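(* Let $H$ be a finite-dimensional cocommutative Hopf algebra over a field $k$ and let $\omega:H\otimes H\otimes H\to k$ be a normalized $3$-cocycle. Let $H^*_\omega$ be the associated quasi-Hopf algebra, $(H^*_\omega)^*\bowtie H^*_\omega$ the diagonal crossed product, and $H^*\#_\sigma H$ $(=D^\omega(H))$ the Hopf crossed product defined by $\omega$. Then the linear map $w:(H^*_\omega)^*\bowtie H^*_\omega\to H^*\#_\sigma H$ defined by $$w(h\bowtie\varphi)=\overline{\omega}_2(h_1)\,\overline{\omega}_3(S(h_2))\;\overline{\omega}_1\,(h_3\rightharpoonup\varphi\leftharpoonup S(h_4))\,\#\,h_5,\qquad h\in H,\ \varphi\in H^*,$$ is an algebra isomorphism, with inverse $W:H^*\#_\sigma H\to (H^*_\omega)^*\bowtie H^*_\omega$ given by $$W(\varphi\# h)=p^1_1(h_1)\,p^2(S(h_2))\,\bigl(\varphi_1\rightharpoonup h_3\leftharpoonup \overline{S}(\varphi_3)\bigr)\bowtie p^1_2\varphi_2,\qquad \varphi\in H^*,\ h\in H,$$ where $p^1\otimes p^2=x^1\otimes x^2\beta\,\overline{S}(x^3)$ with $x^1\otimes x^2\otimes x^3=\omega$ the inverse of the reassociator of $H^*_\omega$.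
   Context: $H$ is a finite-dimensional cocommutative Hopf algebra over $k$ with antipode $S$ (so $S^2=\mathrm{id}$); Sweedler notation $h_1\otimes h_2\otimes\cdots$ for iterated comultiplications is used (the order of the indices is irrelevant by cocommutativity). $H^*$ is the dual commutative Hopf algebra: unit $\varepsilon$, product $(\varphi\psi)(h)=\varphi(h_1)\psi(h_2)$, counit $\varphi\mapsto\varphi(1_H)$, $\Delta(\varphi)=\varphi_1\otimes\varphi_2$ iff $\varphi(hg)=\varphi_1(h)\varphi_2(g)$ for all $h,g\in H$, antipode $\overline{S}(\varphi)=\varphi\circ S$. Regular actions: $(h\rightharpoonup\varphi)(a)=\varphi(ah)$, $(\varphi\leftharpoonup h)(a)=\varphi(ha)$, and $\varphi\rightharpoonup h=\varphi(h_2)h_1$, $h\leftharpoonup\varphi=\varphi(h_1)h_2$, for $a,h\in H$, $\varphi\in H^*$. A normalized $3$-cocycle is a convolution invertible linear map $\omega:H\otimes H\otimes H\to k$ with $\omega(x_1,y_1,z_1t_1)\,\omega(x_2y_2,z_2,t_2)=\omega(y_1,z_1,t_1)\,\omega(x_1,y_2z_2,t_2)\,\omega(x_2,y_3,z_3)$ and $\omega(1,x,y)=\omega(x,1,y)=\omega(x,y,1)=\varepsilon(x)\varepsilon(y)$ for all $x,y,z,t\in H$. View $\omega=\omega_1\otimes\omega_2\otimes\omega_3$ and its convolution inverse $\omega^{-1}=\overline\omega_1\otimes\overline\omega_2\otimes\overline\omega_3$ as elements of $H^*\otimes H^*\otimes H^*$. $H^*_\omega$ is the quasi-Hopf algebra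 $(H^*,\Delta,\varepsilon,\Phi=\omega^{-1},\overline{S},\alpha=\varepsilon,\beta)$, where the algebra structure, $\Delta$, counit and $\overline S$ are those of $H^*$ and $\beta(h)=\omega(h_1,S(h_2),h_3)$. In general a quasi-Hopf algebra is an algebra $K$ with algebra maps $\Delta,\varepsilon$, an invertible $\Phi\in K^{\otimes3}$ with $(\mathrm{id}\otimes\Delta)\Delta=\Phi\cdot(\Delta\otimes\mathrm{id})\Delta\cdot\Phi^{-1}$ satisfying the $3$-cocycle (pentagon) and normalization conditions, $\varepsilon$ being a counit, together with an antipode $(S,\alpha,\beta)$ satisfying $S(h_1)\alpha h_2=\varepsilon(h)\alpha$, $h_1\beta S(h_2)=\varepsilon(h)\beta$, $X^1\beta S(X^2)\alpha X^3=1=S(x^1)\alpha x^2\beta S(x^3)$, where $\Phi=X^1\otimes X^2\otimes X^3$, $\Phi^{-1}=x^1\otimes x^2\otimes x^3=y^1\otimes y^2\otimes y^3$. Diagonal crossed product. For a finite-dimensional quasi-Hopf algebra $K$, $K^*\bowtie K$ is the vector space $K^*\otimes K$ (elements written $a\bowtie b$) with unit $\varepsilon\bowtie1$ and product $$(a\bowtie b)(a'\bowtie b')=\bigl[(\Omega^1\rightharpoonup a\leftharpoonup\Omega^5)(\Omega^2b_{(1,1)}\rightharpoonup a'\leftharpoonup S^{-1}(b_2)\Omega^4)\bigr]\bowtie\Omega^3b_{(1,2)}b',$$ where $b_{(1,1)}\otimes b_{(1,2)}\otimes b_2=(\Delta\otimes\mathrm{id})\Delta(b)$, the product of $K^*$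 is dual to $\Delta$, $\rightharpoonup,\leftharpoonup$ are the regular actions of $K$ on $K^*$, $$\Omega^1\otimes\cdots\otimes\Omega^5=X^1_{(1,1)}y^1x^1\otimes X^1_{(1,2)}y^2x^2_1\otimes X^1_2y^3x^2_2\otimes S^{-1}(f^1X^2x^3)\otimes S^{-1}(f^2X^3),$$ and $f=f^1\otimes f^2=(S\otimes S)(\Delta^{\rm cop}(x^1))\,\gamma\,\Delta(x^2\beta S(x^3))$ with $\gamma=S(X^2x^1_2)\alpha X^3x^2\otimes S(X^1x^1_1)\alpha x^3$ is the Drinfeld twist. For $K=H^*_\omega$, $K^*=H$ as a vector space, the product used on $K^*$ is that of $H$, and the regular actions are $\varphi\rightharpoonup h$, $h\leftharpoonup\varphi$ above. Hopf crossed product $D^\omega(H)=H^*\#_\sigma H$. Put $g\triangleleft x=S(x_1)gx_2$; $\theta(g;x,y)=\omega(g_1,x_1,y_1)\,\omega(x_2,y_2,g_2\triangleleft(x_3y_3))\,\omega^{-1}(x_4,g_3\triangleleft x_5,y_4)$ for $g,x,y\in H$; $\sigma:H\otimes H\to H^*$, $\sigma(x,y)(g)=\theta(g;x,y)$. $H^*\#_\sigma H$ is the vector space $H^*\otimes H$ (elements written $\varphi\# h$) with unit $\varepsilon\#1_H$ and associative product $$(\varphi\#h)(\varphi'\#h')=\varphi\,(h_1\rightharpoonup\varphi'\leftharpoonup S(h_2))\,\sigma(h_3,h'_1)\#h_4h'_2 .$$ *)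

theory Defs
  imports Complex_Main "HOL-Library.Function_Algebras"
begin

section \<open>Vector spaces, algebras and tensor products\<close>

text \<open>
  Dual spaces and tensor products are subspaces of function types, so a vector space is a
  carrier together with a scalar multiplication; addition is always that of the ambient type
  (pointwise on functions, from \<^theory>\<open>HOL-Library.Function_Algebras\<close>).  The pointwise
  multiplication of that theory is never used: all products are explicit.
\<close>

record ('k, 'a) vs =
  carrier :: "'a set"
  scale :: "'k \<Rightarrow> 'a \<Rightarrow> 'a"

record ('k, 'a) alg = "('k, 'a) vs" +
  mult :: "'a \<Rightarrow> 'a \<Rightarrow> 'a"  (infixl \<open>\<cdot>\<index>\<close> 70)
  unit :: 'a  (\<open>\<one>\<index>\<close>)

definition base_field :: "('k::field, 'k) vs" where
  "base_field = \<lparr>carrier = UNIV, scale = (*)\<rparr>"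

definition is_vs :: "('k::field, 'a::ab_group_add, 'm) vs_scheme \<Rightarrow> bool" where
  "is_vs V \<longleftrightarrow> vector_space (scale V) \<and> module.subspace (scale V) (carrier V)"

definition lin_map ::
  "('k::field, 'a::ab_group_add, 'm) vs_scheme \<Rightarrow> ('k, 'b::ab_group_add, 'n) vs_scheme \<Rightarrow> ('a \<Rightarrow> 'b) \<Rightarrow> bool"
where
  "lin_map V W f \<longleftrightarrow>
     (\<forall>x\<in>carrier V. f x \<in> carrier W) \<and>
     (\<forall>x\<in>carrier V. \<forall>y\<in>carrier V. f (x + y) = f x + f y) \<and>
     (\<forall>c. \<forall>x\<in>carrier V. f (scale V c x) = scale W c (f x))"

definition bilin_map ::
  "('k::field, 'a::ab_group_add, 'm) vs_scheme \<Rightarrow> ('k, 'b::ab_group_add, 'n) vs_scheme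
    \<Rightarrow> ('k, 'c::ab_group_add, 'l) vs_scheme \<Rightarrow> ('a \<Rightarrow> 'b \<Rightarrow> 'c) \<Rightarrow> bool"
where
  "bilin_map V W U F \<longleftrightarrow>
     (\<forall>a\<in>carrier V. lin_map W U (F a)) \<and> (\<forall>b\<in>carrier W. lin_map V U (\<lambda>a. F a b))"

text \<open>
  The tensor product, realised as the span of the elementary tensors in the dual of the space
  of bilinear forms: the elementary tensor of \<open>a\<close> and \<open>b\<close> is evaluation of bilinear forms
  at \<open>(a, b)\<close>.
\<close>

type_synonym ('a, 'b, 'k) tensor = "('a \<Rightarrow> 'b \<Rightarrow> 'k) \<Rightarrow> 'k"

definition tens ::
  "('k::field, 'a::ab_group_add, 'm) vs_scheme \<Rightarrow> ('k, 'b::ab_group_add, 'n) vs_scheme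
    \<Rightarrow> 'a \<Rightarrow> 'b \<Rightarrow> ('a, 'b, 'k) tensor"
where
  "tens V W a b = (\<lambda>B. if bilin_map V W base_field B then B a b else 0)"

definition tensor_sp ::
  "('k::field, 'a::ab_group_add, 'm) vs_scheme \<Rightarrow> ('k, 'b::ab_group_add, 'n) vs_scheme
    \<Rightarrow> ('k, ('a, 'b, 'k) tensor) vs"  (infixr \<open>\<otimes>\<close> 75)
where
  "V \<otimes> W = \<lparr>carrier = {\<Sum>(a, b)\<leftarrow>xs. tens V W a b | xs. set xs \<subseteq> carrier V \<times> carrier W},
            scale = (\<lambda>c t B. c * t B)\<rparr>"

text \<open>
  The map out of \<open>V \<otimes> W\<close> induced by \<open>F\<close>, with the tensor as first argument, so that
  \<open>tlift V W t (\<lambda>a b. F a b)\<close> reads as \<open>F (t\<^sub>1, t\<^sub>2)\<close> in Sweedler style.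
  For bilinear \<open>F\<close> the choice of the representing list is irrelevant, see
  \<open>tlift_sum\<close> below.
\<close>

definition tlift ::
  "('k::field, 'a::ab_group_add, 'm) vs_scheme \<Rightarrow> ('k, 'b::ab_group_add, 'n) vs_scheme
    \<Rightarrow> ('a, 'b, 'k) tensor \<Rightarrow> ('a \<Rightarrow> 'b \<Rightarrow> 'c::comm_monoid_add) \<Rightarrow> 'c"
where
  "tlift V W t F =
     (\<Sum>(a, b)\<leftarrow>(SOME xs. set xs \<subseteq> carrier V \<times> carrier W \<and> t = (\<Sum>(a, b)\<leftarrow>xs. tens V W a b)). F a b)"

definition tensor_alg ::
  "('k::field, 'a::ab_group_add, 'm) alg_scheme \<Rightarrow> ('k, 'b::ab_group_add, 'n) alg_scheme
    \<Rightarrow> ('k, ('a, 'b, 'k) tensor) alg"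
where
  "tensor_alg A B = \<lparr>carrier = carrier (A \<otimes> B), scale = scale (A \<otimes> B),
     mult = (\<lambda>t u. tlift A B t (\<lambda>a b. tlift A B u (\<lambda>a' b'. tens A B (a \<cdot>\<^bsub>A\<^esub> a') (b \<cdot>\<^bsub>B\<^esub> b')))),
     unit = tens A B \<one>\<^bsub>A\<^esub> \<one>\<^bsub>B\<^esub>\<rparr>"

definition alg_inverse :: "('k, 'a, 'm) alg_scheme \<Rightarrow> 'a \<Rightarrow> 'a" where
  "alg_inverse A t = (THE u. u \<in> carrier A \<and> t \<cdot>\<^bsub>A\<^esub> u = \<one>\<^bsub>A\<^esub> \<and> u \<cdot>\<^bsub>A\<^esub> t = \<one>\<^bsub>A\<^esub>)"

definition algebra_iso ::
  "('k::field, 'a::ab_group_add, 'm) alg_scheme \<Rightarrow> ('k, 'b::ab_group_add, 'n) alg_scheme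
    \<Rightarrow> ('a \<Rightarrow> 'b) \<Rightarrow> bool"
where
  "algebra_iso A B f \<longleftrightarrow>
     lin_map A B f \<and> bij_betw f (carrier A) (carrier B) \<and>
     (\<forall>x\<in>carrier A. \<forall>y\<in>carrier A. f (x \<cdot>\<^bsub>A\<^esub> y) = f x \<cdot>\<^bsub>B\<^esub> f y) \<and>
     f \<one>\<^bsub>A\<^esub> = \<one>\<^bsub>B\<^esub>"

text \<open>Iterated tensor products of one space are nested to the right.\<close>

definition tens3 where
  "tens3 V a b c = tens V (V \<otimes> V) a (tens V V b c)"

definition tens5 where
  "tens5 V a b c d e =
     tens V (V \<otimes> V \<otimes> V \<otimes> V) a (tens V (V \<otimes> V \<otimes> V) b (tens3 V c d e))"

definition tlift3 where
  "tlift3 V t F = tlift V (V \<otimes> V) t (\<lambda>a u. tlift V V u (\<lambda>b c. F a b c))"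

definition tlift5 where
  "tlift5 V t F =
     tlift V (V \<otimes> V \<otimes> V \<otimes> V) t (\<lambda>a u. tlift V (V \<otimes> V \<otimes> V) u (\<lambda>b v. tlift3 V v (\<lambda>c d e. F a b c d e)))"


subsection \<open>The universal property of the tensor product\<close>

lemma linear_functionals_separate:
  assumes "vector_space (s :: 'k::field \<Rightarrow> 'c::ab_group_add \<Rightarrow> 'c)" and "u \<noteq> 0"
  shows "\<exists>f. Vector_Spaces.linear s (*) f \<and> f u \<noteq> 0"
proof -
  interpret vector_space_pair s "(*) :: 'k \<Rightarrow> 'k \<Rightarrow> 'k"
    by (intro vector_space_pair.intro assms(1)) (unfold_locales, simp_all add: algebra_simps)
  have "vs1.independent {u}" using assms(2) by (simp add: vs1.dependent_single)
  from linear_independent_extend[OF this, of "\<lambda>_. 1"] show ?thesis by auto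
qed

lemma linear_sum_list:
  assumes "Vector_Spaces.linear s t f"
  shows "f (sum_list xs) = (\<Sum>x\<leftarrow>xs. f x)"
proof -
  interpret Vector_Spaces.linear s t f by fact
  show ?thesis by (induction xs) (simp_all add: zero add)
qed

lemma sum_list_fun_apply: "(\<Sum>x\<leftarrow>xs. g x) B = (\<Sum>x\<leftarrow>xs. g x B)"
  by (induction xs) (simp_all add: zero_fun_def plus_fun_def)

lemma tlift_sum:
  assumes U: "is_vs U" and F: "bilin_map V W U F"
    and xs: "set xs \<subseteq> carrier V \<times> carrier W"
  shows "tlift V W (\<Sum>(a, b)\<leftarrow>xs. tens V W a b) F = (\<Sum>(a, b)\<leftarrow>xs. F a b)"
proof -
  let ?T = "\<lambda>ys. \<Sum>(a, b)\<leftarrow>ys. tens V W a b" and ?S = "\<lambda>ys. \<Sum>(a, b)\<leftarrow>ys. F a b"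
  define ys where "ys = (SOME ys. set ys \<subseteq> carrier V \<times> carrier W \<and> ?T xs = ?T ys)"
  have "set ys \<subseteq> carrier V \<times> carrier W \<and> ?T xs = ?T ys"
    unfolding ys_def by (rule someI[of _ xs]) (simp add: xs)
  then have T: "?T xs = ?T ys" by blast
  have vsU: "vector_space (scale U)" using U by (simp add: is_vs_def)
  have "?S ys = ?S xs"
  proof (rule ccontr)
    assume "?S ys \<noteq> ?S xs"
    then obtain f where f: "Vector_Spaces.linear (scale U) (*) f" and ne: "f (?S ys - ?S xs) \<noteq> 0"
      using linear_functionals_separate[OF vsU, of "?S ys - ?S xs"] by auto
    interpret f: Vector_Spaces.linear "scale U" "(*)" f by fact
    have B: "bilin_map V W base_field (\<lambda>a b. f (F a b))"
      using F by (auto simp: bilin_map_def lin_map_def base_field_def f.add f.scale)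
    have "?T zs (\<lambda>a b. f (F a b)) = f (?S zs)" for zs
      by (simp add: sum_list_fun_apply linear_sum_list[OF f] o_def case_prod_unfold tens_def B)
    then have "f (?S xs) = f (?S ys)" using T by metis
    with ne show False by (simp add: f.diff)
  qed
  then show ?thesis by (simp add: tlift_def ys_def)
qed

corollary tlift_tens:
  assumes "is_vs U" and "bilin_map V W U F" and "a \<in> carrier V" and "b \<in> carrier W"
  shows "tlift V W (tens V W a b) F = F a b"
  using tlift_sum[OF assms(1,2), of "[(a, b)]"] assms(3,4) by simp


section \<open>Hopf algebras\<close>

record ('k, 'a) hopf = "('k, 'a) alg" +
  comult :: "'a \<Rightarrow> ('a, 'a, 'k) tensor"
  counit :: "'a \<Rightarrow> 'k"
  antipode :: "'a \<Rightarrow> 'a"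

text \<open>\<open>cop\<^sub>n H h (\<lambda>h\<^sub>1 \<dots> h\<^sub>n. F)\<close> is Sweedler notation for the \<open>n\<close>-fold comultiplication.\<close>

definition cop2 where
  "cop2 H h F = tlift H H (comult H h) (\<lambda>h1 h2. F h1 h2)"

definition cop3 where
  "cop3 H h F = cop2 H h (\<lambda>h1 u. cop2 H u (\<lambda>h2 h3. F h1 h2 h3))"

definition cop4 where
  "cop4 H h F = cop2 H h (\<lambda>h1 u. cop3 H u (\<lambda>h2 h3 h4. F h1 h2 h3 h4))"

definition cop5 where
  "cop5 H h F = cop2 H h (\<lambda>h1 u. cop4 H u (\<lambda>h2 h3 h4 h5. F h1 h2 h3 h4 h5))"

definition hopf_struct ::
  "('k::field \<Rightarrow> 'h::ring_1 \<Rightarrow> 'h) \<Rightarrow> ('h \<Rightarrow> ('h, 'h, 'k) tensor) \<Rightarrow> ('h \<Rightarrow> 'k) \<Rightarrow> ('h \<Rightarrow> 'h) \<Rightarrow> ('k, 'h) hopf"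
where
  "hopf_struct scl \<Delta> \<epsilon> S =
     \<lparr>carrier = UNIV, scale = scl, mult = (*), unit = 1, comult = \<Delta>, counit = \<epsilon>, antipode = S\<rparr>"

locale hopf_algebra = vector_space scl
  for scl :: "'k::field \<Rightarrow> 'h::ring_1 \<Rightarrow> 'h" +
  fixes \<Delta> :: "'h \<Rightarrow> ('h, 'h, 'k) tensor" and \<epsilon> :: "'h \<Rightarrow> 'k" and S :: "'h \<Rightarrow> 'h"
    and H :: "('k, 'h) hopf"
  defines "H \<equiv> hopf_struct scl \<Delta> \<epsilon> S"
  assumes scl_mult_left: "scl c (x * y) = scl c x * y"
    and scl_mult_right: "scl c (x * y) = x * scl c y"
    and comult_lin: "lin_map H (H \<otimes> H) \<Delta>"
    and counit_lin: "Vector_Spaces.linear scl (*) \<epsilon>"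
    and antipode_lin: "Vector_Spaces.linear scl scl S"
    and coassoc: "cop2 H x (\<lambda>a u. cop2 H u (\<lambda>b c. tens3 H a b c))
                  = cop2 H x (\<lambda>u c. cop2 H u (\<lambda>a b. tens3 H a b c))"
    and counit_left: "cop2 H x (\<lambda>x1 x2. scl (\<epsilon> x1) x2) = x"
    and counit_right: "cop2 H x (\<lambda>x1 x2. scl (\<epsilon> x2) x1) = x"
    and comult_mult: "\<Delta> (x * y) = \<Delta> x \<cdot>\<^bsub>tensor_alg H H\<^esub> \<Delta> y"
    and comult_one: "\<Delta> 1 = \<one>\<^bsub>tensor_alg H H\<^esub>"
    and counit_mult: "\<epsilon> (x * y) = \<epsilon> x * \<epsilon> y"
    and counit_one: "\<epsilon> 1 = 1"
    and antipode_left: "cop2 H x (\<lambda>x1 x2. S x1 * x2) = scl (\<epsilon> x) 1"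
    and antipode_right: "cop2 H x (\<lambda>x1 x2. x1 * S x2) = scl (\<epsilon> x) 1"

locale fd_cocommutative_hopf_algebra =
  hopf_algebra scl \<Delta> \<epsilon> S + finite_dimensional_vector_space scl Basis
  for scl :: "'k::field \<Rightarrow> 'h::ring_1 \<Rightarrow> 'h" and Basis \<Delta> \<epsilon> S +
  assumes cocommutative: "cop2 H x (\<lambda>x1 x2. tens H H x2 x1) = \<Delta> x"


section \<open>Three-cocycles\<close>

definition trilinear_form :: "('k::field, 'h::ab_group_add, 'm) vs_scheme \<Rightarrow> ('h \<Rightarrow> 'h \<Rightarrow> 'h \<Rightarrow> 'k) \<Rightarrow> bool" where
  "trilinear_form H \<omega> \<longleftrightarrow>
     (\<forall>y z. Vector_Spaces.linear (scale H) (*) (\<lambda>x. \<omega> x y z)) \<and>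
     (\<forall>x z. Vector_Spaces.linear (scale H) (*) (\<lambda>y. \<omega> x y z)) \<and>
     (\<forall>x y. Vector_Spaces.linear (scale H) (*) (\<lambda>z. \<omega> x y z))"

definition conv3 ::
  "('k::field, 'h::ab_group_add) hopf \<Rightarrow> ('h \<Rightarrow> 'h \<Rightarrow> 'h \<Rightarrow> 'k) \<Rightarrow> ('h \<Rightarrow> 'h \<Rightarrow> 'h \<Rightarrow> 'k)
    \<Rightarrow> 'h \<Rightarrow> 'h \<Rightarrow> 'h \<Rightarrow> 'k"
where
  "conv3 H \<omega> \<eta> x y z =
     cop2 H x (\<lambda>x1 x2. cop2 H y (\<lambda>y1 y2. cop2 H z (\<lambda>z1 z2. \<omega> x1 y1 z1 * \<eta> x2 y2 z2)))"

definition is_conv_inverse3 where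
  "is_conv_inverse3 H \<omega> \<eta> \<longleftrightarrow> trilinear_form H \<eta> \<and>
     (\<forall>x y z. conv3 H \<omega> \<eta> x y z = counit H x * counit H y * counit H z) \<and>
     (\<forall>x y z. conv3 H \<eta> \<omega> x y z = counit H x * counit H y * counit H z)"

definition conv_inverse3 where
  "conv_inverse3 H \<omega> = (THE \<eta>. is_conv_inverse3 H \<omega> \<eta>)"

definition normalized_3_cocycle ::
  "('k::field, 'h::ab_group_add) hopf \<Rightarrow> ('h \<Rightarrow> 'h \<Rightarrow> 'h \<Rightarrow> 'k) \<Rightarrow> bool"
where
  "normalized_3_cocycle H \<omega> \<longleftrightarrow>
     trilinear_form H \<omega> \<and> (\<exists>\<eta>. is_conv_inverse3 H \<omega> \<eta>) \<and>
     (\<forall>x y z t.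
        cop2 H x (\<lambda>x1 x2. cop2 H y (\<lambda>y1 y2. cop2 H z (\<lambda>z1 z2. cop2 H t (\<lambda>t1 t2.
          \<omega> x1 y1 (z1 \<cdot>\<^bsub>H\<^esub> t1) * \<omega> (x2 \<cdot>\<^bsub>H\<^esub> y2) z2 t2))))
        = cop2 H x (\<lambda>x1 x2. cop3 H y (\<lambda>y1 y2 y3. cop3 H z (\<lambda>z1 z2 z3. cop2 H t (\<lambda>t1 t2.
          \<omega> y1 z1 t1 * \<omega> x1 (y2 \<cdot>\<^bsub>H\<^esub> z2) t2 * \<omega> x2 y3 z3))))) \<and>
     (\<forall>x y. \<omega> \<one>\<^bsub>H\<^esub> x y = counit H x * counit H y \<and>
            \<omega> x \<one>\<^bsub>H\<^esub> y = counit H x * counit H y \<and>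
            \<omega> x y \<one>\<^bsub>H\<^esub> = counit H x * counit H y)"


section \<open>The dual and its regular actions\<close>

text \<open>From here on \<open>H\<close> is a Hopf algebra whose carrier is the whole type.\<close>

definition conv :: "('k::field, 'h::ab_group_add) hopf \<Rightarrow> ('h \<Rightarrow> 'k) \<Rightarrow> ('h \<Rightarrow> 'k) \<Rightarrow> 'h \<Rightarrow> 'k" where
  "conv H \<phi> \<psi> h = cop2 H h (\<lambda>h1 h2. \<phi> h1 * \<psi> h2)"

definition dual_alg :: "('k::field, 'h::ab_group_add) hopf \<Rightarrow> ('k, 'h \<Rightarrow> 'k) alg" where
  "dual_alg H = \<lparr>carrier = {\<phi>. Vector_Spaces.linear (scale H) (*) \<phi>},
                 scale = (\<lambda>c \<phi> h. c * \<phi> h), mult = conv H, unit = counit H\<rparr>"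

text \<open>Bilinear and trilinear forms on \<open>H\<close> viewed as elements of tensor powers of the dual of \<open>H\<close>.\<close>

definition form2_tensor where
  "form2_tensor H B =
     (THE t. t \<in> carrier (dual_alg H \<otimes> dual_alg H) \<and>
             (\<forall>x y. tlift (dual_alg H) (dual_alg H) t (\<lambda>\<phi> \<psi>. \<phi> x * \<psi> y) = B x y))"

definition form3_tensor where
  "form3_tensor H B =
     (THE t. t \<in> carrier (dual_alg H \<otimes> dual_alg H \<otimes> dual_alg H) \<and>
             (\<forall>x y z. tlift3 (dual_alg H) t (\<lambda>\<phi> \<psi> \<chi>. \<phi> x * \<psi> y * \<chi> z) = B x y z))"

definition dual_hopf :: "('k::field, 'h::ab_group_add) hopf \<Rightarrow> ('k, 'h \<Rightarrow> 'k) hopf" where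
  "dual_hopf H =
     \<lparr>carrier = carrier (dual_alg H), scale = scale (dual_alg H),
      mult = mult (dual_alg H), unit = unit (dual_alg H),
      comult = (\<lambda>\<phi>. form2_tensor H (\<lambda>h g. \<phi> (h \<cdot>\<^bsub>H\<^esub> g))),
      counit = (\<lambda>\<phi>. \<phi> \<one>\<^bsub>H\<^esub>),
      antipode = (\<lambda>\<phi> h. \<phi> (antipode H h))\<rparr>"

text \<open>\<open>h \<rightharpoonup> \<phi>\<close> and \<open>\<phi> \<leftharpoonup> h\<close> in the dual, \<open>\<phi> \<rightharpoonup> h\<close> and \<open>h \<leftharpoonup> \<phi>\<close> in \<open>H\<close>:\<close>

definition lact_dual where "lact_dual H h \<phi> = (\<lambda>a. \<phi> (a \<cdot>\<^bsub>H\<^esub> h))"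
definition ract_dual where "ract_dual H \<phi> h = (\<lambda>a. \<phi> (h \<cdot>\<^bsub>H\<^esub> a))"
definition lact where "lact H \<phi> h = cop2 H h (\<lambda>h1 h2. scale H (\<phi> h2) h1)"
definition ract where "ract H h \<phi> = cop2 H h (\<lambda>h1 h2. scale H (\<phi> h1) h2)"


section \<open>Quasi-Hopf algebras and the diagonal crossed product\<close>

record ('k, 'a) quasi_hopf = "('k, 'a) hopf" +
  reassoc :: "('a, ('a, 'a, 'k) tensor, 'k) tensor"
  alpha :: 'a
  beta :: 'a

definition reassoc_inv where
  "reassoc_inv K = alg_inverse (tensor_alg K (tensor_alg K K)) (reassoc K)"

definition antipode_inv where
  "antipode_inv K = inv_into (carrier K) (antipode K)"

text \<open>The elements \<open>\<gamma>\<close>, \<open>f\<close> (the Drinfeld twist) and \<open>\<Omega>\<close> of a quasi-Hopf algebra.\<close>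

definition gamma_elt :: "('k::field, 'a::ab_group_add, 'm) quasi_hopf_scheme \<Rightarrow> ('a, 'a, 'k) tensor" where
  "gamma_elt K =
     tlift3 K (reassoc K) (\<lambda>X1 X2 X3. tlift3 K (reassoc_inv K) (\<lambda>x1 x2 x3. cop2 K x1 (\<lambda>x11 x12.
       tens K K (antipode K (X2 \<cdot>\<^bsub>K\<^esub> x12) \<cdot>\<^bsub>K\<^esub> alpha K \<cdot>\<^bsub>K\<^esub> X3 \<cdot>\<^bsub>K\<^esub> x2)
                (antipode K (X1 \<cdot>\<^bsub>K\<^esub> x11) \<cdot>\<^bsub>K\<^esub> alpha K \<cdot>\<^bsub>K\<^esub> x3))))"

definition drinfeld_twist :: "('k::field, 'a::ab_group_add, 'm) quasi_hopf_scheme \<Rightarrow> ('a, 'a, 'k) tensor" where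
  "drinfeld_twist K =
     tlift3 K (reassoc_inv K) (\<lambda>x1 x2 x3.
       cop2 K x1 (\<lambda>x11 x12. tens K K (antipode K x12) (antipode K x11))
       \<cdot>\<^bsub>tensor_alg K K\<^esub> gamma_elt K
       \<cdot>\<^bsub>tensor_alg K K\<^esub> comult K (x2 \<cdot>\<^bsub>K\<^esub> beta K \<cdot>\<^bsub>K\<^esub> antipode K x3))"

definition Omega_elt where
  "Omega_elt K =
     tlift3 K (reassoc K) (\<lambda>X1 X2 X3.
     tlift3 K (reassoc_inv K) (\<lambda>x1 x2 x3.
     tlift3 K (reassoc_inv K) (\<lambda>y1 y2 y3.
     tlift K K (drinfeld_twist K) (\<lambda>f1 f2.
     cop2 K X1 (\<lambda>X1_1 X1_2. cop2 K X1_1 (\<lambda>X1_11 X1_12. cop2 K x2 (\<lambda>x2_1 x2_2.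
       tens5 K (X1_11 \<cdot>\<^bsub>K\<^esub> y1 \<cdot>\<^bsub>K\<^esub> x1)
               (X1_12 \<cdot>\<^bsub>K\<^esub> y2 \<cdot>\<^bsub>K\<^esub> x2_1)
               (X1_2 \<cdot>\<^bsub>K\<^esub> y3 \<cdot>\<^bsub>K\<^esub> x2_2)
               (antipode_inv K (f1 \<cdot>\<^bsub>K\<^esub> X2 \<cdot>\<^bsub>K\<^esub> x3))
               (antipode_inv K (f2 \<cdot>\<^bsub>K\<^esub> X3)))))))))"

text \<open>
  \<open>diag_crossed_product K A la ra\<close> is the diagonal crossed product of the dual of \<open>K\<close> with \<open>K\<close>,
  where the dual enters through a model: \<open>A\<close> is its underlying space with the product dual to the
  comultiplication of \<open>K\<close> (and with unit the counit of \<open>K\<close>), and \<open>la\<close>, \<open>ra\<close> are the left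
  and right regular actions of \<open>K\<close> on it.  This allows using \<open>H\<close> itself as the dual of the dual
  of \<open>H\<close>.
\<close>

definition diag_crossed_product ::
  "('k::field, 'b::ab_group_add, 'n) quasi_hopf_scheme \<Rightarrow> ('k, 'a::ab_group_add, 'm) alg_scheme
    \<Rightarrow> ('b \<Rightarrow> 'a \<Rightarrow> 'a) \<Rightarrow> ('a \<Rightarrow> 'b \<Rightarrow> 'a) \<Rightarrow> ('k, ('a, 'b, 'k) tensor) alg"
where
  "diag_crossed_product K A la ra =
     \<lparr>carrier = carrier (A \<otimes> K), scale = scale (A \<otimes> K),
      mult = (\<lambda>t t'. tlift A K t (\<lambda>a b. tlift A K t' (\<lambda>a' b'.
        tlift5 K (Omega_elt K) (\<lambda>\<Omega>1 \<Omega>2 \<Omega>3 \<Omega>4 \<Omega>5.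
        cop2 K b (\<lambda>b1 b2. cop2 K b1 (\<lambda>b11 b12.
          tens A K
            (ra (la \<Omega>1 a) \<Omega>5 \<cdot>\<^bsub>A\<^esub> ra (la (\<Omega>2 \<cdot>\<^bsub>K\<^esub> b11) a') (antipode_inv K b2 \<cdot>\<^bsub>K\<^esub> \<Omega>4))
            (\<Omega>3 \<cdot>\<^bsub>K\<^esub> b12 \<cdot>\<^bsub>K\<^esub> b'))))))),
      unit = tens A K \<one>\<^bsub>A\<^esub> \<one>\<^bsub>K\<^esub>\<rparr>"

definition beta_form :: "('k::field, 'h::ab_group_add) hopf \<Rightarrow> ('h \<Rightarrow> 'h \<Rightarrow> 'h \<Rightarrow> 'k) \<Rightarrow> 'h \<Rightarrow> 'k" where
  "beta_form H \<omega> h = cop3 H h (\<lambda>h1 h2 h3. \<omega> h1 (antipode H h2) h3)"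

definition dual_quasi_hopf ::
  "('k::field, 'h::ab_group_add) hopf \<Rightarrow> ('h \<Rightarrow> 'h \<Rightarrow> 'h \<Rightarrow> 'k) \<Rightarrow> ('k, 'h \<Rightarrow> 'k) quasi_hopf"
where
  "dual_quasi_hopf H \<omega> =
     \<lparr>carrier = carrier (dual_hopf H), scale = scale (dual_hopf H),
      mult = mult (dual_hopf H), unit = unit (dual_hopf H),
      comult = comult (dual_hopf H), counit = counit (dual_hopf H), antipode = antipode (dual_hopf H),
      reassoc = form3_tensor H (conv_inverse3 H \<omega>),
      alpha = counit H, beta = beta_form H \<omega>\<rparr>"

definition diag_crossed_product_dual ::
  "('k::field, 'h::ab_group_add) hopf \<Rightarrow> ('h \<Rightarrow> 'h \<Rightarrow> 'h \<Rightarrow> 'k) \<Rightarrow> ('k, ('h, 'h \<Rightarrow> 'k, 'k) tensor) alg"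
where
  "diag_crossed_product_dual H \<omega> = diag_crossed_product (dual_quasi_hopf H \<omega>) H (lact H) (ract H)"


section \<open>The Hopf crossed product\<close>

definition adj where
  "adj H g x = cop2 H x (\<lambda>x1 x2. antipode H x1 \<cdot>\<^bsub>H\<^esub> g \<cdot>\<^bsub>H\<^esub> x2)"

definition theta ::
  "('k::field, 'h::ab_group_add) hopf \<Rightarrow> ('h \<Rightarrow> 'h \<Rightarrow> 'h \<Rightarrow> 'k) \<Rightarrow> 'h \<Rightarrow> 'h \<Rightarrow> 'h \<Rightarrow> 'k"
where
  "theta H \<omega> g x y =
     cop3 H g (\<lambda>g1 g2 g3. cop5 H x (\<lambda>x1 x2 x3 x4 x5. cop4 H y (\<lambda>y1 y2 y3 y4.
       \<omega> g1 x1 y1 * \<omega> x2 y2 (adj H g2 (x3 \<cdot>\<^bsub>H\<^esub> y3)) * conv_inverse3 H \<omega> x4 (adj H g3 x5) y4)))"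

definition sigma where
  "sigma H \<omega> x y = (\<lambda>g. theta H \<omega> g x y)"

definition hopf_crossed_product ::
  "('k::field, 'h::ab_group_add) hopf \<Rightarrow> ('h \<Rightarrow> 'h \<Rightarrow> 'h \<Rightarrow> 'k) \<Rightarrow> ('k, ('h \<Rightarrow> 'k, 'h, 'k) tensor) alg"
where
  "hopf_crossed_product H \<omega> =
     \<lparr>carrier = carrier (dual_alg H \<otimes> H), scale = scale (dual_alg H \<otimes> H),
      mult = (\<lambda>t t'. tlift (dual_alg H) H t (\<lambda>\<phi> h. tlift (dual_alg H) H t' (\<lambda>\<phi>' h'.
        cop4 H h (\<lambda>h1 h2 h3 h4. cop2 H h' (\<lambda>h'1 h'2.
          tens (dual_alg H) H
            (\<phi> \<cdot>\<^bsub>dual_alg H\<^esub> ract_dual H (lact_dual H h1 \<phi>') (antipode H h2) \<cdot>\<^bsub>dual_alg H\<^esub> sigma H \<omega> h3 h'1)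
            (h4 \<cdot>\<^bsub>H\<^esub> h'2)))))),
      unit = tens (dual_alg H) H (counit H) \<one>\<^bsub>H\<^esub>\<rparr>"


section \<open>The two maps\<close>

definition w_map ::
  "('k::field, 'h::ab_group_add) hopf \<Rightarrow> ('h \<Rightarrow> 'h \<Rightarrow> 'h \<Rightarrow> 'k)
    \<Rightarrow> ('h, 'h \<Rightarrow> 'k, 'k) tensor \<Rightarrow> ('h \<Rightarrow> 'k, 'h, 'k) tensor"
where
  "w_map H \<omega> t =
     tlift H (dual_alg H) t (\<lambda>h \<phi>.
       tlift3 (dual_alg H) (form3_tensor H (conv_inverse3 H \<omega>)) (\<lambda>\<omega>1 \<omega>2 \<omega>3.
       cop5 H h (\<lambda>h1 h2 h3 h4 h5.
         tens (dual_alg H) H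
           (scale (dual_alg H) (\<omega>2 h1 * \<omega>3 (antipode H h2))
             (\<omega>1 \<cdot>\<^bsub>dual_alg H\<^esub> ract_dual H (lact_dual H h3 \<phi>) (antipode H h4)))
           h5)))"

definition p_elt ::
  "('k::field, 'h::ab_group_add) hopf \<Rightarrow> ('h \<Rightarrow> 'h \<Rightarrow> 'h \<Rightarrow> 'k) \<Rightarrow> ('h \<Rightarrow> 'k, 'h \<Rightarrow> 'k, 'k) tensor"
where
  "p_elt H \<omega> =
     tlift3 (dual_alg H) (form3_tensor H \<omega>) (\<lambda>x1 x2 x3.
       tens (dual_alg H) (dual_alg H) x1
         (x2 \<cdot>\<^bsub>dual_alg H\<^esub> beta_form H \<omega> \<cdot>\<^bsub>dual_alg H\<^esub> antipode (dual_hopf H) x3))"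

definition W_map ::
  "('k::field, 'h::ab_group_add) hopf \<Rightarrow> ('h \<Rightarrow> 'h \<Rightarrow> 'h \<Rightarrow> 'k)
    \<Rightarrow> ('h \<Rightarrow> 'k, 'h, 'k) tensor \<Rightarrow> ('h, 'h \<Rightarrow> 'k, 'k) tensor"
where
  "W_map H \<omega> t =
     tlift (dual_alg H) H t (\<lambda>\<phi> h.
       tlift (dual_alg H) (dual_alg H) (p_elt H \<omega>) (\<lambda>p1 p2.
       cop2 (dual_hopf H) p1 (\<lambda>p1_1 p1_2.
       cop3 (dual_hopf H) \<phi> (\<lambda>\<phi>1 \<phi>2 \<phi>3.
       cop3 H h (\<lambda>h1 h2 h3.
         tens H (dual_alg H)
           (scale H (p1_1 h1 * p2 (antipode H h2))
             (ract H (lact H \<phi>1 h3) (antipode (dual_hopf H) \<phi>3)))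
           (p1_2 \<cdot>\<^bsub>dual_alg H\<^esub> \<phi>2))))))"

end

theory Submission
  imports Defs
begin

text \<open>
  A finite-dimensional cocommutative Hopf algebra \<open>H\<close> is a group, seen through points.  Let \<open>R\<close> be a
  commutative algebra and call an algebra map from the dual of \<open>H\<close> to \<open>R\<close> a point.  A point is the
  same thing as a grouplike element of \<open>R \<otimes> H\<close>, so the points form a group, with inverse given by
  the antipode, and a multilinear form on \<open>H\<close> can be evaluated at points.  A Sweedler sum
  \<open>h\<^sub>1 \<otimes> h\<^sub>2 \<otimes> \<dots>\<close> becomes a repeated argument, the convolution of forms becomes the product of their
  values, and the cocycle identity for \<open>\<omega>\<close> becomes the identity of a normalized group cocycle,
  \<open>\<omega>(f,g,hk) \<omega>(fg,h,k) = \<omega>(g,h,k) \<omega>(f,gh,k) \<omega>(f,g,h)\<close>, with values in the units of \<open>R\<close>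
  (lemma \<open>om_cocycle\<close>).

  Nothing is lost in this translation.  For \<open>R\<close> take the trilinear forms on \<open>H\<close> under convolution,
  that is, the third tensor power of the dual, which is commutative because \<open>H\<close> is cocommutative.
  It has three coordinate points, and the value of a trilinear form at them is the form itself
  (lemma \<open>tri_generic\<close>).  Every identity of trilinear forms can therefore be checked on points, and
  all the identities needed here involve at most three variables.

  On points the data of the theorem are explicit; let \<open>\<eta>\<close> be the inverse of \<open>\<omega>\<close>.  The Drinfeld twist
  of the quasi-Hopf algebra is just \<open>\<gamma>\<close>, its other factors cancel (\<open>twist_on_points\<close>), and \<open>\<Omega>\<close> is a
  product of five values of \<open>\<omega>\<close> and \<open>\<eta>\<close> (\<open>Omega_on_points\<close>).  If \<open>\<phi> # h\<close> and \<open>h \<bowtie> \<phi>\<close> are thought of as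
  a function of \<open>a\<close> placed at the group element \<open>h\<close>, then with \<open>p(x,y) = \<omega>(x,y,y\<^sup>-\<^sup>1) \<omega>(y,y\<^sup>-\<^sup>1,y)\<close>
  the two maps are
   \<^item> \<open>w(h \<bowtie> \<phi>) = (a \<mapsto> \<eta>(a,h,h\<^sup>-\<^sup>1) \<phi>(h\<^sup>-\<^sup>1ah)) # h\<close>,
   \<^item> \<open>W(\<phi> # h) = h \<bowtie> (a \<mapsto> p(ha,h\<^sup>-\<^sup>1) \<phi>(hah\<^sup>-\<^sup>1))\<close>,

  and with \<open>b = x\<^sup>-\<^sup>1ax\<close> the two products are
   \<^item> \<open>(x \<bowtie> \<phi>)(y \<bowtie> \<phi>') = xy \<bowtie> (c \<mapsto> \<Omega>(x,y,c,y,x) \<phi>(ycy\<^sup>-\<^sup>1) \<phi>'(c))\<close>,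
   \<^item> \<open>(\<psi> # x)(\<psi>' # y) = (a \<mapsto> \<psi>(a) \<psi>'(b) \<theta>(a;x,y)) # xy\<close>.

  Both composites of \<open>w\<close> and \<open>W\<close> reduce to one instance of the cocycle identity, at
  \<open>(f,h\<^sup>-\<^sup>1,h,h\<^sup>-\<^sup>1)\<close> (lemma \<open>om_et_inverse_map\<close>), and multiplicativity of \<open>w\<close> to three instances, at
  \<open>(x,b,y,y\<^sup>-\<^sup>1)\<close>, \<open>(a,x,y,y\<^sup>-\<^sup>1)\<close> and \<open>(a,xy,y\<^sup>-\<^sup>1,x\<^sup>-\<^sup>1)\<close> (lemma \<open>multiplicative_pt\<close>).  That \<open>w\<close> preserves
  the unit is the normalization of \<open>\<omega>\<close>.

  The remaining work is the translation itself: a tensor over \<open>H\<close> and its dual is determined by its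
  values on products \<open>\<phi>(a) \<chi>(h)\<close>, so the maps and products are first rewritten as Sweedler sums of such
  values, and these sums are then evaluated at points.
\<close>

section \<open>Calculus of tensors\<close>

text \<open>
  By definition \<^const>\<open>tlift\<close> is a finite sum over a representing list, so it commutes with every
  additive operation.
\<close>

lemma tlift_hom:
  fixes f :: "'c::comm_monoid_add \<Rightarrow> 'd::comm_monoid_add"
  assumes "f 0 = 0" and "\<And>x y. f (x + y) = f x + f y"
  shows "f (tlift V W t F) = tlift V W t (\<lambda>a b. f (F a b))"
proof -
  have "f (\<Sum>(a, b)\<leftarrow>xs. F a b) = (\<Sum>(a, b)\<leftarrow>xs. f (F a b))" for xs
    by (induction xs) (auto simp: assms)
  then show ?thesis by (simp add: tlift_def)
qed

lemma tlift_mult_left: "(c :: 'c::semiring_0) * tlift V W t F = tlift V W t (\<lambda>a b. c * F a b)"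
  by (rule tlift_hom) (simp_all add: distrib_left)

lemma tlift_mult_right: "tlift V W t F * (c :: 'c::semiring_0) = tlift V W t (\<lambda>a b. F a b * c)"
  by (rule tlift_hom[where f = "\<lambda>x. x * c"]) (simp_all add: distrib_right)

lemma tlift_add: "tlift V W t (\<lambda>a b. F a b + G a b) = tlift V W t F + tlift V W t G"
proof -
  have "(\<Sum>(a, b)\<leftarrow>xs. F a b + G a b) = (\<Sum>(a, b)\<leftarrow>xs. F a b) + (\<Sum>(a, b)\<leftarrow>xs. G a b)" for xs
    by (induction xs) (auto simp: ac_simps)
  then show ?thesis by (simp add: tlift_def)
qed

lemma tlift_zero: "tlift V W t (\<lambda>a b. 0) = 0"
proof -
  have "(\<Sum>(a, b)\<leftarrow>xs. 0) = 0" for xs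
    by (induction xs) auto
  then show ?thesis unfolding tlift_def by blast
qed

lemma tlift_swap:
  "tlift V W t (\<lambda>a b. tlift V' W' u (\<lambda>c d. F a b c d)) = tlift V' W' u (\<lambda>c d. tlift V W t (\<lambda>a b. F a b c d))"
proof -
  have "(\<Sum>(a, b)\<leftarrow>xs. tlift V' W' u (\<lambda>c d. F a b c d)) = tlift V' W' u (\<lambda>c d. \<Sum>(a, b)\<leftarrow>xs. F a b c d)" for xs
    by (induction xs) (auto simp: tlift_zero tlift_add)
  then show ?thesis by (simp add: tlift_def[of V W])
qed

lemma tlift_fun_apply: "tlift V W t F x = tlift V W t (\<lambda>a b. F a b x)"
  by (rule tlift_hom[where f = "\<lambda>F. F x"]) simp_all

lemma tlift_sum_set: "tlift V W t (\<lambda>a b. \<Sum>i\<in>I. F i a b) = (\<Sum>i\<in>I. tlift V W t (F i))"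
  by (induction I rule: infinite_finite_induct) (simp_all add: tlift_zero tlift_add)

definition span_closed :: "('k::field, 'a::ab_group_add, 'm) vs_scheme \<Rightarrow> bool" where
  "span_closed V \<longleftrightarrow> 0 \<in> carrier V \<and> (\<forall>x\<in>carrier V. \<forall>y\<in>carrier V. x + y \<in> carrier V) \<and>
     (\<forall>c. \<forall>x\<in>carrier V. scale V c x \<in> carrier V)"

lemma is_vs_span_closed:
  assumes "is_vs V"
  shows "span_closed V"
proof -
  interpret vector_space "scale V" using assms by (simp add: is_vs_def)
  have "subspace (carrier V)" using assms by (simp add: is_vs_def)
  then show ?thesis by (auto simp: span_closed_def intro: subspace_0 subspace_add subspace_scale)
qed

text \<open>
  The representing list chosen in the definition of \<^const>\<open>tlift\<close>.
\<close>

definition tensor_list ::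
  "('k::field, 'a::ab_group_add, 'm) vs_scheme \<Rightarrow> ('k, 'b::ab_group_add, 'n) vs_scheme
    \<Rightarrow> ('a, 'b, 'k) tensor \<Rightarrow> ('a \<times> 'b) list" where
  "tensor_list V W t = (SOME xs. set xs \<subseteq> carrier V \<times> carrier W \<and> t = (\<Sum>(a, b)\<leftarrow>xs. tens V W a b))"

lemma tlift_tensor_list: "tlift V W t F = (\<Sum>(a, b)\<leftarrow>tensor_list V W t. F a b)"
  by (simp add: tlift_def tensor_list_def)

lemma tensor_list:
  assumes "t \<in> carrier (V \<otimes> W)"
  shows tensor_list_mem: "set (tensor_list V W t) \<subseteq> carrier V \<times> carrier W"
    and tensor_list_sum: "t = (\<Sum>(a, b)\<leftarrow>tensor_list V W t. tens V W a b)"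
proof -
  have "\<exists>xs. set xs \<subseteq> carrier V \<times> carrier W \<and> t = (\<Sum>(a, b)\<leftarrow>xs. tens V W a b)"
    using assms by (auto simp: tensor_sp_def)
  from someI_ex[OF this, folded tensor_list_def]
  show "set (tensor_list V W t) \<subseteq> carrier V \<times> carrier W" "t = (\<Sum>(a, b)\<leftarrow>tensor_list V W t. tens V W a b)"
    by auto
qed

lemma tlift_cong_mem:
  assumes "t \<in> carrier (V \<otimes> W)" "\<And>a b. a \<in> carrier V \<Longrightarrow> b \<in> carrier W \<Longrightarrow> F a b = G a b"
  shows "tlift V W t F = tlift V W t G"
proof -
  have "map (\<lambda>(a, b). F a b) (tensor_list V W t) = map (\<lambda>(a, b). G a b) (tensor_list V W t)"
    by (rule map_cong[OF refl]) (use tensor_list_mem[OF assms(1)] in \<open>auto simp: subset_iff assms(2)\<close>)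
  then show ?thesis by (simp only: tlift_tensor_list)
qed

lemma tlift_closed:
  assumes "t \<in> carrier (V \<otimes> W)" and F: "\<And>a b. a \<in> carrier V \<Longrightarrow> b \<in> carrier W \<Longrightarrow> F a b \<in> A"
    and A: "0 \<in> A" "\<And>x y. x \<in> A \<Longrightarrow> y \<in> A \<Longrightarrow> x + y \<in> A"
  shows "tlift V W t F \<in> A"
proof -
  have "(\<Sum>(a, b)\<leftarrow>xs. F a b) \<in> A" if "set xs \<subseteq> carrier V \<times> carrier W" for xs
    using that by (induction xs) (use A F in auto)
  from this[OF tensor_list_mem[OF assms(1)]] show ?thesis by (simp only: tlift_tensor_list)
qed

lemma is_vs_base_field: "is_vs base_field"
proof -
  interpret vector_space "(*) :: 'a::field \<Rightarrow> 'a \<Rightarrow> 'a"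
    by unfold_locales (simp_all add: algebra_simps)
  show ?thesis by (simp add: is_vs_def base_field_def vector_space_axioms)
qed

text \<open>
  Tensors being functionals on bilinear forms, the Sweedler expression of a scalar-valued form needs
  no representing list.
\<close>

lemma tlift_eq_apply:
  assumes "t \<in> carrier (V \<otimes> W)" "bilin_map V W base_field B"
  shows "tlift V W t B = t B"
  by (subst (2) tensor_list_sum[OF assms(1)])
    (simp add: tlift_tensor_list sum_list_fun_apply tens_def assms(2) case_prod_unfold o_def)

lemma tens_eq_apply: "bilin_map V W base_field B \<Longrightarrow> tens V W a b B = B a b"
  by (simp add: tens_def)

lemma tensor_eqI:
  assumes "t \<in> carrier (V \<otimes> W)" "u \<in> carrier (V \<otimes> W)"
    and "\<And>B. bilin_map V W base_field B \<Longrightarrow> t B = u B"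
  shows "t = u"
proof
  fix B
  have off: "s B = 0" if s: "s \<in> carrier (V \<otimes> W)" and nB: "\<not> bilin_map V W base_field B" for s
    by (subst tensor_list_sum[OF s]) (simp add: sum_list_fun_apply tens_def nB case_prod_unfold o_def)
  show "t B = u B"
    using assms off[of t] off[of u] by (cases "bilin_map V W base_field B") simp_all
qed

lemma tens_carrier: "a \<in> carrier V \<Longrightarrow> b \<in> carrier W \<Longrightarrow> tens V W a b \<in> carrier (V \<otimes> W)"
  by (auto simp: tensor_sp_def intro!: exI[of _ "[(a, b)]"])

lemma tensor_zero_carrier: "0 \<in> carrier (V \<otimes> W)"
  by (auto simp: tensor_sp_def intro!: exI[of _ "[]"])

lemma tensor_add_carrier:
  assumes "t \<in> carrier (V \<otimes> W)" "u \<in> carrier (V \<otimes> W)"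
  shows "t + u \<in> carrier (V \<otimes> W)"
proof -
  obtain xs ys where "set xs \<subseteq> carrier V \<times> carrier W" "t = (\<Sum>(a, b)\<leftarrow>xs. tens V W a b)"
    "set ys \<subseteq> carrier V \<times> carrier W" "u = (\<Sum>(a, b)\<leftarrow>ys. tens V W a b)"
    using assms by (auto simp: tensor_sp_def)
  then show ?thesis by (auto simp: tensor_sp_def intro!: exI[of _ "xs @ ys"])
qed

lemma tens_scale:
  assumes "a \<in> carrier V" "b \<in> carrier W"
  shows "tens V W (scale V c a) b = scale (V \<otimes> W) c (tens V W a b)"
  using assms by (auto simp: bilin_map_def lin_map_def tens_def fun_eq_iff tensor_sp_def base_field_def)

lemma tensor_scale_sum_list:
  "scale (V \<otimes> W) c (\<Sum>x\<leftarrow>xs. f x) = (\<Sum>x\<leftarrow>xs. scale (V \<otimes> W) c (f x))"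
  by (induction xs) (simp_all add: tensor_sp_def fun_eq_iff distrib_left)

lemma tens_add_left:
  "a \<in> carrier V \<Longrightarrow> a' \<in> carrier V \<Longrightarrow> b \<in> carrier W \<Longrightarrow>
    tens V W (a + a') b = tens V W a b + tens V W a' b"
  by (auto simp: bilin_map_def lin_map_def tens_def fun_eq_iff)

lemma tens_add_right:
  "a \<in> carrier V \<Longrightarrow> b \<in> carrier W \<Longrightarrow> b' \<in> carrier W \<Longrightarrow>
    tens V W a (b + b') = tens V W a b + tens V W a b'"
  by (auto simp: bilin_map_def lin_map_def tens_def fun_eq_iff)

lemma tens_scale_right:
  "a \<in> carrier V \<Longrightarrow> b \<in> carrier W \<Longrightarrow> tens V W a (scale W c b) = scale (V \<otimes> W) c (tens V W a b)"
  by (auto simp: bilin_map_def lin_map_def tens_def fun_eq_iff tensor_sp_def base_field_def)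

lemma tens_bilinear: "bilin_map V W (V \<otimes> W) (tens V W)"
  unfolding bilin_map_def lin_map_def
  by (intro conjI ballI allI tens_carrier tens_add_left tens_add_right tens_scale tens_scale_right)

lemma tensor_scale_carrier:
  assumes "t \<in> carrier (V \<otimes> W)" "span_closed V"
  shows "scale (V \<otimes> W) c t \<in> carrier (V \<otimes> W)"
proof -
  have "(\<Sum>x\<leftarrow>xs. scale (V \<otimes> W) c (case x of (a, b) \<Rightarrow> tens V W a b)) \<in> carrier (V \<otimes> W)"
    if "set xs \<subseteq> carrier V \<times> carrier W" for xs
    using that
  proof (induction xs)
    case (Cons x xs)
    obtain a b where x: "x = (a, b)" "a \<in> carrier V" "b \<in> carrier W" using Cons.prems by (cases x) auto
    have "scale (V \<otimes> W) c (tens V W a b) \<in> carrier (V \<otimes> W)"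
      using x assms(2) by (subst tens_scale[symmetric]) (auto simp: span_closed_def intro!: tens_carrier)
    then show ?case
      using Cons by (simp add: x(1) tensor_add_carrier del: plus_fun_apply)
  qed (simp add: tensor_zero_carrier)
  from this[OF tensor_list_mem[OF assms(1)]] show ?thesis
    by (subst tensor_list_sum[OF assms(1)]) (simp add: tensor_scale_sum_list)
qed

lemma span_closed_tensor: "span_closed V \<Longrightarrow> span_closed (V \<otimes> W)"
  unfolding span_closed_def[of "V \<otimes> W"]
  by (auto intro: tensor_zero_carrier tensor_add_carrier tensor_scale_carrier)

lemma tlift_lin_map:
  assumes U: "is_vs U" and F: "bilin_map V W U F" and V: "span_closed V"
  shows "lin_map (V \<otimes> W) U (\<lambda>t. tlift V W t F)"
proof -
  have sU: "span_closed U" by (rule is_vs_span_closed[OF U])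
  interpret U: vector_space "scale U" using U by (simp add: is_vs_def)
  have mem: "F a b \<in> carrier U" if "a \<in> carrier V" "b \<in> carrier W" for a b
    using F that by (auto simp: bilin_map_def lin_map_def)
  have "tlift V W (t + u) F = tlift V W t F + tlift V W u F"
    if tu: "t \<in> carrier (V \<otimes> W)" "u \<in> carrier (V \<otimes> W)" for t u
  proof -
    define xs where "xs = tensor_list V W t"
    have xs: "set xs \<subseteq> carrier V \<times> carrier W" "t = (\<Sum>(a, b)\<leftarrow>xs. tens V W a b)"
      using tensor_list[OF tu(1)] by (simp_all add: xs_def)
    define ys where "ys = tensor_list V W u"
    have ys: "set ys \<subseteq> carrier V \<times> carrier W" "u = (\<Sum>(a, b)\<leftarrow>ys. tens V W a b)"
      using tensor_list[OF tu(2)] by (simp_all add: ys_def)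
    have "set (xs @ ys) \<subseteq> carrier V \<times> carrier W" using xs ys by auto
    from tlift_sum[OF U F this] show ?thesis
      by (simp add: xs ys tlift_sum[OF U F])
  qed
  moreover have "tlift V W (scale (V \<otimes> W) c t) F = scale U c (tlift V W t F)"
    if t: "t \<in> carrier (V \<otimes> W)" for c t
  proof -
    define xs where "xs = tensor_list V W t"
    have xs: "set xs \<subseteq> carrier V \<times> carrier W" "t = (\<Sum>(a, b)\<leftarrow>xs. tens V W a b)"
      using tensor_list[OF t] by (simp_all add: xs_def)
    define ys where "ys = map (\<lambda>(a, b). (scale V c a, b)) xs"
    have ys: "set ys \<subseteq> carrier V \<times> carrier W"
      using xs(1) V by (auto simp: ys_def span_closed_def)
    have "scale (V \<otimes> W) c t = (\<Sum>x\<leftarrow>xs. case x of (a, b) \<Rightarrow> scale (V \<otimes> W) c (tens V W a b))"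
      by (simp add: xs(2) tensor_scale_sum_list case_prod_unfold)
    also have "\<dots> = (\<Sum>x\<leftarrow>xs. case x of (a, b) \<Rightarrow> tens V W (scale V c a) b)"
      using xs(1) by (intro arg_cong[where f = sum_list] map_cong) (auto simp: tens_scale)
    also have "\<dots> = (\<Sum>(a, b)\<leftarrow>ys. tens V W a b)"
      by (simp add: ys_def case_prod_unfold o_def)
    finally have "tlift V W (scale (V \<otimes> W) c t) F = (\<Sum>(a, b)\<leftarrow>ys. F a b)"
      by (simp add: tlift_sum[OF U F ys])
    also have "\<dots> = (\<Sum>x\<leftarrow>xs. case x of (a, b) \<Rightarrow> F (scale V c a) b)"
      by (simp add: ys_def case_prod_unfold o_def)
    also have "\<dots> = (\<Sum>x\<leftarrow>xs. case x of (a, b) \<Rightarrow> scale U c (F a b))"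
      using xs(1) F by (intro arg_cong[where f = sum_list] map_cong) (auto simp: bilin_map_def lin_map_def)
    also have "\<dots> = scale U c (\<Sum>(a, b)\<leftarrow>xs. F a b)"
      by (induction xs) (auto simp: U.scale_right_distrib)
    also have "\<dots> = scale U c (tlift V W t F)"
      by (simp add: xs(2) tlift_sum[OF U F xs(1)])
    finally show ?thesis .
  qed
  moreover have "tlift V W t F \<in> carrier U" if "t \<in> carrier (V \<otimes> W)" for t
    by (rule tlift_closed[OF that]) (use sU in \<open>auto simp: span_closed_def mem\<close>)
  ultimately show ?thesis by (auto simp: lin_map_def)
qed

lemma lin_map_tlift:
  assumes f: "lin_map U Z f" and U: "0 \<in> carrier U" "\<And>x y. x \<in> carrier U \<Longrightarrow> y \<in> carrier U \<Longrightarrow> x + y \<in> carrier U"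
    and t: "t \<in> carrier (V \<otimes> W)" and F: "\<And>a b. a \<in> carrier V \<Longrightarrow> b \<in> carrier W \<Longrightarrow> F a b \<in> carrier U"
  shows "f (tlift V W t F) = tlift V W t (\<lambda>a b. f (F a b))"
proof -
  have add: "f (x + y) = f x + f y" if "x \<in> carrier U" "y \<in> carrier U" for x y
    using f that unfolding lin_map_def by blast
  have zero: "f 0 = 0" using add[of 0 0] U(1) by simp
  have "f (\<Sum>(a, b)\<leftarrow>xs. F a b) = (\<Sum>(a, b)\<leftarrow>xs. f (F a b)) \<and> (\<Sum>(a, b)\<leftarrow>xs. F a b) \<in> carrier U"
    if "set xs \<subseteq> carrier V \<times> carrier W" for xs
    using that
  proof (induction xs)
    case (Cons x xs)
    obtain a b where x: "x = (a, b)" "a \<in> carrier V" "b \<in> carrier W" using Cons.prems by (cases x) auto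
    show ?case
      using Cons x by (simp only: list.map sum_list.Cons case_prod_conv list.set insert_subset
          add F U(2) mem_Sigma_iff conj_assoc simp_thms)
  qed (simp add: zero U(1))
  from this[OF tensor_list_mem[OF t]] show ?thesis by (simp only: tlift_tensor_list)
qed

text \<open>
  A linear map is determined by elementary tensors; stated as an expansion because the representing
  list of \<open>t\<close> is hidden inside \<^const>\<open>tlift\<close>.
\<close>

lemma lin_map_eq_tlift:
  assumes f: "lin_map (V \<otimes> W) U f" and t: "t \<in> carrier (V \<otimes> W)"
  shows "f t = tlift V W t (\<lambda>a b. f (tens V W a b))"
proof -
  have "t = tlift V W t (tens V W)"
    by (subst tlift_tensor_list) (rule tensor_list_sum[OF t])
  then have "f t = f (tlift V W t (tens V W))" by simp
  also have "\<dots> = tlift V W t (\<lambda>a b. f (tens V W a b))"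
    by (rule lin_map_tlift[OF f tensor_zero_carrier tensor_add_carrier t tens_carrier])
  finally show ?thesis .
qed

text \<open>
  The dual space occurs as an algebra, a Hopf algebra and a quasi-Hopf algebra.  Tensor products only
  see the underlying vector spaces, so those over the different structures coincide.
\<close>

lemma
  assumes "carrier V = carrier V'" "scale V = scale V'" "carrier W = carrier W'" "scale W = scale W'"
  shows tens_cong: "tens V W = tens V' W'"
    and tensor_sp_cong: "V \<otimes> W = V' \<otimes> W'"
    and tlift_cong: "tlift V W = (tlift V' W' :: _ \<Rightarrow> ('a::ab_group_add \<Rightarrow> 'b::ab_group_add \<Rightarrow> 'c::comm_monoid_add) \<Rightarrow> 'c)"
proof -
  have "bilin_map V W base_field B = bilin_map V' W' base_field B" for B :: "'a \<Rightarrow> 'b \<Rightarrow> 'd"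
    by (simp add: bilin_map_def lin_map_def assms)
  then show t: "tens V W = tens V' W'" by (simp add: tens_def fun_eq_iff)
  then show "V \<otimes> W = V' \<otimes> W'" by (simp add: tensor_sp_def assms)
  show "tlift V W = (tlift V' W' :: _ \<Rightarrow> ('a \<Rightarrow> 'b \<Rightarrow> 'c) \<Rightarrow> 'c)" by (simp add: tlift_def fun_eq_iff t assms)
qed

section \<open>Sweedler sums in coordinates\<close>

lemma fun_sum_apply: "(\<Sum>i\<in>I. f i) x = (\<Sum>i\<in>I. f i x)"
  by (induction I rule: infinite_finite_induct) simp_all

lemma linear_iff_hom:
  assumes "vector_space s" "vector_space t"
  shows "Vector_Spaces.linear s t f \<longleftrightarrow> (\<forall>x y. f (x + y) = f x + f y) \<and> (\<forall>c x. f (s c x) = t c (f x))"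
  using assms by (auto simp: Vector_Spaces.linear_def module_hom_def module_hom_axioms_def
      vector_space_def module_def)

lemma linear_imp_hom:
  assumes "Vector_Spaces.linear s t f"
  shows "f (x + y) = f x + f y" "f (s c x) = t c (f x)" "f 0 = 0" "vector_space s" "vector_space t"
proof -
  interpret Vector_Spaces.linear s t f by fact
  show "f (x + y) = f x + f y" "f (s c x) = t c (f x)" "f 0 = 0" "vector_space s" "vector_space t"
    by (simp_all add: add scale zero vs1.vector_space_axioms vs2.vector_space_axioms)
qed

lemma vector_space_field: "vector_space ((*) :: 'k::field \<Rightarrow> 'k \<Rightarrow> 'k)"
  by unfold_locales (simp_all add: algebra_simps)

context fd_cocommutative_hopf_algebra
begin

abbreviation D :: "('k, 'h \<Rightarrow> 'k) alg" where "D \<equiv> dual_alg H"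

abbreviation lin :: "('h \<Rightarrow> 'k) \<Rightarrow> bool" where "lin \<equiv> Vector_Spaces.linear scl (*)"

lemma H_simps [simp]:
  "carrier H = UNIV" "scale H = scl" "mult H = (*)" "unit H = 1"
  "comult H = \<Delta>" "counit H = \<epsilon>" "antipode H = S"
  by (simp_all add: H_def hopf_struct_def)

lemma D_simps [simp]:
  "carrier D = {\<phi>. lin \<phi>}" "scale D = (\<lambda>c \<phi> h. c * \<phi> h)" "mult D = conv H" "unit D = \<epsilon>"
  by (simp_all add: dual_alg_def)

lemma bilin_H_iff:
  assumes "vector_space s"
  shows "bilin_map H H \<lparr>carrier = UNIV, scale = s\<rparr> F \<longleftrightarrow>
    (\<forall>a. Vector_Spaces.linear scl s (\<lambda>b. F a b)) \<and> (\<forall>b. Vector_Spaces.linear scl s (\<lambda>a. F a b))"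
  by (auto simp: bilin_map_def lin_map_def linear_iff_hom[OF vector_space_axioms assms])

definition coord :: "'h \<Rightarrow> 'h \<Rightarrow> 'k" where
  "coord b v = representation Basis v b"

lemma lin_coord: "lin (coord b)"
  unfolding coord_def by (rule linear_representation[OF independent_Basis span_Basis])

lemma coord_sum: "(\<Sum>b\<in>Basis. scl (coord b v) b) = v"
  unfolding coord_def
  by (rule sum_representation_eq[OF independent_Basis _ finite_Basis order_refl]) (simp add: span_Basis)

lemma linear_coord:
  assumes "Vector_Spaces.linear scl s M"
  shows "M v = (\<Sum>b\<in>Basis. s (coord b v) (M b))"
proof -
  interpret Vector_Spaces.linear scl s M by fact
  have "M v = M (\<Sum>b\<in>Basis. scl (coord b v) b)" by (simp add: coord_sum)
  also have "\<dots> = (\<Sum>b\<in>Basis. s (coord b v) (M b))" by (simp add: sum scale)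
  finally show ?thesis .
qed

lemma lin_coord_expand: "lin \<phi> \<Longrightarrow> \<phi> = (\<Sum>b\<in>Basis. scale D (\<phi> b) (coord b))"
  by (rule ext) (simp add: fun_sum_apply linear_coord[of "(*)" \<phi>] mult.commute)

text \<open>
  The coordinate forms are a basis of the dual.  The induction is over subsets of the basis because \<open>g\<close>
  is linear on linear forms only.
\<close>

lemma lin_map_D_coord:
  assumes g: "lin_map D U g" and \<phi>: "lin \<phi>"
  shows "g \<phi> = (\<Sum>b\<in>Basis. scale U (\<phi> b) (g (coord b)))"
proof -
  have sc: "lin (scale D c \<psi>)" "g (scale D c \<psi>) = scale U c (g \<psi>)" if "lin \<psi>" for c \<psi>
    using g that by (auto simp: lin_map_def linear_iff_hom[OF vector_space_axioms vector_space_field] algebra_simps)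
  have add: "lin (\<psi> + \<chi>)" "g (\<psi> + \<chi>) = g \<psi> + g \<chi>" if "lin \<psi>" "lin \<chi>" for \<psi> \<chi>
    using g that by (auto simp: lin_map_def linear_iff_hom[OF vector_space_axioms vector_space_field] algebra_simps)
  have zero: "lin 0" "g 0 = 0"
  proof -
    show z: "lin 0" by (simp add: linear_iff_hom[OF vector_space_axioms vector_space_field])
    from add(2)[OF z z] show "g 0 = 0" by simp
  qed
  have "lin (\<Sum>b\<in>B. scale D (\<phi> b) (coord b)) \<and>
      g (\<Sum>b\<in>B. scale D (\<phi> b) (coord b)) = (\<Sum>b\<in>B. scale U (\<phi> b) (g (coord b)))" if "finite B" for B
    using that
  proof (induction B rule: finite_induct)
    case (insert b B)
    then show ?case
      by (simp only: sum.insert[OF insert.hyps] sc[OF lin_coord] add simp_thms)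
  qed (simp only: sum.empty zero simp_thms)
  from this[OF finite_Basis] show ?thesis using lin_coord_expand[OF \<phi>] by metis
qed

lemma comult_carrier: "\<Delta> x \<in> carrier (H \<otimes> H)"
  using comult_lin by (simp add: lin_map_def)

lemma cop2_bilinear_form:
  assumes "\<And>a. lin (F a)" "\<And>b. lin (\<lambda>a. F a b)"
  shows "cop2 H x F = \<Delta> x F"
  unfolding cop2_def H_simps
  by (rule tlift_eq_apply[OF comult_carrier])
    (use assms bilin_H_iff[OF vector_space_field] in \<open>auto simp: base_field_def\<close>)

lemma comult_add: "\<Delta> (x + y) = \<Delta> x + \<Delta> y" and comult_scale: "\<Delta> (scl c x) = (\<lambda>B. c * \<Delta> x B)"
  using comult_lin by (simp_all add: lin_map_def tensor_sp_def)

lemma lin_cop2: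
  assumes "\<And>a. lin (F a)" "\<And>b. lin (\<lambda>a. F a b)"
  shows "lin (\<lambda>x. cop2 H x F)"
  unfolding cop2_bilinear_form[OF assms]
  by (simp add: linear_iff_hom[OF vector_space_axioms vector_space_field] comult_add comult_scale)

lemma lin_conv: "lin \<phi> \<Longrightarrow> lin \<psi> \<Longrightarrow> lin (conv H \<phi> \<psi>)"
  unfolding conv_def
  by (rule lin_cop2) (auto simp: linear_iff_hom[OF vector_space_axioms vector_space_field] algebra_simps)

text \<open>
  In coordinates every bilinear Sweedler sum is governed by the convolutions of the coordinate forms,
  whatever the space in which the sum is taken.
\<close>

lemma cop2_coord:
  assumes "\<And>a. Vector_Spaces.linear scl s (M a)" "\<And>b. Vector_Spaces.linear scl s (\<lambda>a. M a b)"
  shows "cop2 H h M = (\<Sum>b\<in>Basis. \<Sum>d\<in>Basis. s (conv H (coord b) (coord d) h) (M b d))"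
proof -
  interpret U: vector_space s using linear_imp_hom(5)[OF assms(1)] .
  have M: "M x y = (\<Sum>b\<in>Basis. \<Sum>d\<in>Basis. s (coord b x * coord d y) (M b d))" for x y
  proof -
    have "M x y = (\<Sum>b\<in>Basis. s (coord b x) (M b y))" by (rule linear_coord[OF assms(2)])
    also have "\<dots> = (\<Sum>b\<in>Basis. s (coord b x) (\<Sum>d\<in>Basis. s (coord d y) (M b d)))"
      by (rule sum.cong[OF refl]) (subst linear_coord[OF assms(1)], rule refl)
    finally show ?thesis by (simp add: U.scale_sum_right)
  qed
  have "cop2 H h M = cop2 H h (\<lambda>x y. \<Sum>b\<in>Basis. \<Sum>d\<in>Basis. s (coord b x * coord d y) (M b d))"
    by (rule arg_cong[where f = "cop2 H h"]) (auto intro!: ext M)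
  also have "\<dots> = (\<Sum>b\<in>Basis. \<Sum>d\<in>Basis. cop2 H h (\<lambda>x y. s (coord b x * coord d y) (M b d)))"
    by (simp add: cop2_def tlift_sum_set)
  also have "\<dots> = (\<Sum>b\<in>Basis. \<Sum>d\<in>Basis. s (conv H (coord b) (coord d) h) (M b d))"
  proof (intro sum.cong refl)
    fix b d
    show "cop2 H h (\<lambda>x y. s (coord b x * coord d y) (M b d)) = s (conv H (coord b) (coord d) h) (M b d)"
      unfolding conv_def cop2_def
      by (rule tlift_hom[where f = "\<lambda>c. s c (M b d)", symmetric]) (simp_all add: U.scale_left_distrib)
  qed
  finally show ?thesis .
qed

lemma linear_cop2:
  assumes "\<And>a. Vector_Spaces.linear scl s (M a)" "\<And>b. Vector_Spaces.linear scl s (\<lambda>a. M a b)"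
  shows "Vector_Spaces.linear scl s (\<lambda>x. cop2 H x M)"
proof -
  interpret U: vector_space s using linear_imp_hom(5)[OF assms(1)] .
  have L: "conv H (coord b) (coord d) (x + y) = conv H (coord b) (coord d) x + conv H (coord b) (coord d) y"
    "conv H (coord b) (coord d) (scl c x) = c * conv H (coord b) (coord d) x" for b d x y c
    using linear_imp_hom[OF lin_conv[OF lin_coord lin_coord]] by blast+
  show ?thesis
    unfolding cop2_coord[OF assms] linear_iff_hom[OF vector_space_axioms U.vector_space_axioms]
    by (simp add: L U.scale_left_distrib sum.distrib U.scale_sum_right)
qed

lemma linear_cop2_inner:
  assumes "\<And>a b. Vector_Spaces.linear scl s (\<lambda>x. M x a b)"
  shows "Vector_Spaces.linear scl s (\<lambda>x. cop2 H y (M x))"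
proof -
  interpret U: vector_space s using linear_imp_hom(5)[OF assms] .
  note hom = linear_imp_hom[OF assms]
  have "cop2 H y (M (c1 + c2)) = cop2 H y (M c1) + cop2 H y (M c2)" for c1 c2
    by (simp add: cop2_def tlift_add[symmetric] hom(1))
  moreover have "cop2 H y (M (scl c x)) = s c (cop2 H y (M x))" for c x
    unfolding cop2_def hom(2)
    by (rule tlift_hom[symmetric]) (simp_all add: U.scale_right_distrib)
  ultimately show ?thesis
    by (simp add: linear_iff_hom[OF vector_space_axioms U.vector_space_axioms])
qed

lemma span_closed_D: "span_closed D"
  by (auto simp: span_closed_def linear_iff_hom[OF vector_space_axioms vector_space_field] algebra_simps)

lemma span_closed_H: "span_closed H"
  by (simp add: span_closed_def)

text \<open>The coalgebra axioms, tested on multilinear forms instead of tensors.\<close>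

lemma cop2_commute:
  assumes "\<And>a. lin (F a)" "\<And>b. lin (\<lambda>a. F a b)"
  shows "cop2 H x (\<lambda>a b. F b a) = cop2 H x F"
proof -
  have B: "bilin_map H H base_field F"
    using assms bilin_H_iff[OF vector_space_field] by (auto simp: base_field_def)
  have "cop2 H x F = \<Delta> x F" by (rule cop2_bilinear_form[OF assms])
  also have "\<dots> = cop2 H x (\<lambda>a b. tens H H b a) F" by (simp add: cocommutative)
  also have "\<dots> = cop2 H x (\<lambda>a b. F b a)"
    unfolding cop2_def tlift_fun_apply by (simp add: tens_eq_apply[OF B])
  finally show ?thesis by simp
qed

lemma conv_commute: "lin \<phi> \<Longrightarrow> lin \<psi> \<Longrightarrow> conv H \<phi> \<psi> = conv H \<psi> \<phi>"
proof (rule ext)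
  fix h
  assume "lin \<phi>" "lin \<psi>"
  then have "cop2 H h (\<lambda>a b. \<phi> b * \<psi> a) = cop2 H h (\<lambda>a b. \<phi> a * \<psi> b)"
    by (intro cop2_commute) (auto simp: linear_iff_hom[OF vector_space_axioms vector_space_field] algebra_simps)
  then show "conv H \<phi> \<psi> h = conv H \<psi> \<phi> h" by (simp add: conv_def mult.commute)
qed

lemma cop2_assoc:
  assumes T: "\<And>b c. lin (\<lambda>a. T a b c)" "\<And>a c. lin (\<lambda>b. T a b c)" "\<And>a b. lin (\<lambda>c. T a b c)"
  shows "cop2 H h (\<lambda>u c. cop2 H u (\<lambda>a b. T a b c)) = cop2 H h (\<lambda>a u. cop2 H u (\<lambda>b c. T a b c))"
proof -
  note hom = T[THEN linear_imp_hom(1)] T[THEN linear_imp_hom(2)]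
  have B1: "bilin_map H H base_field (\<lambda>b c. T a b c)" for a
    by (simp add: bilin_map_def lin_map_def base_field_def hom)
  have B2: "bilin_map H (H \<otimes> H) base_field (\<lambda>a u. tlift H H u (\<lambda>b c. T a b c))"
  proof -
    have "lin_map (H \<otimes> H) base_field (\<lambda>u. tlift H H u (\<lambda>b c. T a b c))" for a
      by (rule tlift_lin_map[OF is_vs_base_field B1 span_closed_H])
    moreover have "lin_map H base_field (\<lambda>a. tlift H H u (\<lambda>b c. T a b c))" for u
    proof -
      have e: "T (x + y) = (\<lambda>b c. T x b c + T y b c)" "T (scl k x) = (\<lambda>b c. k * T x b c)" for x y k
        by (intro ext, rule hom)+
      show ?thesis by (simp add: lin_map_def base_field_def e tlift_add tlift_mult_left)
    qed
    ultimately show ?thesis by (simp add: bilin_map_def)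
  qed
  have t3: "tens3 H a b c (\<lambda>a u. tlift H H u (\<lambda>b c. T a b c)) = T a b c" for a b c
    unfolding tens3_def tens_eq_apply[OF B2]
    by (rule tlift_tens[OF is_vs_base_field B1]) simp_all
  have "cop2 H h (\<lambda>a u. cop2 H u (\<lambda>b c. T a b c))
      = cop2 H h (\<lambda>a u. cop2 H u (\<lambda>b c. tens3 H a b c)) (\<lambda>a u. tlift H H u (\<lambda>b c. T a b c))"
    unfolding cop2_def tlift_fun_apply t3 ..
  also have "\<dots> = cop2 H h (\<lambda>u c. cop2 H u (\<lambda>a b. tens3 H a b c)) (\<lambda>a u. tlift H H u (\<lambda>b c. T a b c))"
    by (simp add: coassoc)
  also have "\<dots> = cop2 H h (\<lambda>u c. cop2 H u (\<lambda>a b. T a b c))"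
    unfolding cop2_def tlift_fun_apply t3 ..
  finally show ?thesis by simp
qed

lemma linear_cop2_value:
  assumes "lin \<phi>"
  shows "\<phi> (cop2 H h F) = cop2 H h (\<lambda>a b. \<phi> (F a b))"
  unfolding cop2_def using linear_imp_hom[OF assms] by (intro tlift_hom) auto

lemma conv_counit_left:
  assumes "lin \<phi>"
  shows "conv H \<epsilon> \<phi> = \<phi>"
proof (rule ext)
  fix h
  have "\<phi> (cop2 H h (\<lambda>x1 x2. scl (\<epsilon> x1) x2)) = conv H \<epsilon> \<phi> h"
    by (simp add: linear_cop2_value[OF assms] conv_def linear_imp_hom(2)[OF assms])
  then show "conv H \<epsilon> \<phi> h = \<phi> h" by (simp add: counit_left)
qed

lemmas scl_vector_space = vector_space_axioms

abbreviation linH :: "('h \<Rightarrow> 'h) \<Rightarrow> bool" where "linH \<equiv> Vector_Spaces.linear scl scl"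

lemma lin_iff: "lin M \<longleftrightarrow> (\<forall>x y. M (x + y) = M x + M y) \<and> (\<forall>c x. M (scl c x) = c * (M x))"
  by (rule linear_iff_hom[OF vector_space_axioms vector_space_field])

lemma linH_iff: "linH M \<longleftrightarrow> (\<forall>x y. M (x + y) = M x + M y) \<and> (\<forall>c x. M (scl c x) = scl c (M x))"
  by (rule linear_iff_hom[OF vector_space_axioms vector_space_axioms])

lemma linH_id: "linH (\<lambda>x. x)"
  and linH_S: "linH f \<Longrightarrow> linH (\<lambda>x. S (f x))"
  and linH_mult_left: "linH f \<Longrightarrow> linH (\<lambda>x. f x * y)"
  and linH_mult_right: "linH f \<Longrightarrow> linH (\<lambda>x. y * f x)"
  using linear_imp_hom[OF antipode_lin]
  by (auto simp: linH_iff distrib_left distrib_right scl_mult_left[symmetric] scl_mult_right[symmetric])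

lemma lin_app: "lin \<phi> \<Longrightarrow> linH f \<Longrightarrow> lin (\<lambda>x. \<phi> (f x))"
  by (simp add: lin_iff linH_iff)

lemma lin_mult_left: "lin f \<Longrightarrow> lin (\<lambda>x. f x * c)"
  and lin_mult_right: "lin f \<Longrightarrow> lin (\<lambda>x. c * f x)"
  by (simp_all add: lin_iff algebra_simps)

end

lemma tensor_alg_simps [simp]:
  "carrier (tensor_alg A B) = carrier (A \<otimes> B)" "scale (tensor_alg A B) = scale (A \<otimes> B)"
  "unit (tensor_alg A B) = tens A B (unit A) (unit B)"
  by (simp_all add: tensor_alg_def)

definition alg_closed :: "('k::field, 'a::ab_group_add, 'm) alg_scheme \<Rightarrow> bool" where
  "alg_closed A \<longleftrightarrow> span_closed A \<and> (\<forall>a\<in>carrier A. \<forall>b\<in>carrier A. a \<cdot>\<^bsub>A\<^esub> b \<in> carrier A) \<and> \<one>\<^bsub>A\<^esub> \<in> carrier A"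

lemma alg_closed_tensor:
  assumes "alg_closed A" "alg_closed B"
  shows "alg_closed (tensor_alg A B)"
proof -
  have "span_closed (tensor_alg A B)"
    using span_closed_tensor[of A B] assms by (simp add: alg_closed_def span_closed_def)
  moreover have "t \<cdot>\<^bsub>tensor_alg A B\<^esub> u \<in> carrier (A \<otimes> B)" if "t \<in> carrier (A \<otimes> B)" "u \<in> carrier (A \<otimes> B)" for t u
    using that assms unfolding tensor_alg_def alg.simps
    by (intro tlift_closed tensor_zero_carrier tensor_add_carrier tens_carrier)
      (auto simp: alg_closed_def)
  ultimately show ?thesis using assms by (simp add: alg_closed_def tens_carrier)
qed

section \<open>Points with values in a commutative algebra\<close>

text \<open>
  The algebras in which forms take their values.  The ring laws range over the whole type and only the
  closure and unit laws over \<open>R\<close>, so that sums and products can be rearranged without membership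
  conditions.
\<close>

locale value_algebra = vector_space scR
  for scR :: "'k::field \<Rightarrow> 'r::ab_group_add \<Rightarrow> 'r" +
  fixes R :: "'r set" and mul :: "'r \<Rightarrow> 'r \<Rightarrow> 'r"  (infixl "\<bullet>" 70) and one :: 'r
  assumes R_zero: "0 \<in> R" and R_add: "x \<in> R \<Longrightarrow> y \<in> R \<Longrightarrow> x + y \<in> R"
    and R_scale: "x \<in> R \<Longrightarrow> scR c x \<in> R" and R_mul: "x \<in> R \<Longrightarrow> y \<in> R \<Longrightarrow> x \<bullet> y \<in> R"
    and R_one: "one \<in> R"
    and mul_assoc: "(x \<bullet> y) \<bullet> z = x \<bullet> (y \<bullet> z)" and mul_commute: "x \<bullet> y = y \<bullet> x"
    and mul_add_left: "(x + y) \<bullet> z = x \<bullet> z + y \<bullet> z" and mul_scale_left: "scR c x \<bullet> z = scR c (x \<bullet> z)"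
    and one_mul: "x \<in> R \<Longrightarrow> one \<bullet> x = x"
begin

lemma mul_left_commute: "x \<bullet> (y \<bullet> z) = y \<bullet> (x \<bullet> z)"
  by (metis mul_assoc mul_commute)

lemmas mul_ac = mul_assoc mul_commute mul_left_commute

lemma mul_add_right: "z \<bullet> (x + y) = z \<bullet> x + z \<bullet> y"
  by (metis mul_add_left mul_commute)

lemma mul_scale_right: "z \<bullet> scR c x = scR c (z \<bullet> x)"
  by (metis mul_scale_left mul_commute)

lemma mul_zero_left [simp]: "0 \<bullet> x = 0"
  using mul_scale_left[of 0 0 x] by simp

lemma mul_zero_right [simp]: "x \<bullet> 0 = 0"
  by (simp add: mul_commute[of x])

lemma mul_one: "x \<in> R \<Longrightarrow> x \<bullet> one = x"
  by (simp add: one_mul mul_commute[of x])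

lemma mul_sum_right: "z \<bullet> (\<Sum>i\<in>I. f i) = (\<Sum>i\<in>I. z \<bullet> f i)"
  by (induction I rule: infinite_finite_induct) (simp_all add: mul_add_right)

lemma mul_sum_left: "(\<Sum>i\<in>I. f i) \<bullet> z = (\<Sum>i\<in>I. f i \<bullet> z)"
  by (induction I rule: infinite_finite_induct) (simp_all add: mul_add_left)

lemma R_sum: "(\<And>i. i \<in> I \<Longrightarrow> f i \<in> R) \<Longrightarrow> (\<Sum>i\<in>I. f i) \<in> R"
  by (induction I rule: infinite_finite_induct) (simp_all add: R_zero R_add)

lemma mul_tlift_right: "z \<bullet> tlift V W t F = tlift V W t (\<lambda>a b. z \<bullet> F a b)"
  by (rule tlift_hom) (simp_all add: mul_add_right)

lemma mul_tlift_left: "tlift V W t F \<bullet> z = tlift V W t (\<lambda>a b. F a b \<bullet> z)"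
  by (rule tlift_hom[where f = "\<lambda>x. x \<bullet> z"]) (simp_all add: mul_add_left)

lemma inverse_unique: "x \<in> R \<Longrightarrow> y \<in> R \<Longrightarrow> z \<bullet> x = one \<Longrightarrow> z \<bullet> y = one \<Longrightarrow> x = y"
  by (metis mul_assoc mul_commute one_mul)

definition Rv :: "('k, 'r) vs" where "Rv = \<lparr>carrier = R, scale = scR\<rparr>"

lemma Rv_simps [simp]: "carrier Rv = R" "scale Rv = scR"
  by (simp_all add: Rv_def)

lemma is_vs_Rv: "is_vs Rv"
  by (simp add: is_vs_def vector_space_axioms subspace_def R_zero R_add R_scale)

definition alg_hom :: "('k, 'a::ab_group_add, 'm) alg_scheme \<Rightarrow> ('a \<Rightarrow> 'r) \<Rightarrow> bool" where
  "alg_hom A f \<longleftrightarrow> lin_map A Rv f \<and> (\<forall>a\<in>carrier A. \<forall>b\<in>carrier A. f (a \<cdot>\<^bsub>A\<^esub> b) = f a \<bullet> f b) \<and> f \<one>\<^bsub>A\<^esub> = one"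

lemma alg_homD:
  assumes "alg_hom A f"
  shows "a \<in> carrier A \<Longrightarrow> f a \<in> R"
    and "a \<in> carrier A \<Longrightarrow> b \<in> carrier A \<Longrightarrow> f (a + b) = f a + f b"
    and "a \<in> carrier A \<Longrightarrow> f (scale A c a) = scR c (f a)"
    and "a \<in> carrier A \<Longrightarrow> b \<in> carrier A \<Longrightarrow> f (a \<cdot>\<^bsub>A\<^esub> b) = f a \<bullet> f b" and "f \<one>\<^bsub>A\<^esub> = one"
    and "lin_map A Rv f"
  using assms by (auto simp: alg_hom_def lin_map_def)

text \<open>
  The map \<open>f \<otimes> g\<close> followed by the multiplication of \<open>R\<close>.  It is an algebra homomorphism if \<open>f\<close> and \<open>g\<close>
  are, which is where commutativity of \<open>R\<close> enters (\<open>alg_hom_tprod\<close> below).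
\<close>

definition tprod ::
  "('k, 'a::ab_group_add, 'm) vs_scheme \<Rightarrow> ('k, 'b::ab_group_add, 'n) vs_scheme
    \<Rightarrow> ('a \<Rightarrow> 'r) \<Rightarrow> ('b \<Rightarrow> 'r) \<Rightarrow> ('a, 'b, 'k) tensor \<Rightarrow> 'r" where
  "tprod V W f g t = tlift V W t (\<lambda>a b. f a \<bullet> g b)"

lemma tprod_bilin:
  assumes "lin_map V Rv f" "lin_map W Rv g"
  shows "bilin_map V W Rv (\<lambda>a b. f a \<bullet> g b)"
  using assms by (auto simp: bilin_map_def lin_map_def mul_add_left mul_add_right mul_scale_left
      mul_scale_right R_mul)

lemma tprod_tens:
  assumes "lin_map V Rv f" "lin_map W Rv g" "a \<in> carrier V" "b \<in> carrier W"
  shows "tprod V W f g (tens V W a b) = f a \<bullet> g b"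
  unfolding tprod_def by (rule tlift_tens[OF is_vs_Rv tprod_bilin[OF assms(1,2)] assms(3,4)])

lemma tprod_lin_map:
  assumes "lin_map V Rv f" "lin_map W Rv g" "span_closed V"
  shows "lin_map (V \<otimes> W) Rv (tprod V W f g)"
  using tlift_lin_map[OF is_vs_Rv tprod_bilin[OF assms(1,2)] assms(3)] by (simp add: tprod_def[abs_def])

lemma tprod_tlift:
  assumes "lin_map V Rv f" "lin_map W Rv g" "span_closed V"
    and "t \<in> carrier (V' \<otimes> W')" "\<And>a b. a \<in> carrier V' \<Longrightarrow> b \<in> carrier W' \<Longrightarrow> F a b \<in> carrier (V \<otimes> W)"
  shows "tprod V W f g (tlift V' W' t F) = tlift V' W' t (\<lambda>a b. tprod V W f g (F a b))"
  by (rule lin_map_tlift[OF tprod_lin_map[OF assms(1-3)] tensor_zero_carrier tensor_add_carrier assms(4,5)])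

lemma alg_hom_tprod:
  assumes f: "alg_hom A f" and g: "alg_hom B g" and A: "alg_closed A" and B: "alg_closed B"
  shows "alg_hom (tensor_alg A B) (tprod A B f g)"
proof -
  note fD = alg_homD[OF f] and gD = alg_homD[OF g]
  have sA: "span_closed A" using A by (simp add: alg_closed_def)
  have "tprod A B f g (t \<cdot>\<^bsub>tensor_alg A B\<^esub> u) = tprod A B f g t \<bullet> tprod A B f g u" (is "?l1 = _")
    if t: "t \<in> carrier (A \<otimes> B)" and u: "u \<in> carrier (A \<otimes> B)" for t u
  proof -
    have ab: "a \<cdot>\<^bsub>A\<^esub> a' \<in> carrier A" "b \<cdot>\<^bsub>B\<^esub> b' \<in> carrier B"
      if "a \<in> carrier A" "a' \<in> carrier A" "b \<in> carrier B" "b' \<in> carrier B" for a a' b b'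
      using A B that by (auto simp: alg_closed_def)
    have "?l1 = tlift A B t (\<lambda>a b. tprod A B f g (tlift A B u (\<lambda>a' b'.
        tens A B (a \<cdot>\<^bsub>A\<^esub> a') (b \<cdot>\<^bsub>B\<^esub> b'))))"
      unfolding tensor_alg_def alg.simps
      by (rule tprod_tlift[OF fD(6) gD(6) sA t])
        (intro tlift_closed[OF u] tensor_zero_carrier tensor_add_carrier tens_carrier ab)
    also have "\<dots> = tlift A B t (\<lambda>a b. tlift A B u (\<lambda>a' b'. (f a \<bullet> g b) \<bullet> (f a' \<bullet> g b')))"
    proof (rule tlift_cong_mem[OF t])
      fix a b assume "a \<in> carrier A" "b \<in> carrier B"
      then show "tprod A B f g (tlift A B u (\<lambda>a' b'. tens A B (a \<cdot>\<^bsub>A\<^esub> a') (b \<cdot>\<^bsub>B\<^esub> b')))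
        = tlift A B u (\<lambda>a' b'. (f a \<bullet> g b) \<bullet> (f a' \<bullet> g b'))"
        by (subst tprod_tlift[OF fD(6) gD(6) sA u])
          (auto simp: tens_carrier ab tprod_tens[OF fD(6) gD(6)] fD(4) gD(4) mul_ac intro!: tlift_cong_mem[OF u])
    qed
    also have "\<dots> = tprod A B f g t \<bullet> tprod A B f g u"
      by (simp only: tprod_def mul_tlift_left mul_tlift_right) (rule tlift_swap)
    finally show ?thesis .
  qed
  moreover have "tprod A B f g (unit (tensor_alg A B)) = one"
    using A B by (simp add: tprod_tens[OF fD(6) gD(6)] alg_closed_def fD(5) gD(5) one_mul R_one)
  ultimately show ?thesis
    using tprod_lin_map[OF fD(6) gD(6) sA] by (simp add: alg_hom_def lin_map_def)
qed

end

locale hopf_points =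
  fd_cocommutative_hopf_algebra where scl = scl and Basis = Basis and \<Delta> = \<Delta> and \<epsilon> = \<epsilon> and S = S +
  val?: value_algebra scR R mul one
  for scl :: "'k::field \<Rightarrow> 'h::ring_1 \<Rightarrow> 'h" and Basis \<Delta> \<epsilon> S
    and scR :: "'k \<Rightarrow> 'r::ab_group_add \<Rightarrow> 'r" and R and mul (infixl "\<bullet>" 70) and one
begin

abbreviation linR :: "('h \<Rightarrow> 'r) \<Rightarrow> bool" where "linR \<equiv> Vector_Spaces.linear scl scR"

text \<open>
  Points are set to 0 off the dual, so that points agreeing on the dual are equal.
\<close>

definition point :: "(('h \<Rightarrow> 'k) \<Rightarrow> 'r) \<Rightarrow> bool" where
  "point g \<longleftrightarrow> alg_hom D g \<and> (\<forall>\<phi>. \<not> lin \<phi> \<longrightarrow> g \<phi> = 0)"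

text \<open>
  A point \<open>g\<close> amounts to the element \<open>\<Sum>b. g(coord b) \<otimes> b\<close> of \<open>R \<otimes> H\<close>; \<open>ev g M\<close> is the value on it of
  the \<open>R\<close>-linear extension of a linear map \<open>M\<close> from \<open>H\<close> to \<open>R\<close>.
\<close>

definition ev :: "(('h \<Rightarrow> 'k) \<Rightarrow> 'r) \<Rightarrow> ('h \<Rightarrow> 'r) \<Rightarrow> 'r" where
  "ev g M = (\<Sum>b\<in>Basis. g (coord b) \<bullet> M b)"

text \<open>
  The product of the corresponding elements of \<open>R \<otimes> H\<close>.
\<close>

definition pmul :: "(('h \<Rightarrow> 'k) \<Rightarrow> 'r) \<Rightarrow> (('h \<Rightarrow> 'k) \<Rightarrow> 'r) \<Rightarrow> ('h \<Rightarrow> 'k) \<Rightarrow> 'r"  (infixl "\<star>" 75) where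
  "(f \<star> g) \<phi> = (if lin \<phi> then \<Sum>b\<in>Basis. \<Sum>d\<in>Basis. scR (\<phi> (b * d)) (f (coord b) \<bullet> g (coord d)) else 0)"

text \<open>
  The antipode applied to the corresponding element of \<open>R \<otimes> H\<close>.
\<close>

definition pinv :: "(('h \<Rightarrow> 'k) \<Rightarrow> 'r) \<Rightarrow> ('h \<Rightarrow> 'k) \<Rightarrow> 'r" where
  "pinv g \<phi> = (if lin \<phi> then g (\<lambda>x. \<phi> (S x)) else 0)"

definition pone :: "('h \<Rightarrow> 'k) \<Rightarrow> 'r" where
  "pone \<phi> = (if lin \<phi> then scR (\<phi> 1) one else 0)"

lemma pointD:
  assumes "point g"
  shows "alg_hom D g" and "\<not> lin \<phi> \<Longrightarrow> g \<phi> = 0"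
    and "lin \<phi> \<Longrightarrow> lin \<psi> \<Longrightarrow> g (conv H \<phi> \<psi>) = g \<phi> \<bullet> g \<psi>"
    and "g \<epsilon> = one" and "g \<phi> \<in> R"
proof -
  show g: "alg_hom D g" and "\<not> lin \<phi> \<Longrightarrow> g \<phi> = 0" for \<phi>
    using assms by (auto simp: point_def)
  then show "g \<phi> \<in> R"
    using alg_homD(1)[OF g, of \<phi>] R_zero by (cases "lin \<phi>") auto
  show "lin \<phi> \<Longrightarrow> lin \<psi> \<Longrightarrow> g (conv H \<phi> \<psi>) = g \<phi> \<bullet> g \<psi>" and "g \<epsilon> = one"
    using alg_homD(4,5)[OF g] by auto
qed

lemma linR_iff: "linR M \<longleftrightarrow> (\<forall>x y. M (x + y) = M x + M y) \<and> (\<forall>c x. M (scl c x) = scR c (M x))"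
  by (rule linear_iff_hom[OF scl_vector_space val.vector_space_axioms])

lemma linR_app: "linR \<phi> \<Longrightarrow> linH f \<Longrightarrow> linR (\<lambda>x. \<phi> (f x))"
  by (simp add: linR_iff linH_iff)

lemma linR_scale: "lin f \<Longrightarrow> linR (\<lambda>x. scR (f x) m)"
  by (simp add: lin_iff linR_iff val.scale_left_distrib)

lemma linR_mul_left: "linR f \<Longrightarrow> linR (\<lambda>x. f x \<bullet> c)"
  and linR_mul_right: "linR f \<Longrightarrow> linR (\<lambda>x. c \<bullet> f x)"
  by (simp_all add: linR_iff mul_add_left mul_add_right mul_scale_left mul_scale_right)

lemma linR_ev: "(\<And>y. linR (\<lambda>x. M x y)) \<Longrightarrow> linR (\<lambda>x. ev g (M x))"
  unfolding ev_def linR_iff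
  by (simp add: mul_add_right mul_scale_right sum.distrib val.scale_sum_right)

lemmas linR_intros = linH_id linH_S linH_mult_left linH_mult_right lin_mult_left lin_mult_right
  linR_scale linR_mul_left linR_mul_right linR_ev lin_cop2
  linear_cop2[where s = scR] linear_cop2_inner[where s = "(*)"] linear_cop2_inner[where s = scR]

lemma ev_cong: "(\<And>x. M x = N x) \<Longrightarrow> ev g M = ev g N"
  by (simp add: ev_def)

lemma ev_swap: "ev f (\<lambda>x. ev g (\<lambda>y. M x y)) = ev g (\<lambda>y. ev f (\<lambda>x. M x y))"
  by (simp add: ev_def mul_sum_right mul_left_commute) (rule sum.swap)

lemma ev_mul_right: "ev g (\<lambda>x. m \<bullet> M x) = m \<bullet> ev g M"
  by (simp add: ev_def mul_sum_right mul_left_commute)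

lemma ev_mul_left: "ev g (\<lambda>x. M x \<bullet> m) = ev g M \<bullet> m"
  by (simp add: ev_def mul_sum_left mul_assoc)

lemma ev_closed:
  assumes "point g" "\<And>x. M x \<in> R"
  shows "ev g M \<in> R"
  unfolding ev_def using assms pointD(5) by (intro R_sum R_mul) auto

lemma ev_tlift: "ev g (\<lambda>x. tlift V W t (\<lambda>a b. M a b x)) = tlift V W t (\<lambda>a b. ev g (M a b))"
  by (simp add: ev_def mul_tlift_right tlift_sum_set)

lemma ev_cop2_inner: "ev g (\<lambda>x. cop2 H y (\<lambda>a b. M a b x)) = cop2 H y (\<lambda>a b. ev g (M a b))"
  by (simp add: cop2_def ev_tlift)

lemma hom_coord: "alg_hom D g \<Longrightarrow> lin \<phi> \<Longrightarrow> g \<phi> = (\<Sum>b\<in>Basis. scR (\<phi> b) (g (coord b)))"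
  using lin_map_D_coord[OF alg_homD(6)] by simp

lemma ev_lin:
  assumes "alg_hom D g" "lin \<phi>"
  shows "ev g (\<lambda>x. scR (\<phi> x) m) = g \<phi> \<bullet> m"
  by (simp add: ev_def hom_coord[OF assms] mul_sum_left mul_scale_left mul_scale_right)

lemma scR_cop2: "scR (cop2 H x F) m = cop2 H x (\<lambda>a b. scR (F a b) m)"
  unfolding cop2_def by (rule tlift_hom[where f = "\<lambda>c. scR c m"]) (simp_all add: val.scale_left_distrib)

lemma scR_mult_one: "scR (a * b) one = scR a one \<bullet> scR b one"
  by (simp add: mul_scale_left mul_scale_right one_mul R_one)

text \<open>
  A point is grouplike: multiplicativity of \<open>g\<close> for the convolution says that the comultiplication
  duplicates it.  This is what turns Sweedler sums into repeated arguments.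
\<close>

lemma ev_cop2:
  assumes g: "alg_hom D g" and M: "\<And>a. linR (M a)" "\<And>b. linR (\<lambda>a. M a b)"
  shows "ev g (\<lambda>x. cop2 H x M) = ev g (\<lambda>x. ev g (\<lambda>y. M x y))"
proof -
  have "ev g (\<lambda>x. cop2 H x M) = ev g (\<lambda>x. \<Sum>b\<in>Basis. \<Sum>d\<in>Basis. scR (conv H (coord b) (coord d) x) (M b d))"
    by (simp only: cop2_coord[where s = scR, OF M])
  also have "\<dots> = (\<Sum>b\<in>Basis. \<Sum>d\<in>Basis. ev g (\<lambda>x. scR (conv H (coord b) (coord d) x) (M b d)))"
  proof -
    have "ev g (\<lambda>x. \<Sum>i\<in>I. F i x) = (\<Sum>i\<in>I. ev g (F i))" for I :: "'h set" and F
      by (simp add: ev_def mul_sum_right) (rule sum.swap)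
    then show ?thesis by simp
  qed
  also have "\<dots> = (\<Sum>b\<in>Basis. \<Sum>d\<in>Basis. g (coord b) \<bullet> (g (coord d) \<bullet> M b d))"
    using alg_homD(4)[OF g, of "coord b" "coord d" for b d]
    by (simp add: ev_lin[OF g] lin_conv lin_coord mul_assoc)
  finally show ?thesis by (simp add: ev_def mul_sum_right)
qed

lemma ev_cop3:
  assumes g: "alg_hom D g"
    and M: "\<And>b c. linR (\<lambda>a. M a b c)" "\<And>a c. linR (\<lambda>b. M a b c)" "\<And>a b. linR (\<lambda>c. M a b c)"
  shows "ev g (\<lambda>x. cop3 H x M) = ev g (\<lambda>x. ev g (\<lambda>y. ev g (\<lambda>z. M x y z)))"
  unfolding cop3_def
  by (subst ev_cop2[OF g]) (simp_all add: ev_cop2[OF g] linear_cop2[where s = scR]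
      linear_cop2_inner[where s = scR] M)

lemma ev_pmul:
  assumes M: "linR M"
  shows "ev f (\<lambda>x. ev g (\<lambda>y. M (x * y))) = ev (f \<star> g) M"
proof -
  have "ev (f \<star> g) M = (\<Sum>e\<in>Basis. \<Sum>b\<in>Basis. \<Sum>d\<in>Basis. f (coord b) \<bullet> (g (coord d) \<bullet> scR (coord e (b * d)) (M e)))"
    by (simp add: ev_def pmul_def lin_coord mul_sum_left mul_scale_left mul_scale_right mul_assoc)
  also have "\<dots> = (\<Sum>b\<in>Basis. \<Sum>d\<in>Basis. \<Sum>e\<in>Basis. f (coord b) \<bullet> (g (coord d) \<bullet> scR (coord e (b * d)) (M e)))"
    by (subst sum.swap) (intro sum.cong refl sum.swap)
  also have "\<dots> = (\<Sum>b\<in>Basis. \<Sum>d\<in>Basis. f (coord b) \<bullet> (g (coord d) \<bullet> M (b * d)))"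
    by (simp only: mul_sum_right[symmetric] linear_coord[OF M, symmetric])
  finally show ?thesis by (simp add: ev_def mul_sum_right)
qed

lemma pmul_apply: "lin \<phi> \<Longrightarrow> ev f (\<lambda>x. ev g (\<lambda>y. scR (\<phi> (x * y)) m)) = (f \<star> g) \<phi> \<bullet> m"
  by (simp add: ev_def pmul_def mul_sum_right mul_sum_left mul_scale_left mul_scale_right mul_assoc)

end

section \<open>The group of points\<close>

context fd_cocommutative_hopf_algebra
begin

lemma lin_counit: "lin \<epsilon>"
  by (rule counit_lin)

lemma bilin_form_H:
  assumes "\<And>a. lin (F a)" "\<And>b. lin (\<lambda>a. F a b)"
  shows "bilin_map H H base_field F"
  using assms bilin_H_iff[OF vector_space_field] by (auto simp: base_field_def)

lemma cop2_mult:
  assumes F: "\<And>a. lin (F a)" "\<And>b. lin (\<lambda>a. F a b)"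
  shows "cop2 H (x * y) F = cop2 H x (\<lambda>x1 x2. cop2 H y (\<lambda>y1 y2. F (x1 * y1) (x2 * y2)))"
proof -
  have "cop2 H (x * y) F = (\<Delta> x \<cdot>\<^bsub>tensor_alg H H\<^esub> \<Delta> y) F"
    by (simp add: cop2_bilinear_form[OF F] comult_mult)
  also have "\<dots> = cop2 H x (\<lambda>x1 x2. cop2 H y (\<lambda>y1 y2. F (x1 * y1) (x2 * y2)))"
    by (simp add: tensor_alg_def cop2_def tlift_fun_apply tens_eq_apply[OF bilin_form_H[OF F]])
  finally show ?thesis .
qed

lemma cop2_one:
  assumes F: "\<And>a. lin (F a)" "\<And>b. lin (\<lambda>a. F a b)"
  shows "cop2 H 1 F = F 1 1"
  by (simp add: cop2_bilinear_form[OF F] comult_one tensor_alg_def tens_eq_apply[OF bilin_form_H[OF F]])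

text \<open>
  Apply \<open>\<epsilon>\<close> to the antipode axiom and use the counit axiom for the remaining factor.
\<close>

lemma counit_antipode: "\<epsilon> (S x) = \<epsilon> x"
proof -
  have "lin (\<lambda>x. \<epsilon> (S x))" by (intro lin_app[OF lin_counit] linH_S linH_id)
  note h = linear_imp_hom(2)[OF this]
  have "\<epsilon> x = \<epsilon> (cop2 H x (\<lambda>x1 x2. S x1 * x2))"
    by (simp add: antipode_left linear_imp_hom(2)[OF lin_counit] counit_one)
  also have "\<dots> = cop2 H x (\<lambda>x1 x2. \<epsilon> (S x1) * \<epsilon> x2)"
    by (simp add: linear_cop2_value[OF lin_counit] counit_mult)
  also have "\<dots> = \<epsilon> (S (cop2 H x (\<lambda>x1 x2. scl (\<epsilon> x2) x1)))"
    using linear_cop2_value[OF \<open>lin (\<lambda>x. \<epsilon> (S x))\<close>, of x "\<lambda>x1 x2. scl (\<epsilon> x2) x1"] by (simp add: h mult.commute)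
  finally show ?thesis by (simp add: counit_right)
qed

end

context hopf_points
begin

lemma ev_point: "point g \<Longrightarrow> lin \<phi> \<Longrightarrow> ev g (\<lambda>x. scR (\<phi> x) m) = g \<phi> \<bullet> m"
  by (rule ev_lin[OF pointD(1)])

lemma ev_point_one: "point g \<Longrightarrow> lin \<phi> \<Longrightarrow> ev g (\<lambda>x. scR (\<phi> x) one) = g \<phi>"
  by (simp add: ev_point mul_one pointD(5))

lemma point_eqI: "point f \<Longrightarrow> point g \<Longrightarrow> (\<And>\<phi>. lin \<phi> \<Longrightarrow> f \<phi> = g \<phi>) \<Longrightarrow> f = g"
  by (metis ext pointD(2))

lemma pmul_eq:
  assumes "point f" "point g" "lin \<phi>"
  shows "(f \<star> g) \<phi> = ev f (\<lambda>x. ev g (\<lambda>y. scR (\<phi> (x * y)) one))"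
proof -
  have "(f \<star> g) \<phi> \<in> R" using assms by (auto simp: pmul_def pointD(5) intro!: R_sum R_scale R_mul)
  then show ?thesis by (simp add: pmul_apply[OF assms(3)] mul_one)
qed

lemma alg_hom_DI:
  assumes "\<And>\<phi>. lin \<phi> \<Longrightarrow> g \<phi> \<in> R" "\<And>\<phi> \<psi>. lin \<phi> \<Longrightarrow> lin \<psi> \<Longrightarrow> g (\<lambda>x. \<phi> x + \<psi> x) = g \<phi> + g \<psi>"
    "\<And>\<phi> c. lin \<phi> \<Longrightarrow> g (\<lambda>x. c * \<phi> x) = scR c (g \<phi>)"
    "\<And>\<phi> \<psi>. lin \<phi> \<Longrightarrow> lin \<psi> \<Longrightarrow> g (conv H \<phi> \<psi>) = g \<phi> \<bullet> g \<psi>" "g \<epsilon> = one"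
  shows "alg_hom D g"
  using assms by (simp add: alg_hom_def lin_map_def plus_fun_def)

lemma lin_add: "lin \<phi> \<Longrightarrow> lin \<psi> \<Longrightarrow> lin (\<lambda>x. \<phi> x + \<psi> x)"
  by (simp add: lin_iff algebra_simps)

lemma lin_conv_mult: "lin \<phi> \<Longrightarrow> lin \<psi> \<Longrightarrow> conv H \<phi> \<psi> (x * y) =
    cop2 H x (\<lambda>x1 x2. cop2 H y (\<lambda>y1 y2. \<phi> (x1 * y1) * \<psi> (x2 * y2)))"
  unfolding conv_def by (rule cop2_mult) (intro linR_intros; assumption)+

text \<open>
  The product of two points is multiplicative because the comultiplication of \<open>H\<close> is.
\<close>

lemma point_pmul:
  assumes f: "point f" and g: "point g"
  shows "point (f \<star> g)"
  unfolding point_def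
proof (intro conjI allI impI alg_hom_DI)
  fix \<phi> \<psi> c
  assume \<phi>: "lin \<phi>"
  show "(f \<star> g) \<phi> \<in> R"
    using \<phi> f g by (auto simp: pmul_def pointD(5) intro!: R_sum R_scale R_mul)
  show "(f \<star> g) (\<lambda>x. c * \<phi> x) = scR c ((f \<star> g) \<phi>)"
    using \<phi> by (simp add: pmul_def lin_mult_right val.scale_sum_right)
  assume \<psi>: "lin \<psi>"
  show "(f \<star> g) (\<lambda>x. \<phi> x + \<psi> x) = (f \<star> g) \<phi> + (f \<star> g) \<psi>"
    using \<phi> \<psi> by (simp add: pmul_def lin_add val.scale_left_distrib sum.distrib)
  note li = linR_intros lin_app[OF \<phi>] lin_app[OF \<psi>]
  have "(f \<star> g) (conv H \<phi> \<psi>) = ev f (\<lambda>x. cop2 H x (\<lambda>x1 x2. ev g (\<lambda>y. cop2 H y (\<lambda>y1 y2.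
      scR (\<phi> (x1 * y1) * \<psi> (x2 * y2)) one))))"
    by (simp add: pmul_eq f g lin_conv \<phi> \<psi> lin_conv_mult scR_cop2 ev_cop2_inner)
  also have "\<dots> = ev f (\<lambda>x1. ev f (\<lambda>x2. ev g (\<lambda>y. cop2 H y (\<lambda>y1 y2.
      scR (\<phi> (x1 * y1) * \<psi> (x2 * y2)) one))))"
    by (rule ev_cop2[OF pointD(1)[OF f]]) (intro li)+
  also have "\<dots> = ev f (\<lambda>x1. ev f (\<lambda>x2. ev g (\<lambda>y1. ev g (\<lambda>y2.
      scR (\<phi> (x1 * y1) * \<psi> (x2 * y2)) one))))"
    by (intro ev_cong ev_cop2[OF pointD(1)[OF g]] li)
  also have "\<dots> = (f \<star> g) \<phi> \<bullet> (f \<star> g) \<psi>"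
    by (simp add: scR_mult_one ev_mul_left ev_mul_right pmul_eq f g \<phi> \<psi>)
  finally show "(f \<star> g) (conv H \<phi> \<psi>) = (f \<star> g) \<phi> \<bullet> (f \<star> g) \<psi>" .
next
  show "(f \<star> g) \<epsilon> = one"
    by (simp add: pmul_eq f g lin_counit counit_mult scR_mult_one ev_mul_left ev_mul_right
        ev_point_one pointD(4) one_mul R_one)
qed (simp add: pmul_def)

lemma point_pone: "point pone"
  unfolding point_def
proof (intro conjI allI impI alg_hom_DI)
  fix \<phi> \<psi> c
  assume \<phi>: "lin \<phi>"
  show "pone \<phi> \<in> R" using \<phi> by (simp add: pone_def R_one R_scale)
  show "pone (\<lambda>x. c * \<phi> x) = scR c (pone \<phi>)" using \<phi> by (simp add: pone_def lin_mult_right)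
  assume \<psi>: "lin \<psi>"
  show "pone (\<lambda>x. \<phi> x + \<psi> x) = pone \<phi> + pone \<psi>"
    using \<phi> \<psi> by (simp add: pone_def lin_add val.scale_left_distrib)
  have "conv H \<phi> \<psi> 1 = \<phi> 1 * \<psi> 1"
    unfolding conv_def by (rule cop2_one) (intro linR_intros \<phi> \<psi>)+
  then show "pone (conv H \<phi> \<psi>) = pone \<phi> \<bullet> pone \<psi>"
    using \<phi> \<psi> by (simp add: pone_def lin_conv scR_mult_one)
next
  show "pone \<epsilon> = one" by (simp add: pone_def lin_counit counit_one)
qed (simp add: pone_def)

lemma ev_pone: "linR M \<Longrightarrow> M 1 \<in> R \<Longrightarrow> ev pone M = M 1"
  by (simp add: ev_def pone_def lin_coord mul_scale_left mul_sum_right[symmetric] linear_coord[of scR M 1])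
    (simp add: mul_scale_right[symmetric] mul_sum_right[symmetric] one_mul linear_coord[of scR M 1, symmetric])

text \<open>
  Since \<open>g\<close> is grouplike, the two copies of \<open>g\<close> are the two halves of its comultiplication, and the
  antipode axiom applies.
\<close>

lemma ev_antipode_left:
  assumes g: "point g" and N: "linR N" "N 1 \<in> R"
  shows "ev g (\<lambda>x. ev g (\<lambda>y. N (S x * y))) = N 1" (is "?lhs = _")
proof -
  have "?lhs = ev g (\<lambda>x. cop2 H x (\<lambda>x y. N (S x * y)))"
    by (rule ev_cop2[OF pointD(1)[OF g], symmetric]) (intro linR_intros linR_app[OF N(1)])+
  also have "\<dots> = ev g (\<lambda>x. N (cop2 H x (\<lambda>x y. S x * y)))"
    unfolding cop2_def using linear_imp_hom[OF N(1)] by (intro ev_cong tlift_hom[symmetric]) auto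
  also have "\<dots> = ev g (\<lambda>x. scR (\<epsilon> x) (N 1))"
    by (simp add: antipode_left linear_imp_hom(2)[OF N(1)])
  finally show ?thesis by (simp add: ev_point g lin_counit pointD(4) one_mul N)
qed

lemma ev_antipode_right:
  assumes g: "point g" and N: "linR N" "N 1 \<in> R"
  shows "ev g (\<lambda>x. ev g (\<lambda>y. N (x * S y))) = N 1" (is "?lhs = _")
proof -
  have "?lhs = ev g (\<lambda>x. cop2 H x (\<lambda>x y. N (x * S y)))"
    by (rule ev_cop2[OF pointD(1)[OF g], symmetric]) (intro linR_intros linR_app[OF N(1)])+
  also have "\<dots> = ev g (\<lambda>x. N (cop2 H x (\<lambda>x y. x * S y)))"
    unfolding cop2_def using linear_imp_hom[OF N(1)] by (intro ev_cong tlift_hom[symmetric]) auto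
  also have "\<dots> = ev g (\<lambda>x. scR (\<epsilon> x) (N 1))"
    by (simp add: antipode_right linear_imp_hom(2)[OF N(1)])
  finally show ?thesis by (simp add: ev_point g lin_counit pointD(4) one_mul N)
qed

lemma R_scale_one: "scR c one \<in> R"
  by (simp add: R_scale R_one)

text \<open>
  The antipode respects the comultiplication, in the form needed for \<open>pinv g\<close> to be a point.  Writing
  \<open>\<phi>(S x) \<psi>(S y)\<close> with a factor \<open>\<Delta>(1) = \<Delta>(v\<^sub>1) \<Delta>(S v\<^sub>2)\<close> inserted and evaluating everything at the same
  point \<open>g\<close>, the arguments become \<open>g\<^sup>-\<^sup>1 g\<close> times the two halves of \<open>S b\<close>, and \<open>g\<^sup>-\<^sup>1 g\<close> cancels in each
  of them.
\<close>

lemma pinv_conv: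
  assumes g: "point g" and \<phi>: "lin \<phi>" and \<psi>: "lin \<psi>"
  shows "pinv g (conv H \<phi> \<psi>) = pinv g \<phi> \<bullet> pinv g \<psi>"
proof -
  note li = linR_intros lin_app[OF \<phi>] lin_app[OF \<psi>] linear_imp_hom(5)
  \<comment> \<open>The factor \<open>\<epsilon> v\<close> makes room for \<open>\<Delta>(1)\<close>; at a point it evaluates to the unit.\<close>
  have expand: "\<epsilon> v * (\<phi> (S x) * \<psi> (S y)) = cop2 H v (\<lambda>a b. cop2 H a (\<lambda>c d. cop2 H (S b) (\<lambda>p q.
      \<phi> (S x * c * p) * \<psi> (S y * d * q))))" for v x y
  proof -
    have c: "lin (\<lambda>v. cop2 H v (\<lambda>a b. \<phi> (S x * a) * \<psi> (S y * b)))" by (intro li)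
    have "\<epsilon> v * (\<phi> (S x) * \<psi> (S y)) = \<epsilon> v * cop2 H 1 (\<lambda>a b. \<phi> (S x * a) * \<psi> (S y * b))"
      by (subst cop2_one) (simp | intro li)+
    also have "\<dots> = cop2 H (cop2 H v (\<lambda>a b. a * S b)) (\<lambda>a b. \<phi> (S x * a) * \<psi> (S y * b))"
      by (simp add: antipode_right linear_imp_hom(2)[OF c])
    also have "\<dots> = cop2 H v (\<lambda>a b. cop2 H (a * S b) (\<lambda>a b. \<phi> (S x * a) * \<psi> (S y * b)))"
      by (rule linear_cop2_value[OF c])
    also have "\<dots> = cop2 H v (\<lambda>a b. cop2 H a (\<lambda>c d. cop2 H (S b) (\<lambda>p q. \<phi> (S x * c * p) * \<psi> (S y * d * q))))"
      by (subst cop2_mult) (simp add: mult.assoc | intro li)+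
    finally show ?thesis .
  qed
  have reorder: "ev g (\<lambda>x. ev g (\<lambda>y. ev g (\<lambda>b. ev g (\<lambda>c. F x y b c))))
    = ev g (\<lambda>b. ev g (\<lambda>x. ev g (\<lambda>c. ev g (\<lambda>y. F x y b c))))" (is "?l1 = _") for F
  proof -
    have "?l1
      = ev g (\<lambda>x. ev g (\<lambda>b. ev g (\<lambda>y. ev g (\<lambda>c. F x y b c))))"
      by (rule ev_cong, rule ev_swap)
    also have "\<dots> = ev g (\<lambda>b. ev g (\<lambda>x. ev g (\<lambda>y. ev g (\<lambda>c. F x y b c))))"
      by (rule ev_swap)
    also have "\<dots> = ev g (\<lambda>b. ev g (\<lambda>x. ev g (\<lambda>c. ev g (\<lambda>y. F x y b c))))"
      by (rule ev_cong, rule ev_cong, rule ev_swap)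
    finally show ?thesis .
  qed
  have gl: "lin (\<lambda>x. \<phi> (S x))" "lin (\<lambda>x. \<psi> (S x))" by (intro li)+
  have "pinv g \<phi> \<bullet> pinv g \<psi> = ev g (\<lambda>x. ev g (\<lambda>y. ev g (\<lambda>v. scR (\<epsilon> v * (\<phi> (S x) * \<psi> (S y))) one)))"
    by (simp add: scR_mult_one ev_mul_left ev_mul_right ev_point_one g lin_counit pointD(4,5) one_mul
        pinv_def \<phi> \<psi> gl R_mul)
  also have "\<dots> = ev g (\<lambda>x. ev g (\<lambda>y. ev g (\<lambda>v. cop2 H v (\<lambda>a b. cop2 H a (\<lambda>c d. cop2 H (S b) (\<lambda>p q.
      scR (\<phi> (S x * c * p) * \<psi> (S y * d * q)) one))))))"
    by (simp add: expand scR_cop2)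
  also have "\<dots> = ev g (\<lambda>x. ev g (\<lambda>y. ev g (\<lambda>b. ev g (\<lambda>a. cop2 H a (\<lambda>c d. cop2 H (S b) (\<lambda>p q.
      scR (\<phi> (S x * c * p) * \<psi> (S y * d * q)) one))))))"
  proof (rule ev_cong, rule ev_cong)
    fix x y
    show "ev g (\<lambda>v. cop2 H v (\<lambda>a b. cop2 H a (\<lambda>c d. cop2 H (S b) (\<lambda>p q.
        scR (\<phi> (S x * c * p) * \<psi> (S y * d * q)) one))))
      = ev g (\<lambda>b. ev g (\<lambda>a. cop2 H a (\<lambda>c d. cop2 H (S b) (\<lambda>p q. scR (\<phi> (S x * c * p) * \<psi> (S y * d * q)) one))))"
      apply (subst ev_cop2[OF pointD(1)[OF g]])
        apply (intro li linear_cop2_inner[where s = scR] linR_app[OF linear_cop2[where s = scR]])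
       apply (intro li)
      apply (rule ev_swap)
      done
  qed
  also have "\<dots> = ev g (\<lambda>x. ev g (\<lambda>y. ev g (\<lambda>b. ev g (\<lambda>c. ev g (\<lambda>d. cop2 H (S b) (\<lambda>p q.
      scR (\<phi> (S x * c * p) * \<psi> (S y * d * q)) one))))))"
    by (intro ev_cong ev_cop2[OF pointD(1)[OF g]] li)
  also have "\<dots> = ev g (\<lambda>b. ev g (\<lambda>x. ev g (\<lambda>c. ev g (\<lambda>y. ev g (\<lambda>d. cop2 H (S b) (\<lambda>p q.
      scR (\<phi> (S x * c * p) * \<psi> (S y * d * q)) one))))))"
    by (rule reorder)
  also have "\<dots> = ev g (\<lambda>b. scR (conv H \<phi> \<psi> (S b)) one)"
  proof (rule ev_cong)
    fix b
    \<comment> \<open>Twice \<open>g\<^sup>-\<^sup>1 g = 1\<close>, once for each half of \<open>S b\<close>.\<close>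
    define K where "K u v = scR (cop2 H (S b) (\<lambda>p q. \<phi> (u * p) * \<psi> (v * q))) one" for u v
    have K: "linR (\<lambda>u. K u v)" "linR (\<lambda>v. K u v)" "K u v \<in> R" for u v
      unfolding K_def by (intro li R_scale_one)+
    have "ev g (\<lambda>x. ev g (\<lambda>c. ev g (\<lambda>y. ev g (\<lambda>d. K (S x * c) (S y * d))))) = K 1 1"
      by (subst ev_antipode_left[OF g K(2,3)]) (rule ev_antipode_left[OF g K(1,3)])
    then show "ev g (\<lambda>x. ev g (\<lambda>c. ev g (\<lambda>y. ev g (\<lambda>d. cop2 H (S b) (\<lambda>p q.
        scR (\<phi> (S x * c * p) * \<psi> (S y * d * q)) one))))) = scR (conv H \<phi> \<psi> (S b)) one"
      by (simp add: K_def scR_cop2 conv_def)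
  qed
  also have "\<dots> = pinv g (conv H \<phi> \<psi>)"
    by (subst ev_point_one[OF g]) (simp_all add: pinv_def lin_conv \<phi> \<psi> lin_app linH_S linH_id)
  finally show ?thesis by simp
qed

lemma point_pinv:
  assumes g: "point g"
  shows "point (pinv g)"
  unfolding point_def
proof (intro conjI allI impI alg_hom_DI)
  fix \<phi> \<psi> c
  assume \<phi>: "lin \<phi>"
  have S: "lin (\<lambda>x. \<phi> (S x))" if "lin \<phi>" for \<phi>
    by (intro lin_app[OF that] linH_S linH_id)
  note gD = alg_homD[OF pointD(1)[OF g], simplified, unfolded plus_fun_def]
  show "pinv g \<phi> \<in> R" using \<phi> by (simp add: pinv_def pointD(5)[OF g])
  show "pinv g (\<lambda>x. c * \<phi> x) = scR c (pinv g \<phi>)"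
    using \<phi> S[OF \<phi>] by (simp add: pinv_def lin_mult_right gD)
  assume \<psi>: "lin \<psi>"
  show "pinv g (\<lambda>x. \<phi> x + \<psi> x) = pinv g \<phi> + pinv g \<psi>"
    using \<phi> \<psi> S[OF \<phi>] S[OF \<psi>] by (simp add: pinv_def lin_add gD)
  show "pinv g (conv H \<phi> \<psi>) = pinv g \<phi> \<bullet> pinv g \<psi>"
    by (rule pinv_conv[OF g \<phi> \<psi>])
next
  show "pinv g \<epsilon> = one" by (simp add: pinv_def lin_counit counit_antipode pointD(4)[OF g])
qed (simp add: pinv_def)

lemma ev_pinv:
  assumes M: "linR M" and g: "point g"
  shows "ev g (\<lambda>x. M (S x)) = ev (pinv g) M"
proof -
  have "ev g (\<lambda>x. M (S x)) = ev g (\<lambda>x. \<Sum>b\<in>Basis. scR (coord b (S x)) (M b))"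
    by (rule ev_cong) (rule linear_coord[OF M])
  also have "\<dots> = (\<Sum>b\<in>Basis. ev g (\<lambda>x. scR (coord b (S x)) (M b)))"
    unfolding ev_def mul_sum_right by (rule sum.swap)
  also have "\<dots> = (\<Sum>b\<in>Basis. pinv g (coord b) \<bullet> M b)"
    by (intro sum.cong refl, subst ev_point[OF g])
      (simp_all add: pinv_def lin_coord lin_app[OF lin_coord] linH_S linH_id)
  finally show ?thesis by (simp add: ev_def)
qed

lemma pmul_assoc:
  assumes f: "point f" and g: "point g" and h: "point h"
  shows "(f \<star> g) \<star> h = f \<star> (g \<star> h)"
proof (rule point_eqI)
  fix \<phi> assume \<phi>: "lin \<phi>"
  note li = linR_intros lin_app[OF \<phi>]
  have "((f \<star> g) \<star> h) \<phi> = ev f (\<lambda>x. ev g (\<lambda>y. ev h (\<lambda>z. scR (\<phi> (x * y * z)) one)))"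
    by (simp only: pmul_eq point_pmul f g h \<phi>) (rule ev_pmul[symmetric], intro li)
  also have "\<dots> = (f \<star> (g \<star> h)) \<phi>"
    unfolding mult.assoc
    by (simp only: pmul_eq point_pmul f g h \<phi>) (intro ev_cong ev_pmul li)
  finally show "((f \<star> g) \<star> h) \<phi> = (f \<star> (g \<star> h)) \<phi>" .
qed (intro point_pmul f g h)+

lemma pone_left: "point f \<Longrightarrow> pone \<star> f = f"
proof (rule point_eqI)
  fix \<phi> assume f: "point f" and \<phi>: "lin \<phi>"
  note li = linR_intros lin_app[OF \<phi>]
  have "(pone \<star> f) \<phi> = ev pone (\<lambda>x. ev f (\<lambda>y. scR (\<phi> (x * y)) one))"
    by (simp add: pmul_eq point_pone f \<phi>)
  also have "\<dots> = ev f (\<lambda>y. scR (\<phi> (1 * y)) one)"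
    by (rule ev_pone) (intro li ev_closed[OF f] R_scale_one)+
  finally show "(pone \<star> f) \<phi> = f \<phi>" by (simp add: ev_point_one f \<phi>)
qed (simp_all add: point_pmul point_pone)

lemma pinv_left: "point f \<Longrightarrow> pinv f \<star> f = pone"
proof (rule point_eqI)
  fix \<phi> assume f: "point f" and \<phi>: "lin \<phi>"
  note li = linR_intros lin_app[OF \<phi>]
  have "(pinv f \<star> f) \<phi> = ev (pinv f) (\<lambda>x. ev f (\<lambda>y. scR (\<phi> (x * y)) one))"
    by (simp add: pmul_eq point_pinv f \<phi>)
  also have "\<dots> = ev f (\<lambda>x. ev f (\<lambda>y. scR (\<phi> (S x * y)) one))"
    by (rule ev_pinv[OF _ f, symmetric]) (intro li)
  also have "\<dots> = scR (\<phi> 1) one"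
    by (rule ev_antipode_left[OF f]) (intro li \<phi> R_scale_one)+
  finally show "(pinv f \<star> f) \<phi> = pone \<phi>" by (simp add: pone_def \<phi>)
qed (simp_all add: point_pmul point_pone point_pinv)

lemma pinv_right: "point f \<Longrightarrow> f \<star> pinv f = pone"
proof (rule point_eqI)
  fix \<phi> assume f: "point f" and \<phi>: "lin \<phi>"
  note li = linR_intros lin_app[OF \<phi>]
  have "(f \<star> pinv f) \<phi> = ev f (\<lambda>x. ev (pinv f) (\<lambda>y. scR (\<phi> (x * y)) one))"
    by (simp add: pmul_eq point_pinv f \<phi>)
  also have "\<dots> = ev f (\<lambda>x. ev f (\<lambda>y. scR (\<phi> (x * S y)) one))"
    by (intro ev_cong ev_pinv[OF _ f, symmetric] li)
  also have "\<dots> = scR (\<phi> 1) one"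
    by (rule ev_antipode_right[OF f]) (intro li \<phi> R_scale_one)+
  finally show "(f \<star> pinv f) \<phi> = pone \<phi>" by (simp add: pone_def \<phi>)
qed (simp_all add: point_pmul point_pone point_pinv)

lemma pinv_left_cancel: "point f \<Longrightarrow> point g \<Longrightarrow> pinv f \<star> (f \<star> g) = g"
  by (simp add: pmul_assoc[symmetric] point_pinv pinv_left pone_left)

lemma pinv_right_cancel: "point f \<Longrightarrow> point g \<Longrightarrow> f \<star> (pinv f \<star> g) = g"
  by (simp add: pmul_assoc[symmetric] point_pinv pinv_right pone_left)

lemma pone_right: "point f \<Longrightarrow> f \<star> pone = f"
  by (metis pinv_left pinv_right pmul_assoc pone_left point_pinv)

lemma pinv_unique: "point f \<Longrightarrow> point g \<Longrightarrow> f \<star> g = pone \<Longrightarrow> g = pinv f"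
  by (metis pinv_left_cancel pone_right point_pinv)

lemma pinv_pinv: "point f \<Longrightarrow> pinv (pinv f) = f"
  by (metis pinv_left pinv_unique point_pinv)

lemma pinv_pmul: "point f \<Longrightarrow> point g \<Longrightarrow> pinv (f \<star> g) = pinv g \<star> pinv f"
  by (rule pinv_unique[symmetric])
    (simp_all add: point_pmul point_pinv pmul_assoc pinv_right_cancel pinv_right)

lemma pinv_pone: "pinv pone = pone"
  by (metis pinv_unique point_pone pone_left)

lemmas point_simps = point_pmul point_pinv point_pone pmul_assoc pone_left pone_right
  pinv_left pinv_right pinv_left_cancel pinv_right_cancel pinv_pinv pinv_pmul pinv_pone

end

section \<open>The group cocycle on points\<close>

context fd_cocommutative_hopf_algebra
begin

abbreviation trilin :: "('h \<Rightarrow> 'h \<Rightarrow> 'h \<Rightarrow> 'k) \<Rightarrow> bool" where "trilin F \<equiv> trilinear_form H F"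

lemma trilin_iff: "trilin F \<longleftrightarrow> (\<forall>y z. lin (\<lambda>x. F x y z)) \<and> (\<forall>x z. lin (\<lambda>y. F x y z)) \<and> (\<forall>x y. lin (\<lambda>z. F x y z))"
  by (simp add: trilinear_form_def)

lemma trilin_app:
  assumes "trilin F" "linH f"
  shows "lin (\<lambda>x. F (f x) y z)" "lin (\<lambda>y. F x (f y) z)" "lin (\<lambda>z. F x y (f z))"
  using assms(1) lin_app[OF _ assms(2), of "\<lambda>x. F x y z"] lin_app[OF _ assms(2), of "\<lambda>y. F x y z"]
    lin_app[OF _ assms(2), of "\<lambda>z. F x y z"]
  by (simp_all add: trilin_iff)

end

context hopf_points
begin

text \<open>
  The value of a trilinear form at three points.
\<close>

definition tri :: "('h \<Rightarrow> 'h \<Rightarrow> 'h \<Rightarrow> 'k) \<Rightarrow> (('h \<Rightarrow> 'k) \<Rightarrow> 'r) \<Rightarrow> (('h \<Rightarrow> 'k) \<Rightarrow> 'r) \<Rightarrow> (('h \<Rightarrow> 'k) \<Rightarrow> 'r) \<Rightarrow> 'r" where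
  "tri F f g h = ev f (\<lambda>x. ev g (\<lambda>y. ev h (\<lambda>z. scR (F x y z) one)))"

lemma tri_closed: "point f \<Longrightarrow> point g \<Longrightarrow> point h \<Longrightarrow> tri F f g h \<in> R"
  unfolding tri_def by (intro ev_closed R_scale_one)

lemmas ev_cop2_point = ev_cop2[OF pointD(1)]

text \<open>
  Rewriting with \<open>ev_expand\<close> duplicates the points of an evaluated Sweedler sum; rewriting with
  \<open>ev_split\<close> then distributes the evaluations over the factors of a product.
\<close>

lemmas ev_expand = scR_cop2 ev_cop2_inner ev_cop2_point cop3_def cop4_def cop5_def
lemmas ev_split = scR_mult_one ev_mul_left ev_mul_right

lemma tri_conv:
  assumes F: "trilin F" and G: "trilin G" and f: "point f" and g: "point g" and h: "point h"
  shows "tri (conv3 H F G) f g h = tri F f g h \<bullet> tri G f g h"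
proof -
  note li = linR_intros trilin_app[OF F] trilin_app[OF G]
  show ?thesis
    unfolding tri_def conv3_def by (simp add: ev_expand f g h li) (simp add: ev_split)
qed

lemma tri_counit:
  assumes "point f" "point g" "point h"
  shows "tri (\<lambda>x y z. \<epsilon> x * \<epsilon> y * \<epsilon> z) f g h = one"
  using assms by (simp add: tri_def scR_mult_one ev_mul_left ev_mul_right ev_point_one lin_counit
      pointD(4) one_mul R_one)

end

text \<open>
  The convolution inverse is a parameter; it is unique, but its uniqueness is obtained only from the
  generic value algebra below.
\<close>

locale cocycle_points = hopf_points where scl = scl and Basis = Basis and \<Delta> = \<Delta> and \<epsilon> = \<epsilon> and S = S
    and scR = scR and R = R and mul = mul and one = one
  for scl :: "'k::field \<Rightarrow> 'h::ring_1 \<Rightarrow> 'h" and Basis \<Delta> \<epsilon> S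
    and scR :: "'k \<Rightarrow> 'r::ab_group_add \<Rightarrow> 'r" and R and mul (infixl "\<bullet>" 70) and one +
  fixes \<omega> \<eta> :: "'h \<Rightarrow> 'h \<Rightarrow> 'h \<Rightarrow> 'k"
  assumes cocycle: "normalized_3_cocycle H \<omega>" and inverse: "is_conv_inverse3 H \<omega> \<eta>"
begin

lemma trilin_omega: "trilin \<omega>" and trilin_eta: "trilin \<eta>"
  using cocycle inverse by (simp_all add: normalized_3_cocycle_def is_conv_inverse3_def)

abbreviation om where "om \<equiv> tri \<omega>"
abbreviation et where "et \<equiv> tri \<eta>"

lemma om_et: "point f \<Longrightarrow> point g \<Longrightarrow> point h \<Longrightarrow> om f g h \<bullet> et f g h = one"
proof -
  have e: "conv3 H \<omega> \<eta> = (\<lambda>x y z. \<epsilon> x * \<epsilon> y * \<epsilon> z)"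
    using inverse by (simp add: is_conv_inverse3_def fun_eq_iff)
  show "point f \<Longrightarrow> point g \<Longrightarrow> point h \<Longrightarrow> om f g h \<bullet> et f g h = one"
    by (simp add: tri_conv[OF trilin_omega trilin_eta, symmetric] e tri_counit)
qed

lemma normalized: "\<omega> 1 x y = \<epsilon> x * \<epsilon> y" "\<omega> x 1 y = \<epsilon> x * \<epsilon> y" "\<omega> x y 1 = \<epsilon> x * \<epsilon> y"
  using cocycle by (simp_all add: normalized_3_cocycle_def)

lemma om_pone:
  assumes f: "point f" and g: "point g"
  shows "om pone f g = one" "om f pone g = one" "om f g pone = one"
proof -
  note li = linR_intros trilin_app[OF trilin_omega]
  have e: "ev f (\<lambda>x. ev g (\<lambda>y. scR (\<epsilon> x * \<epsilon> y) one)) = one"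
    by (simp add: scR_mult_one ev_mul_left ev_mul_right ev_point_one f g lin_counit pointD(4) one_mul R_one)
  have "om pone f g = ev f (\<lambda>y. ev g (\<lambda>z. scR (\<omega> 1 y z) one))"
    unfolding tri_def by (rule ev_pone) (intro li ev_closed f g R_scale_one)+
  then show "om pone f g = one" by (simp add: normalized e)
  have "om f pone g = ev f (\<lambda>x. ev g (\<lambda>z. scR (\<omega> x 1 z) one))"
    unfolding tri_def by (intro ev_cong ev_pone) (intro li ev_closed f g R_scale_one)+
  then show "om f pone g = one" by (simp add: normalized e)
  have "om f g pone = ev f (\<lambda>x. ev g (\<lambda>y. scR (\<omega> x y 1) one))"
    unfolding tri_def by (intro ev_cong ev_pone) (intro li ev_closed f g R_scale_one)+
  then show "om f g pone = one" by (simp add: normalized e)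
qed

lemma om_cocycle:
  assumes f: "point f" and g: "point g" and h: "point h" and k: "point k"
  shows "om f g (h \<star> k) \<bullet> om (f \<star> g) h k = om g h k \<bullet> om f (g \<star> h) k \<bullet> om f g h"
proof -
  note li = linR_intros trilin_app[OF trilin_omega]
  define L where "L x y z t = cop2 H x (\<lambda>x1 x2. cop2 H y (\<lambda>y1 y2. cop2 H z (\<lambda>z1 z2. cop2 H t (\<lambda>t1 t2.
          \<omega> x1 y1 (z1 * t1) * \<omega> (x2 * y2) z2 t2))))" for x y z t
  define E where "E L = ev f (\<lambda>x. ev g (\<lambda>y. ev h (\<lambda>z. ev k (\<lambda>t. scR (L x y z t) one))))" for L
  have L: "L x y z t = cop2 H x (\<lambda>x1 x2. cop3 H y (\<lambda>y1 y2 y3. cop3 H z (\<lambda>z1 z2 z3. cop2 H t (\<lambda>t1 t2.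
          \<omega> y1 z1 t1 * \<omega> x1 (y2 * z2) t2 * \<omega> x2 y3 z3))))" for x y z t
    using cocycle by (simp add: normalized_3_cocycle_def L_def)
  have "E L = ev f (\<lambda>x. ev g (\<lambda>y. ev h (\<lambda>z. ev k (\<lambda>t. scR (\<omega> x y (z * t)) one))))
      \<bullet> ev f (\<lambda>x. ev g (\<lambda>y. ev h (\<lambda>z. ev k (\<lambda>t. scR (\<omega> (x * y) z t) one))))"
    unfolding E_def L_def by (simp add: ev_expand f g h k li) (simp add: ev_split)
  also have "\<dots> = om f g (h \<star> k) \<bullet> om (f \<star> g) h k"
    unfolding tri_def by (intro arg_cong2[where f = mul] ev_cong ev_pmul li)
  finally have 1: "E L = om f g (h \<star> k) \<bullet> om (f \<star> g) h k" .
  have "E L = ev g (\<lambda>y. ev h (\<lambda>z. ev k (\<lambda>t. scR (\<omega> y z t) one)))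
      \<bullet> ev f (\<lambda>x. ev g (\<lambda>y. ev h (\<lambda>z. ev k (\<lambda>t. scR (\<omega> x (y * z) t) one))))
      \<bullet> ev f (\<lambda>x. ev g (\<lambda>y. ev h (\<lambda>z. scR (\<omega> x y z) one)))"
    unfolding E_def L by (simp add: ev_expand f g h k li) (simp add: ev_split)
  also have "\<dots> = om g h k \<bullet> om f (g \<star> h) k \<bullet> om f g h"
    unfolding tri_def by (intro arg_cong2[where f = mul] ev_cong ev_pmul li refl)
  finally show ?thesis using 1 by simp
qed

text \<open>
  The cocycle identity at \<open>(g,g\<^sup>-\<^sup>1,g,g\<^sup>-\<^sup>1)\<close>, where three of the five factors are normalized.
\<close>

lemma om_antipode:
  assumes g: "point g"
  shows "om (pinv g) g (pinv g) \<bullet> om g (pinv g) g = one"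
  using om_cocycle[of g "pinv g" g "pinv g"] g
  by (simp add: point_simps om_pone one_mul mul_one tri_closed R_mul R_one)

text \<open>
  The cocycle identity at \<open>(f,h\<^sup>-\<^sup>1,h,h\<^sup>-\<^sup>1)\<close>.  The product on the left is the scalar by which both
  composites of \<open>w\<close> and \<open>W\<close> act.
\<close>

lemma om_et_inverse_map:
  assumes f: "point f" and h: "point h"
  shows "om f (pinv h) h \<bullet> om (pinv h) h (pinv h) \<bullet> et (f \<star> pinv h) h (pinv h) = one"
proof -
  have "om (f \<star> pinv h) h (pinv h) = om (pinv h) h (pinv h) \<bullet> om f (pinv h) h"
    using om_cocycle[of f "pinv h" h "pinv h"] f h
    by (simp add: point_simps om_pone one_mul mul_one tri_closed R_mul)
  then show ?thesis
    using om_et[of "f \<star> pinv h" h "pinv h"] f h by (simp add: mul_commute[of "om f (pinv h) h"] point_simps)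
qed

text \<open>
  The values at points of \<open>\<theta>(a;x,y)\<close>, of \<open>\<gamma>\<close> and of \<open>\<Omega>\<close>.
\<close>

definition theta_pt where
  "theta_pt a x y = om a x y \<bullet> om x y (pinv (x \<star> y) \<star> a \<star> (x \<star> y)) \<bullet> et x (pinv x \<star> a \<star> x) y"

definition gamma_pt where
  "gamma_pt u v = et (pinv v) (pinv u) u \<bullet> om (pinv v \<star> pinv u) u v"

definition Omega_pt where
  "Omega_pt a1 a2 a3 a4 a5 = et (a1 \<star> a2 \<star> a3) (pinv a4) (pinv a5) \<bullet> om a1 a2 a3
     \<bullet> om a1 (a2 \<star> a3) (pinv a4) \<bullet> gamma_pt (pinv a4) (pinv a5)"

text \<open>
  The multiplicativity of \<open>w\<close> as an identity of group cocycles.  With \<open>b = x\<^sup>-\<^sup>1ax\<close> and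
  \<open>c = (xy)\<^sup>-\<^sup>1a(xy)\<close>, so that \<open>xb = ax\<close> and \<open>yc = by\<close>, comparing the cocycle identities at \<open>(x,b,y,y\<^sup>-\<^sup>1)\<close>
  and \<open>(a,x,y,y\<^sup>-\<^sup>1)\<close> eliminates \<open>\<omega>(ax,y,y\<^sup>-\<^sup>1)\<close>, and the one at \<open>(a,xy,y\<^sup>-\<^sup>1,x\<^sup>-\<^sup>1)\<close> then eliminates
  \<open>\<omega>(a,xy,y\<^sup>-\<^sup>1)\<close>.  The factor \<open>\<omega>(x,y,c)\<close> occurs on both sides.
\<close>

lemma multiplicative_pt:
  assumes a: "point a" and x: "point x" and y: "point y"
  shows "et a (x \<star> y) (pinv (x \<star> y)) \<bullet> Omega_pt x y (pinv (x \<star> y) \<star> a \<star> (x \<star> y)) y x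
    = et a x (pinv x) \<bullet> et (pinv x \<star> a \<star> x) y (pinv y) \<bullet> theta_pt a x y"
proof -
  define b where "b = pinv x \<star> a \<star> x"
  define c where "c = pinv (x \<star> y) \<star> a \<star> (x \<star> y)"
  have b: "point b" and c: "point c" by (simp_all add: b_def c_def point_simps a x y)
  have xb: "x \<star> b = a \<star> x" and yc: "y \<star> c = b \<star> y" and xbR: "x \<star> (b \<star> y) = a \<star> (x \<star> y)"
    by (simp_all add: b_def c_def point_simps a x y)
  note p = a x y b c point_simps
  note R = tri_closed p R_mul R_one
  have r1: "om (a \<star> x) y (pinv y) = om b y (pinv y) \<bullet> om x (b \<star> y) (pinv y) \<bullet> om x b y"
    using om_cocycle[of x b y "pinv y"] by (simp add: p om_pone one_mul tri_closed R_mul xb)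
  have r2: "om (a \<star> x) y (pinv y) = om x y (pinv y) \<bullet> om a (x \<star> y) (pinv y) \<bullet> om a x y"
    using om_cocycle[of a x y "pinv y"] by (simp add: p om_pone one_mul tri_closed R_mul)
  have r3: "om a (x \<star> y) (pinv (x \<star> y)) \<bullet> om (a \<star> (x \<star> y)) (pinv y) (pinv x)
      = om (x \<star> y) (pinv y) (pinv x) \<bullet> om a x (pinv x) \<bullet> om a (x \<star> y) (pinv y)"
    using om_cocycle[of a "x \<star> y" "pinv y" "pinv x"] by (simp add: p)
  \<comment> \<open>The identity is now one of monomials in units: each \<open>w\<close> is a value of \<open>\<omega>\<close>, \<open>e\<close> its inverse.\<close>
  define w0 w1 w3 w4 w5 w6 w7 w8 w9 wq where w:
    "w0 = om a (x \<star> y) (pinv (x \<star> y))" "w1 = om (a \<star> (x \<star> y)) (pinv y) (pinv x)"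
    "w3 = om x (b \<star> y) (pinv y)" "w4 = om x y (pinv y)" "w5 = om (x \<star> y) (pinv y) (pinv x)"
    "w6 = om a x (pinv x)" "w7 = om b y (pinv y)" "w8 = om a x y" "w9 = om x b y"
    "wq = om a (x \<star> y) (pinv y)"
  define e0 e1 e4 e6 e7 e9 eq where e:
    "e0 = et a (x \<star> y) (pinv (x \<star> y))" "e1 = et (a \<star> (x \<star> y)) (pinv y) (pinv x)"
    "e4 = et x y (pinv y)" "e6 = et a x (pinv x)" "e7 = et b y (pinv y)" "e9 = et x b y"
    "eq = et a (x \<star> y) (pinv y)"
  have we: "w0 \<bullet> e0 = one" "w1 \<bullet> e1 = one" "w4 \<bullet> e4 = one" "w6 \<bullet> e6 = one" "w7 \<bullet> e7 = one"
    "w9 \<bullet> e9 = one" "wq \<bullet> eq = one"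
    by (simp_all add: w e om_et p)
  have wR: "w0 \<in> R" "w1 \<in> R" "w3 \<in> R" "w4 \<in> R" "w5 \<in> R" "w6 \<in> R" "w7 \<in> R" "w8 \<in> R" "w9 \<in> R" "wq \<in> R"
    and eR: "e0 \<in> R" "e1 \<in> R" "e4 \<in> R" "e6 \<in> R" "e7 \<in> R" "e9 \<in> R" "eq \<in> R"
    by (simp_all add: w e tri_closed p)
  have 12: "w7 \<bullet> w3 \<bullet> w9 = w4 \<bullet> wq \<bullet> w8" using r1 r2 by (simp add: w)
  have 3: "w0 \<bullet> w1 = w5 \<bullet> w6 \<bullet> wq" using r3 by (simp add: w)
  have key: "w3 \<bullet> w5 \<bullet> w6 \<bullet> w7 \<bullet> w9 = w8 \<bullet> w0 \<bullet> w1 \<bullet> w4" (is "?l1 = _")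
  proof -
    have "?l1 = (w7 \<bullet> w3 \<bullet> w9) \<bullet> (w5 \<bullet> w6)" by (simp add: mul_ac)
    also have "\<dots> = (w5 \<bullet> w6 \<bullet> wq) \<bullet> w4 \<bullet> w8" unfolding 12 by (simp add: mul_ac)
    also have "\<dots> = w8 \<bullet> w0 \<bullet> w1 \<bullet> w4" unfolding 3[symmetric] by (simp add: mul_ac)
    finally show ?thesis .
  qed
  have "e0 \<bullet> (e1 \<bullet> w3 \<bullet> (e4 \<bullet> w5)) = (w6 \<bullet> e6) \<bullet> (w7 \<bullet> e7) \<bullet> (w9 \<bullet> e9) \<bullet> (e0 \<bullet> (e1 \<bullet> w3 \<bullet> (e4 \<bullet> w5)))"
    by (simp add: we one_mul R_mul wR eR R_one)
  also have "\<dots> = (w3 \<bullet> w5 \<bullet> w6 \<bullet> w7 \<bullet> w9) \<bullet> (e6 \<bullet> e7 \<bullet> e9 \<bullet> e0 \<bullet> e1 \<bullet> e4)"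
    by (simp add: mul_ac)
  also have "\<dots> = (w0 \<bullet> e0) \<bullet> (w1 \<bullet> e1) \<bullet> (w4 \<bullet> e4) \<bullet> (e6 \<bullet> e7 \<bullet> (w8 \<bullet> e9))"
    unfolding key by (simp add: mul_ac)
  also have "\<dots> = e6 \<bullet> e7 \<bullet> (w8 \<bullet> e9)"
    by (simp add: we one_mul R_mul wR eR R_one)
  finally have main: "e0 \<bullet> (e1 \<bullet> w3 \<bullet> (e4 \<bullet> w5)) = e6 \<bullet> e7 \<bullet> (w8 \<bullet> e9)" .
  have "Omega_pt x y c y x = e1 \<bullet> om x y c \<bullet> w3 \<bullet> (e4 \<bullet> w5)"
    using xbR yc by (simp add: Omega_pt_def gamma_pt_def e w p)
  moreover have "theta_pt a x y = w8 \<bullet> om x y c \<bullet> e9"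
    by (simp add: theta_pt_def w e b_def c_def)
  moreover have "e0 \<bullet> (e1 \<bullet> om x y c \<bullet> w3 \<bullet> (e4 \<bullet> w5)) = om x y c \<bullet> (e0 \<bullet> (e1 \<bullet> w3 \<bullet> (e4 \<bullet> w5)))"
    by (simp add: mul_ac)
  moreover have "e6 \<bullet> e7 \<bullet> (w8 \<bullet> om x y c \<bullet> e9) = om x y c \<bullet> (e6 \<bullet> e7 \<bullet> (w8 \<bullet> e9))"
    by (simp add: mul_ac)
  ultimately show ?thesis
    using main unfolding c_def[symmetric] b_def[symmetric] e[symmetric] by (simp add: e)
qed

end

section \<open>Trilinear forms as an algebra of values\<close>

context fd_cocommutative_hopf_algebra
begin

lemma cop2_cong: "(\<And>a b. F a b = G a b) \<Longrightarrow> cop2 H x F = cop2 H x G"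
  by (rule arg_cong[where f = "cop2 H x"]) (intro ext)

lemma cop2_swap: "cop2 H x (\<lambda>a b. cop2 H y (\<lambda>c d. F a b c d)) = cop2 H y (\<lambda>c d. cop2 H x (\<lambda>a b. F a b c d))"
  unfolding cop2_def by (rule tlift_swap)

lemma cop2_mult_left: "(c::'k) * cop2 H x F = cop2 H x (\<lambda>a b. c * F a b)"
  unfolding cop2_def by (rule tlift_mult_left)

lemma cop2_mult_right: "cop2 H x F * (c::'k) = cop2 H x (\<lambda>a b. F a b * c)"
  unfolding cop2_def by (rule tlift_mult_right)

lemma cop2_counit_left: "lin \<phi> \<Longrightarrow> cop2 H x (\<lambda>a b. \<epsilon> a * \<phi> b) = \<phi> x"
  using conv_counit_left[of \<phi>] by (simp add: conv_def fun_eq_iff)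

lemmas lin_intros = linH_id linH_S linH_mult_left linH_mult_right lin_mult_left lin_mult_right
  lin_cop2 linear_cop2_inner[where s = "(*)"]

lemma trilin_conv3: "trilin F \<Longrightarrow> trilin G \<Longrightarrow> trilin (conv3 H F G)"
  unfolding trilin_iff[of "conv3 H F G"] conv3_def
  by (intro conjI allI lin_intros; (erule trilin_app)?; intro lin_intros)

lemma conv3_commute:
  assumes "trilin F" "trilin G"
  shows "conv3 H F G = conv3 H G F"
proof (intro ext)
  fix x y z
  note li = lin_intros trilin_app[OF assms(1)] trilin_app[OF assms(2)]
  have "conv3 H F G x y z = cop2 H x (\<lambda>x2 x1. cop2 H y (\<lambda>y1 y2. cop2 H z (\<lambda>z1 z2. F x1 y1 z1 * G x2 y2 z2)))"
    unfolding conv3_def by (rule cop2_commute[symmetric]) (intro li)+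
  also have "\<dots> = cop2 H x (\<lambda>x2 x1. cop2 H y (\<lambda>y2 y1. cop2 H z (\<lambda>z1 z2. F x1 y1 z1 * G x2 y2 z2)))"
    by (intro cop2_cong cop2_commute[symmetric] li)
  also have "\<dots> = cop2 H x (\<lambda>x2 x1. cop2 H y (\<lambda>y2 y1. cop2 H z (\<lambda>z2 z1. F x1 y1 z1 * G x2 y2 z2)))"
    by (intro cop2_cong cop2_commute[symmetric] li)
  finally show "conv3 H F G x y z = conv3 H G F x y z" by (simp add: conv3_def mult.commute)
qed

text \<open>
  Coassociativity in each of the three arguments, after the Sweedler sums of each argument have been
  brought together.
\<close>

lemma conv3_assoc:
  assumes F: "trilin F" and G: "trilin G" and K: "trilin K"
  shows "conv3 H (conv3 H F G) K = conv3 H F (conv3 H G K)"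
proof (intro ext)
  fix x y z
  note li = lin_intros trilin_app[OF F] trilin_app[OF G] trilin_app[OF K]
  have swap: "cop2 H y (\<lambda>v y'. cop2 H z (\<lambda>w z'. cop2 H u (\<lambda>a a'. cop2 H (f v y') (\<lambda>b b'. P v y' w z' a a' b b'))))
    = cop2 H u (\<lambda>a a'. cop2 H y (\<lambda>v y'. cop2 H (f v y') (\<lambda>b b'. cop2 H z (\<lambda>w z'. P v y' w z' a a' b b'))))" (is "?l1 = _")
    for y z u f and P :: "_ \<Rightarrow> _ \<Rightarrow> _ \<Rightarrow> _ \<Rightarrow> _ \<Rightarrow> _ \<Rightarrow> _ \<Rightarrow> _ \<Rightarrow> 'k"
  proof -
    have "?l1
      = cop2 H y (\<lambda>v y'. cop2 H u (\<lambda>a a'. cop2 H z (\<lambda>w z'. cop2 H (f v y') (\<lambda>b b'. P v y' w z' a a' b b'))))"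
      by (rule cop2_cong, rule cop2_swap)
    also have "\<dots> = cop2 H u (\<lambda>a a'. cop2 H y (\<lambda>v y'. cop2 H z (\<lambda>w z'. cop2 H (f v y') (\<lambda>b b'. P v y' w z' a a' b b'))))"
      by (rule cop2_swap)
    also have "\<dots> = cop2 H u (\<lambda>a a'. cop2 H y (\<lambda>v y'. cop2 H (f v y') (\<lambda>b b'. cop2 H z (\<lambda>w z'. P v y' w z' a a' b b'))))"
      by (rule cop2_cong, rule cop2_cong, rule cop2_swap)
    finally show ?thesis .
  qed
  let ?P = "\<lambda>x1 y1 z1 x2 y2 z2 x3 y3 z3. F x1 y1 z1 * G x2 y2 z2 * K x3 y3 z3"
  have "conv3 H (conv3 H F G) K x y z = cop2 H x (\<lambda>u x3. cop2 H u (\<lambda>x1 x2. cop2 H y (\<lambda>v y3. cop2 H v (\<lambda>y1 y2.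
      cop2 H z (\<lambda>w z3. cop2 H w (\<lambda>z1 z2. ?P x1 y1 z1 x2 y2 z2 x3 y3 z3))))))"
    unfolding conv3_def cop2_mult_right by (rule cop2_cong, rule swap)
  also have "\<dots> = cop2 H x (\<lambda>x1 u. cop2 H u (\<lambda>x2 x3. cop2 H y (\<lambda>v y3. cop2 H v (\<lambda>y1 y2.
      cop2 H z (\<lambda>w z3. cop2 H w (\<lambda>z1 z2. ?P x1 y1 z1 x2 y2 z2 x3 y3 z3))))))"
    by (rule cop2_assoc) (intro li)+
  also have "\<dots> = cop2 H x (\<lambda>x1 u. cop2 H u (\<lambda>x2 x3. cop2 H y (\<lambda>y1 v. cop2 H v (\<lambda>y2 y3.
      cop2 H z (\<lambda>w z3. cop2 H w (\<lambda>z1 z2. ?P x1 y1 z1 x2 y2 z2 x3 y3 z3))))))"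
    by (intro cop2_cong cop2_assoc li)
  also have "\<dots> = cop2 H x (\<lambda>x1 u. cop2 H u (\<lambda>x2 x3. cop2 H y (\<lambda>y1 v. cop2 H v (\<lambda>y2 y3.
      cop2 H z (\<lambda>z1 w. cop2 H w (\<lambda>z2 z3. ?P x1 y1 z1 x2 y2 z2 x3 y3 z3))))))"
    by (intro cop2_cong cop2_assoc li)
  also have "\<dots> = conv3 H F (conv3 H G K) x y z"
    unfolding conv3_def cop2_mult_left mult.assoc by (rule cop2_cong, rule swap[symmetric])
  finally show "conv3 H (conv3 H F G) K x y z = conv3 H F (conv3 H G K) x y z" .
qed

definition counit3 :: "'h \<Rightarrow> 'h \<Rightarrow> 'h \<Rightarrow> 'k" where
  "counit3 x y z = \<epsilon> x * \<epsilon> y * \<epsilon> z"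

lemma trilin_counit3: "trilin counit3"
  unfolding trilin_iff counit3_def by (intro conjI allI lin_intros lin_counit)

lemma conv3_counit:
  assumes F: "trilin F"
  shows "conv3 H counit3 F = F"
proof (intro ext)
  fix x y z
  note li = lin_intros trilin_app[OF F]
  have "conv3 H counit3 F x y z = cop2 H x (\<lambda>x1 x2. cop2 H y (\<lambda>y1 y2. cop2 H z (\<lambda>z1 z2.
      \<epsilon> z1 * (\<epsilon> x1 * (\<epsilon> y1 * F x2 y2 z2)))))"
    by (simp add: conv3_def counit3_def ac_simps)
  also have "\<dots> = cop2 H x (\<lambda>x1 x2. cop2 H y (\<lambda>y1 y2. \<epsilon> x1 * (\<epsilon> y1 * F x2 y2 z)))"
    by (intro cop2_cong cop2_counit_left li)
  also have "\<dots> = cop2 H x (\<lambda>x1 x2. \<epsilon> x1 * cop2 H y (\<lambda>y1 y2. \<epsilon> y1 * F x2 y2 z))"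
    by (simp only: cop2_mult_left)
  also have "\<dots> = F x y z"
    using F by (simp add: cop2_counit_left trilin_iff)
  finally show "conv3 H counit3 F x y z = F x y z" .
qed

text \<open>
  The trilinear form that agrees with \<open>F\<close> on basis vectors.  Convolution obeys the ring laws on
  trilinear forms only; applying \<open>lin3\<close> to its arguments makes them hold for arbitrary functions, as
  \<^locale>\<open>value_algebra\<close> demands, without changing it on trilinear forms.
\<close>

definition lin3 :: "('h \<Rightarrow> 'h \<Rightarrow> 'h \<Rightarrow> 'k) \<Rightarrow> 'h \<Rightarrow> 'h \<Rightarrow> 'h \<Rightarrow> 'k" where
  "lin3 F x y z = (\<Sum>b\<in>Basis. \<Sum>c\<in>Basis. \<Sum>d\<in>Basis. coord b x * (coord c y * (coord d z * F b c d)))"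

lemma lin_sum: "(\<And>i. i \<in> I \<Longrightarrow> lin (f i)) \<Longrightarrow> lin (\<lambda>x. \<Sum>i\<in>I. f i x)"
  by (simp add: lin_iff sum.distrib sum_distrib_left)

lemma trilin_lin3: "trilin (lin3 F)"
  unfolding trilin_iff lin3_def by (intro conjI allI lin_sum lin_intros lin_coord)

lemma lin3_trilin: "trilin F \<Longrightarrow> lin3 F = F"
proof (intro ext)
  fix x y z assume F: "trilin F"
  have "F x y z = (\<Sum>b\<in>Basis. coord b x * F b y z)"
    using linear_coord[of "(*)" "\<lambda>x. F x y z" x] F by (simp add: trilin_iff)
  also have "\<dots> = (\<Sum>b\<in>Basis. coord b x * (\<Sum>c\<in>Basis. coord c y * F b c z))"
    using linear_coord[of "(*)" "\<lambda>y. F b y z" y for b] F by (simp add: trilin_iff)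
  also have "\<dots> = (\<Sum>b\<in>Basis. coord b x * (\<Sum>c\<in>Basis. coord c y * (\<Sum>d\<in>Basis. coord d z * F b c d)))"
    using linear_coord[of "(*)" "\<lambda>z. F b c z" z for b c] F by (simp add: trilin_iff)
  finally show "lin3 F x y z = F x y z" by (simp add: lin3_def sum_distrib_left)
qed

definition mul3 where "mul3 F G = conv3 H (lin3 F) (lin3 G)"

definition scale3 :: "'k \<Rightarrow> ('h \<Rightarrow> 'h \<Rightarrow> 'h \<Rightarrow> 'k) \<Rightarrow> 'h \<Rightarrow> 'h \<Rightarrow> 'h \<Rightarrow> 'k" where
  "scale3 c F x y z = c * F x y z"

lemma lin3_add: "lin3 (F + G) = lin3 F + lin3 G"
  by (intro ext) (simp add: lin3_def sum.distrib distrib_left)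

lemma lin3_scale: "lin3 (scale3 c F) = scale3 c (lin3 F)"
  by (intro ext) (simp add: lin3_def scale3_def sum_distrib_left ac_simps)

lemma mul3_trilin: "trilin F \<Longrightarrow> trilin G \<Longrightarrow> mul3 F G = conv3 H F G"
  by (simp add: mul3_def lin3_trilin)

lemma trilin_closed:
  shows "trilin 0" and "trilin F \<Longrightarrow> trilin G \<Longrightarrow> trilin (F + G)" and "trilin F \<Longrightarrow> trilin (scale3 c F)"
  unfolding trilin_iff lin_iff scale3_def plus_fun_apply zero_fun_apply
  by (simp_all add: algebra_simps)

lemma value_algebra_trilin: "value_algebra scale3 {F. trilin F} mul3 counit3"
proof unfold_locales
  fix a b c :: 'k and F G K :: "'h \<Rightarrow> 'h \<Rightarrow> 'h \<Rightarrow> 'k"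
  show "scale3 a (F + G) = scale3 a F + scale3 a G" "scale3 (a + b) F = scale3 a F + scale3 b F"
    "scale3 a (scale3 b F) = scale3 (a * b) F" "scale3 1 F = F"
    by (simp_all add: fun_eq_iff scale3_def algebra_simps)
  show "0 \<in> {F. trilin F}" by (simp add: trilin_closed)
  show "F + G \<in> {F. trilin F}" if "F \<in> {F. trilin F}" "G \<in> {F. trilin F}"
    using that by (simp add: trilin_closed)
  show "scale3 c F \<in> {F. trilin F}" if "F \<in> {F. trilin F}"
    using that by (simp add: trilin_closed)
  show "mul3 F G \<in> {F. trilin F}"
    by (simp add: mul3_def trilin_conv3 trilin_lin3)
  show "counit3 \<in> {F. trilin F}" by (simp add: trilin_counit3)
  have l: "lin3 (mul3 F G) = conv3 H (lin3 F) (lin3 G)" for F G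
    by (simp add: mul3_def lin3_trilin trilin_conv3 trilin_lin3)
  show "mul3 (mul3 F G) K = mul3 F (mul3 G K)"
    unfolding mul3_def[of "mul3 F G"] mul3_def[of F "mul3 G K"] l by (intro conv3_assoc trilin_lin3)
  show "mul3 F G = mul3 G F"
    unfolding mul3_def by (intro conv3_commute trilin_lin3)
  show "mul3 (F + G) K = mul3 F K + mul3 G K"
    unfolding mul3_def lin3_add
    by (intro ext) (simp add: conv3_def distrib_right cop2_def tlift_add)
  show "mul3 (scale3 c F) K = scale3 c (mul3 F K)"
    unfolding mul3_def lin3_scale
    by (intro ext) (simp add: conv3_def scale3_def cop2_mult_left mult.assoc)
  show "mul3 counit3 F = F" if "F \<in> {F. trilin F}"
    using that by (simp add: mul3_trilin trilin_counit3 conv3_counit)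
qed

lemma hopf_points_trilin:
  "hopf_points scl Basis \<Delta> \<epsilon> S scale3 {F. trilin F} mul3 counit3"
  by (intro hopf_points.intro fd_cocommutative_hopf_algebra_axioms value_algebra_trilin)

interpretation T: hopf_points where scl = scl and Basis = Basis and \<Delta> = \<Delta> and \<epsilon> = \<epsilon> and S = S
  and scR = scale3 and R = "{F. trilin F}" and mul = mul3 and one = counit3
  by (rule hopf_points_trilin) (rule H_def)

text \<open>
  The coordinate points: the three inclusions of the dual into its third tensor power.
\<close>

definition pt1 where "pt1 \<phi> = (if lin \<phi> then \<lambda>x y z. \<phi> x * \<epsilon> y * \<epsilon> z else 0)"
definition pt2 where "pt2 \<phi> = (if lin \<phi> then \<lambda>x y z. \<epsilon> x * \<phi> y * \<epsilon> z else 0)"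
definition pt3 where "pt3 \<phi> = (if lin \<phi> then \<lambda>x y z. \<epsilon> x * \<epsilon> y * \<phi> z else 0)"

lemma trilin_product: "lin \<phi> \<Longrightarrow> lin \<psi> \<Longrightarrow> lin \<chi> \<Longrightarrow> trilin (\<lambda>x y z. \<phi> x * \<psi> y * \<chi> z)"
  unfolding trilin_iff by (intro conjI allI lin_intros)

lemma mul3_product:
  assumes "lin \<phi>" "lin \<psi>" "lin \<chi>" "lin \<phi>'" "lin \<psi>'" "lin \<chi>'"
  shows "mul3 (\<lambda>x y z. \<phi> x * \<psi> y * \<chi> z) (\<lambda>x y z. \<phi>' x * \<psi>' y * \<chi>' z)
    = (\<lambda>x y z. conv H \<phi> \<phi>' x * conv H \<psi> \<psi>' y * conv H \<chi> \<chi>' z)"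
proof (intro ext)
  fix x y z
  have z: "cop2 H z (\<lambda>z1 z2. \<phi> x1 * \<psi> y1 * \<chi> z1 * (\<phi>' x2 * \<psi>' y2 * \<chi>' z2))
    = (\<phi> x1 * \<phi>' x2) * ((\<psi> y1 * \<psi>' y2) * conv H \<chi> \<chi>' z)" for x1 x2 y1 y2
    unfolding conv_def cop2_mult_left by (rule cop2_cong) (simp only: ac_simps)
  have "mul3 (\<lambda>x y z. \<phi> x * \<psi> y * \<chi> z) (\<lambda>x y z. \<phi>' x * \<psi>' y * \<chi>' z) x y z
    = cop2 H x (\<lambda>x1 x2. cop2 H y (\<lambda>y1 y2. (\<phi> x1 * \<phi>' x2) * ((\<psi> y1 * \<psi>' y2) * conv H \<chi> \<chi>' z)))"
    by (simp only: mul3_trilin trilin_product assms conv3_def z)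
  also have "\<dots> = conv H \<phi> \<phi>' x * (conv H \<psi> \<psi>' y * conv H \<chi> \<chi>' z)"
    by (simp only: cop2_mult_left[symmetric] cop2_mult_right[symmetric] conv_def)
  finally show "mul3 (\<lambda>x y z. \<phi> x * \<psi> y * \<chi> z) (\<lambda>x y z. \<phi>' x * \<psi>' y * \<chi>' z) x y z
    = conv H \<phi> \<phi>' x * conv H \<psi> \<psi>' y * conv H \<chi> \<chi>' z" by (simp only: mult.assoc)
qed

text \<open>
  The conditions for a point of this value algebra, with the forms applied to their arguments, as
  suits the coordinate points.
\<close>

lemma point_productI:
  assumes "\<And>\<phi>. lin \<phi> \<Longrightarrow> trilin (g \<phi>)" "\<And>\<phi>. \<not> lin \<phi> \<Longrightarrow> g \<phi> = 0"
    and "\<And>\<phi> \<psi> x y z. lin \<phi> \<Longrightarrow> lin \<psi> \<Longrightarrow> g (\<lambda>x. \<phi> x + \<psi> x) x y z = g \<phi> x y z + g \<psi> x y z"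
    and "\<And>\<phi> c x y z. lin \<phi> \<Longrightarrow> g (\<lambda>x. c * \<phi> x) x y z = c * g \<phi> x y z"
    and "\<And>\<phi> \<psi>. lin \<phi> \<Longrightarrow> lin \<psi> \<Longrightarrow> g (conv H \<phi> \<psi>) = mul3 (g \<phi>) (g \<psi>)" and "g \<epsilon> = counit3"
  shows "T.point g"
  unfolding T.point_def
proof (intro conjI allI impI T.alg_hom_DI)
  fix \<phi> \<psi> c assume "lin \<phi>" "lin \<psi>"
  then show "g (\<lambda>x. \<phi> x + \<psi> x) = g \<phi> + g \<psi>"
    by (intro ext) (simp only: assms(3) plus_fun_apply)
next
  fix \<phi> c assume "lin \<phi>"
  then show "g (\<lambda>x. c * \<phi> x) = scale3 c (g \<phi>)"
    by (intro ext) (simp only: assms(4) scale3_def)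
qed (simp_all add: assms(1,2,5,6))

lemma point_pt1: "T.point pt1" and point_pt2: "T.point pt2" and point_pt3: "T.point pt3"
proof -
  have c: "conv H \<epsilon> \<epsilon> = \<epsilon>" by (rule conv_counit_left[OF lin_counit])
  have c3: "counit3 = (\<lambda>x y z. \<epsilon> x * \<epsilon> y * \<epsilon> z)" by (intro ext) (rule counit3_def)
  show "T.point pt1"
    by (rule point_productI) (simp_all add: pt1_def trilin_product lin_counit T.lin_add lin_mult_right
        lin_conv mul3_product c c3 distrib_left distrib_right)
  show "T.point pt2"
    by (rule point_productI) (simp_all add: pt2_def trilin_product lin_counit T.lin_add lin_mult_right
        lin_conv mul3_product c c3 distrib_left distrib_right)
  show "T.point pt3"
    by (rule point_productI) (simp_all add: pt3_def trilin_product lin_counit T.lin_add lin_mult_right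
        lin_conv mul3_product c c3 distrib_left distrib_right)
qed

text \<open>
  Expanded in coordinates, evaluation at the coordinate points replaces \<open>coord b\<close>, \<open>coord c\<close>, \<open>coord d\<close> by
  the product form \<open>coord b x * coord c y * coord d z\<close>.  Hence an identity between values of trilinear forms
  that holds at all points is an identity of the forms.
\<close>

lemma tri_generic:
  assumes "trilin F"
  shows "T.tri F pt1 pt2 pt3 = F"
proof -
  have e: "mul3 (pt1 \<phi>) (mul3 (pt2 \<psi>) (mul3 (pt3 \<chi>) counit3)) = (\<lambda>x y z. \<phi> x * \<psi> y * \<chi> z)"
    if "lin \<phi>" "lin \<psi>" "lin \<chi>" for \<phi> \<psi> \<chi>
  proof -
    have c: "conv H \<epsilon> \<phi> = \<phi>" "conv H \<phi> \<epsilon> = \<phi>" if "lin \<phi>" for \<phi>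
      using conv_counit_left[OF that] conv_commute[OF that lin_counit] by simp_all
    show ?thesis
      by (simp add: pt1_def pt2_def pt3_def counit3_def[abs_def] that mul3_product lin_counit c lin_conv)
  qed
  have "T.tri F pt1 pt2 pt3 = (\<Sum>b\<in>Basis. \<Sum>c\<in>Basis. \<Sum>d\<in>Basis. scale3 (F b c d)
      (mul3 (pt1 (coord b)) (mul3 (pt2 (coord c)) (mul3 (pt3 (coord d)) counit3))))"
    by (simp add: T.tri_def T.ev_def T.mul_sum_right T.mul_scale_right)
  also have "\<dots> = lin3 F"
    by (intro ext) (simp add: e lin_coord fun_sum_apply scale3_def lin3_def ac_simps)
  finally show ?thesis by (simp add: lin3_trilin assms)
qed

lemma conv_inverse3_unique:
  assumes "is_conv_inverse3 H \<omega> \<eta>" "is_conv_inverse3 H \<omega> \<eta>'" "trilin \<omega>"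
  shows "\<eta> = \<eta>'"
proof (rule T.inverse_unique)
  show "mul3 \<omega> \<eta> = counit3" "mul3 \<omega> \<eta>' = counit3"
    using assms by (simp_all add: is_conv_inverse3_def mul3_trilin fun_eq_iff counit3_def)
qed (use assms in \<open>simp_all add: is_conv_inverse3_def\<close>)

lemma is_conv_inverse3:
  assumes "normalized_3_cocycle H \<omega>"
  shows "is_conv_inverse3 H \<omega> (conv_inverse3 H \<omega>)"
proof -
  obtain \<eta> where \<eta>: "is_conv_inverse3 H \<omega> \<eta>" and "trilin \<omega>"
    using assms by (auto simp: normalized_3_cocycle_def)
  show ?thesis
    unfolding conv_inverse3_def
    by (rule theI[where P = "is_conv_inverse3 H \<omega>" and a = \<eta>, OF \<eta>])
      (rule conv_inverse3_unique[OF _ \<eta> \<open>trilin \<omega>\<close>])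
qed

end

section \<open>Forms as tensors over the dual\<close>

text \<open>
  A dual basis of \<open>V\<close>, as an expansion of every linear form on \<open>V\<close>; it is inherited by tensor
  products and reduces equality of tensors to equality of coefficients.
\<close>

definition dual_basis ::
  "('k::field, 'a::ab_group_add, 'm) vs_scheme \<Rightarrow> 'i set \<Rightarrow> ('i \<Rightarrow> 'a \<Rightarrow> 'k) \<Rightarrow> ('i \<Rightarrow> 'a) \<Rightarrow> bool" where
  "dual_basis V I p v \<longleftrightarrow> (\<forall>i\<in>I. v i \<in> carrier V) \<and>
     (\<forall>f. lin_map V base_field f \<longrightarrow> (\<forall>a\<in>carrier V. f a = (\<Sum>i\<in>I. p i a * f (v i))))"

lemma base_field_simps [simp]: "carrier base_field = UNIV" "scale base_field = (*)"
  by (simp_all add: base_field_def)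

lemma dual_basis_bilinear:
  assumes "dual_basis V I p v" "dual_basis W J q w" "bilin_map V W base_field B"
    and "a \<in> carrier V" "b \<in> carrier W"
  shows "B a b = (\<Sum>i\<in>I. \<Sum>j\<in>J. p i a * q j b * B (v i) (w j))"
proof -
  have "lin_map V base_field (\<lambda>a. B a b)" using assms by (simp add: bilin_map_def)
  with assms(1,4) have "B a b = (\<Sum>i\<in>I. p i a * B (v i) b)"
    unfolding dual_basis_def by blast
  also have "\<dots> = (\<Sum>i\<in>I. p i a * (\<Sum>j\<in>J. q j b * B (v i) (w j)))"
    using assms by (intro sum.cong refl) (simp add: dual_basis_def bilin_map_def)
  finally show ?thesis by (simp add: sum_distrib_left mult.assoc)
qed

lemma dual_basis_tlift:
  assumes "dual_basis V I p v" "dual_basis W J q w" "bilin_map V W base_field B" "t \<in> carrier (V \<otimes> W)"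
  shows "tlift V W t B = (\<Sum>i\<in>I. \<Sum>j\<in>J. tlift V W t (\<lambda>a b. p i a * q j b) * B (v i) (w j))"
proof -
  have "tlift V W t B = tlift V W t (\<lambda>a b. \<Sum>i\<in>I. \<Sum>j\<in>J. p i a * q j b * B (v i) (w j))"
    by (rule tlift_cong_mem[OF assms(4)]) (rule dual_basis_bilinear[OF assms(1-3)])
  then show ?thesis by (simp add: tlift_sum_set tlift_mult_right)
qed

lemma dual_basis_tensor_eqI:
  assumes "dual_basis V I p v" "dual_basis W J q w" "t \<in> carrier (V \<otimes> W)" "u \<in> carrier (V \<otimes> W)"
    and "\<And>i j. i \<in> I \<Longrightarrow> j \<in> J \<Longrightarrow> tlift V W t (\<lambda>a b. p i a * q j b) = tlift V W u (\<lambda>a b. p i a * q j b)"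
  shows "t = u"
  using dual_basis_tlift[OF assms(1,2)] assms(3-5)
  by (intro tensor_eqI[OF assms(3,4)]) (simp flip: tlift_eq_apply)

lemma dual_basis_tensor:
  assumes "dual_basis V I p v" "dual_basis W J q w"
  shows "dual_basis (V \<otimes> W) (I \<times> J) (\<lambda>(i, j) t. tlift V W t (\<lambda>a b. p i a * q j b)) (\<lambda>(i, j). tens V W (v i) (w j))"
  unfolding dual_basis_def
proof (intro conjI allI impI ballI)
  show "(case x of (i, j) \<Rightarrow> tens V W (v i) (w j)) \<in> carrier (V \<otimes> W)" if "x \<in> I \<times> J" for x
    using assms that by (auto simp: dual_basis_def intro!: tens_carrier)
  fix f t
  assume f: "lin_map (V \<otimes> W) base_field f" and t: "t \<in> carrier (V \<otimes> W)"
  have "bilin_map V W base_field (\<lambda>a b. f (tens V W a b))"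
    using f tens_bilinear[of V W] by (auto simp: bilin_map_def lin_map_def)
  from dual_basis_tlift[OF assms this t]
  show "f t = (\<Sum>x\<in>I \<times> J. (case x of (i, j) \<Rightarrow> \<lambda>t. tlift V W t (\<lambda>a b. p i a * q j b)) t * f (case x of (i, j) \<Rightarrow> tens V W (v i) (w j)))"
    by (simp add: lin_map_eq_tlift[OF f t] sum.cartesian_product case_prod_unfold)
qed

lemma tensor_sum_carrier: "(\<And>i. i \<in> I \<Longrightarrow> f i \<in> carrier (V \<otimes> W)) \<Longrightarrow> (\<Sum>i\<in>I. f i) \<in> carrier (V \<otimes> W)"
proof (induction I rule: infinite_finite_induct)
  case (insert x F)
  then show ?case unfolding sum.insert[OF insert.hyps] by (intro tensor_add_carrier) auto
qed (simp_all add: tensor_zero_carrier)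

context fd_cocommutative_hopf_algebra
begin

lemma dual_basis_H: "dual_basis H Basis coord (\<lambda>b. b)"
  unfolding dual_basis_def
proof (intro conjI ballI allI impI)
  fix f a assume "lin_map H base_field f"
  then have "lin f" by (simp add: lin_map_def lin_iff)
  then show "f a = (\<Sum>i\<in>Basis. coord i a * f i)" by (rule linear_coord)
qed simp

lemma dual_basis_D: "dual_basis D Basis (\<lambda>b \<phi>. \<phi> b) coord"
  unfolding dual_basis_def
  using lin_map_D_coord[of base_field] by (auto simp: lin_coord)

lemma tensor2_eqI:
  assumes "t \<in> carrier (D \<otimes> D)" "u \<in> carrier (D \<otimes> D)"
    and "\<And>x y. tlift D D t (\<lambda>\<phi> \<psi>. \<phi> x * \<psi> y) = tlift D D u (\<lambda>\<phi> \<psi>. \<phi> x * \<psi> y)"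
  shows "t = u"
  using assms by (rule dual_basis_tensor_eqI[OF dual_basis_D dual_basis_D])

lemma tlift3_product:
  "tlift3 D t (\<lambda>\<phi> \<psi> \<chi>. \<phi> x * \<psi> y * \<chi> z)
    = tlift D (D \<otimes> D) t (\<lambda>\<phi> u. \<phi> x * tlift D D u (\<lambda>\<psi> \<chi>. \<psi> y * \<chi> z))"
  by (simp add: tlift3_def tlift_mult_left mult.assoc)

lemma tensor3_eqI:
  assumes "t \<in> carrier (D \<otimes> D \<otimes> D)" "u \<in> carrier (D \<otimes> D \<otimes> D)"
    and "\<And>x y z. tlift3 D t (\<lambda>\<phi> \<psi> \<chi>. \<phi> x * \<psi> y * \<chi> z) = tlift3 D u (\<lambda>\<phi> \<psi> \<chi>. \<phi> x * \<psi> y * \<chi> z)"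
  shows "t = u"
  by (rule dual_basis_tensor_eqI[OF dual_basis_D dual_basis_tensor[OF dual_basis_D dual_basis_D] assms(1,2)])
    (use assms(3) in \<open>auto simp: tlift3_product\<close>)

lemma bilin_product_D: "bilin_map D D base_field (\<lambda>\<phi> \<psi>. \<phi> x * \<psi> y)"
  by (simp add: bilin_map_def lin_map_def algebra_simps)

lemma bilin_product3_D: "bilin_map D (D \<otimes> D) base_field (\<lambda>\<phi> u. \<phi> x * tlift D D u (\<lambda>\<psi> \<chi>. \<psi> y * \<chi> z))"
  using tlift_lin_map[OF is_vs_base_field bilin_product_D[of y z] span_closed_D]
  by (simp add: bilin_map_def lin_map_def algebra_simps)

lemma lin_expand_app: "lin \<phi> \<Longrightarrow> (\<Sum>b\<in>Basis. coord b x * \<phi> b) = \<phi> x"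
  using linear_coord[of "(*)" \<phi> x] by simp

lemma form2_tensor:
  assumes B: "\<And>y. lin (\<lambda>x. B x y)" "\<And>x. lin (B x)"
  shows form2_tensor_carrier: "form2_tensor H B \<in> carrier (D \<otimes> D)"
    and tlift_form2_tensor: "tlift D D (form2_tensor H B) (\<lambda>\<phi> \<psi>. \<phi> x * \<psi> y) = B x y"
proof -
  define t where "t = (\<Sum>b\<in>Basis. \<Sum>c\<in>Basis. tens D D (scale D (B b c) (coord b)) (coord c))"
  have t: "t \<in> carrier (D \<otimes> D)"
    unfolding t_def by (intro tensor_sum_carrier tens_carrier) (auto simp: lin_coord lin_mult_right)
  have ev: "tlift D D t (\<lambda>\<phi> \<psi>. \<phi> x * \<psi> y) = B x y" (is "?l1 = _") for x y
  proof -
    have "?l1 = t (\<lambda>\<phi> \<psi>. \<phi> x * \<psi> y)"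
      by (rule tlift_eq_apply[OF t bilin_product_D])
    also have "\<dots> = (\<Sum>b\<in>Basis. coord b x * (\<Sum>c\<in>Basis. coord c y * B b c))"
      by (simp add: t_def fun_sum_apply tens_eq_apply[OF bilin_product_D] sum_distrib_left ac_simps)
    also have "\<dots> = B x y" by (simp add: lin_expand_app B)
    finally show ?thesis .
  qed
  have "form2_tensor H B = t"
    unfolding form2_tensor_def using t ev by (intro the_equality tensor2_eqI) auto
  then show "form2_tensor H B \<in> carrier (D \<otimes> D)" "tlift D D (form2_tensor H B) (\<lambda>\<phi> \<psi>. \<phi> x * \<psi> y) = B x y"
    using t ev by auto
qed

lemma form3_tensor:
  assumes B: "trilin B"
  shows form3_tensor_carrier: "form3_tensor H B \<in> carrier (D \<otimes> D \<otimes> D)"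
    and tlift_form3_tensor: "tlift3 D (form3_tensor H B) (\<lambda>\<phi> \<psi> \<chi>. \<phi> x * \<psi> y * \<chi> z) = B x y z"
proof -
  define t where "t = (\<Sum>b\<in>Basis. \<Sum>c\<in>Basis. \<Sum>d\<in>Basis. tens3 D (scale D (B b c d) (coord b)) (coord c) (coord d))"
  have t: "t \<in> carrier (D \<otimes> D \<otimes> D)"
    unfolding t_def tens3_def by (intro tensor_sum_carrier tens_carrier) (auto simp: lin_coord lin_mult_right)
  have ev: "tlift3 D t (\<lambda>\<phi> \<psi> \<chi>. \<phi> x * \<psi> y * \<chi> z) = B x y z" (is "?l1 = _") for x y z
  proof -
    have *: "tlift D D (tens D D (coord c) (coord d)) (\<lambda>\<psi> \<chi>. \<psi> y * \<chi> z) = coord c y * coord d z" for c d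
      by (rule tlift_tens[OF is_vs_base_field bilin_product_D]) (simp_all add: lin_coord)
    have "?l1 = t (\<lambda>\<phi> u. \<phi> x * tlift D D u (\<lambda>\<psi> \<chi>. \<psi> y * \<chi> z))"
      unfolding tlift3_product by (rule tlift_eq_apply[OF t bilin_product3_D])
    also have "\<dots> = lin3 B x y z"
      by (simp add: t_def tens3_def fun_sum_apply tens_eq_apply[OF bilin_product3_D] * lin3_def ac_simps)
    finally show ?thesis by (simp add: lin3_trilin B)
  qed
  have "form3_tensor H B = t"
    unfolding form3_tensor_def using t ev by (intro the_equality tensor3_eqI) auto
  then show "form3_tensor H B \<in> carrier (D \<otimes> D \<otimes> D)"
    "tlift3 D (form3_tensor H B) (\<lambda>\<phi> \<psi> \<chi>. \<phi> x * \<psi> y * \<chi> z) = B x y z"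
    using t ev by auto
qed

lemma alg_closed_D: "alg_closed D"
  by (simp add: alg_closed_def span_closed_D lin_conv lin_counit)

end

context hopf_points
begin

lemma lin_map_point: "point g \<Longrightarrow> lin_map D Rv g"
  by (rule alg_homD(6)[OF pointD(1)])

lemma point_coord: "point g \<Longrightarrow> lin \<phi> \<Longrightarrow> g \<phi> = (\<Sum>b\<in>Basis. scR (\<phi> b) (g (coord b)))"
  by (rule hom_coord[OF pointD(1)])

lemma scR_tlift: "scR (tlift V W t F) m = tlift V W t (\<lambda>a b. scR (F a b) m)"
  by (rule tlift_hom[where f = "\<lambda>c. scR c m"]) (simp_all add: val.scale_left_distrib)

lemma point_mul_coord:
  assumes "point f" "point g" "lin \<phi>" "lin \<psi>"
  shows "f \<phi> \<bullet> g \<psi> = (\<Sum>b\<in>Basis. \<Sum>c\<in>Basis. scR (\<phi> b * \<psi> c) (f (coord b) \<bullet> g (coord c)))"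
proof -
  have "f \<phi> \<bullet> g \<psi> = (\<Sum>b\<in>Basis. scR (\<phi> b) (f (coord b))) \<bullet> (\<Sum>c\<in>Basis. scR (\<psi> c) (g (coord c)))"
    using assms by (simp only: point_coord[symmetric])
  also have "\<dots> = (\<Sum>b\<in>Basis. \<Sum>c\<in>Basis. scR (\<phi> b) (f (coord b)) \<bullet> scR (\<psi> c) (g (coord c)))"
    by (simp only: mul_sum_left) (simp only: mul_sum_right)
  finally show ?thesis by (simp add: mul_scale_left mul_scale_right mult.commute)
qed

text \<open>
  Under the identification of forms with tensors over the dual, applying points to the tensor factors
  is evaluating the form at the points.
\<close>

lemma tprod_form2:
  assumes B: "\<And>y. lin (\<lambda>x. B x y)" "\<And>x. lin (B x)" and f: "point f" and g: "point g"
  shows "tprod D D f g (form2_tensor H B) = ev f (\<lambda>x. ev g (\<lambda>y. scR (B x y) one))"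
proof -
  let ?t = "form2_tensor H B"
  have "tprod D D f g ?t = tlift D D ?t (\<lambda>\<phi> \<psi>. \<Sum>b\<in>Basis. \<Sum>c\<in>Basis. scR (\<phi> b * \<psi> c) (f (coord b) \<bullet> g (coord c)))"
    unfolding tprod_def
    by (rule tlift_cong_mem[OF form2_tensor_carrier[OF B]])
      (simp add: point_mul_coord[OF f g])
  also have "\<dots> = (\<Sum>b\<in>Basis. \<Sum>c\<in>Basis. scR (B b c) (f (coord b) \<bullet> g (coord c)))"
    by (simp add: tlift_sum_set scR_tlift[symmetric] tlift_form2_tensor[OF B])
  also have "\<dots> = ev f (\<lambda>x. ev g (\<lambda>y. scR (B x y) one))"
    by (simp add: ev_def mul_sum_right mul_scale_right mul_one pointD(5) f g)
  finally show ?thesis .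
qed

lemma tprod_form3:
  assumes B: "trilin B" and f: "point f" and g: "point g" and h: "point h"
  shows "tprod D (D \<otimes> D) f (tprod D D g h) (form3_tensor H B) = tri B f g h"
proof -
  let ?t = "form3_tensor H B"
  have "tprod D (D \<otimes> D) f (tprod D D g h) ?t = tlift D (D \<otimes> D) ?t (\<lambda>\<phi> u.
      \<Sum>b\<in>Basis. \<Sum>c\<in>Basis. \<Sum>d\<in>Basis. scR (\<phi> b * tlift D D u (\<lambda>\<psi> \<chi>. \<psi> c * \<chi> d)) (f (coord b) \<bullet> (g (coord c) \<bullet> h (coord d))))"
    unfolding tprod_def[of D "D \<otimes> D"]
  proof (rule tlift_cong_mem[OF form3_tensor_carrier[OF B]])
    fix \<phi> u assume \<phi>: "\<phi> \<in> carrier D" and u: "u \<in> carrier (D \<otimes> D)"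
    have "tprod D D g h u = tlift D D u (\<lambda>\<psi> \<chi>. \<Sum>c\<in>Basis. \<Sum>d\<in>Basis. scR (\<psi> c * \<chi> d) (g (coord c) \<bullet> h (coord d)))"
      unfolding tprod_def
      by (rule tlift_cong_mem[OF u])
        (simp add: point_mul_coord[OF g h])
    then have u': "tprod D D g h u = (\<Sum>c\<in>Basis. \<Sum>d\<in>Basis.
        scR (tlift D D u (\<lambda>\<psi> \<chi>. \<psi> c * \<chi> d)) (g (coord c) \<bullet> h (coord d)))"
      by (simp only: tlift_sum_set scR_tlift)
    have "f \<phi> \<bullet> m = (\<Sum>b\<in>Basis. scR (\<phi> b) (f (coord b) \<bullet> m))" for m
      using \<phi> f by (subst point_coord[OF f]) (simp_all add: mul_sum_left mul_scale_left)
    then show "f \<phi> \<bullet> tprod D D g h u = (\<Sum>b\<in>Basis. \<Sum>c\<in>Basis. \<Sum>d\<in>Basis.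
        scR (\<phi> b * tlift D D u (\<lambda>\<psi> \<chi>. \<psi> c * \<chi> d)) (f (coord b) \<bullet> (g (coord c) \<bullet> h (coord d))))"
      by (simp only: u') (simp add: mul_sum_right mul_scale_right val.scale_sum_right)
  qed
  also have "\<dots> = (\<Sum>b\<in>Basis. \<Sum>c\<in>Basis. \<Sum>d\<in>Basis. scR (B b c d) (f (coord b) \<bullet> (g (coord c) \<bullet> h (coord d))))"
    by (simp add: tlift_sum_set scR_tlift[symmetric] tlift3_product[symmetric] tlift_form3_tensor[OF B])
  also have "\<dots> = tri B f g h"
    by (simp add: tri_def ev_def mul_sum_right mul_scale_right mul_one pointD(5) f g h)
  finally show ?thesis .
qed

end

section \<open>The quasi-Hopf algebra on points\<close>

context fd_cocommutative_hopf_algebra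
begin

abbreviation K :: "('h \<Rightarrow> 'h \<Rightarrow> 'h \<Rightarrow> 'k) \<Rightarrow> ('k, 'h \<Rightarrow> 'k) quasi_hopf" where
  "K \<omega> \<equiv> dual_quasi_hopf H \<omega>"

definition dcomult :: "('h \<Rightarrow> 'k) \<Rightarrow> ('h \<Rightarrow> 'k, 'h \<Rightarrow> 'k, 'k) tensor" where
  "dcomult \<phi> = form2_tensor H (\<lambda>x y. \<phi> (x * y))"

lemma K_simps [simp]:
  "carrier (K \<omega>) = {\<phi>. lin \<phi>}" "scale (K \<omega>) = (\<lambda>c \<phi> h. c * \<phi> h)" "mult (K \<omega>) = conv H" "unit (K \<omega>) = \<epsilon>"
  "comult (K \<omega>) = dcomult" "antipode (K \<omega>) = (\<lambda>\<phi> h. \<phi> (S h))" "alpha (K \<omega>) = \<epsilon>"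
  "beta (K \<omega>) = beta_form H \<omega>" "reassoc (K \<omega>) = form3_tensor H (conv_inverse3 H \<omega>)"
  by (simp_all add: dual_quasi_hopf_def dual_hopf_def dcomult_def fun_eq_iff)

lemma K_tensor_simps [simp]:
  shows "tens (K \<omega>) (K \<omega>) = tens D D" "K \<omega> \<otimes> K \<omega> = D \<otimes> D"
    and "tens (K \<omega>) (D \<otimes> D) = tens D (D \<otimes> D)" "K \<omega> \<otimes> (D \<otimes> D) = D \<otimes> (D \<otimes> D)"
    and "tens (K \<omega>) (D \<otimes> D \<otimes> D) = tens D (D \<otimes> D \<otimes> D)" "K \<omega> \<otimes> (D \<otimes> D \<otimes> D) = D \<otimes> (D \<otimes> D \<otimes> D)"
    and "tens (K \<omega>) (D \<otimes> D \<otimes> D \<otimes> D) = tens D (D \<otimes> D \<otimes> D \<otimes> D)"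
  by (rule tens_cong tensor_sp_cong; simp)+

lemma K_tlift_simps [simp]:
  shows "tlift (K \<omega>) (K \<omega>) t F = tlift D D t F"
    and "tlift (K \<omega>) (D \<otimes> D) t2 F2 = tlift D (D \<otimes> D) t2 F2"
    and "tlift (K \<omega>) (D \<otimes> D \<otimes> D) t3 F3 = tlift D (D \<otimes> D \<otimes> D) t3 F3"
    and "tlift (K \<omega>) (D \<otimes> D \<otimes> D \<otimes> D) t4 F4 = tlift D (D \<otimes> D \<otimes> D \<otimes> D) t4 F4"
    and "tlift H (K \<omega>) t5 F5 = tlift H D t5 F5"
  by ((rule fun_cong[OF fun_cong[OF tlift_cong]]; simp)+)

lemma tlift3_K [simp]: "tlift3 (K \<omega>) t F = tlift3 D t F"
  by (simp add: tlift3_def)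

lemma tlift5_K [simp]: "tlift5 (K \<omega>) t F = tlift5 D t F"
  by (simp add: tlift5_def)

lemma tens5_K [simp]: "tens5 (K \<omega>) = tens5 D"
  by (intro ext) (simp add: tens5_def tens3_def)

lemma tensor_alg_K [simp]: "tensor_alg (K \<omega>) (K \<omega>) = tensor_alg D D"
  by (simp add: tensor_alg_def)

lemma cop2_K [simp]: "cop2 (K \<omega>) \<phi> F = tlift D D (dcomult \<phi>) F"
  by (simp add: cop2_def)

lemma linear_tlift:
  assumes "t \<in> carrier (V \<otimes> W)" "vector_space s"
    "\<And>a b. a \<in> carrier V \<Longrightarrow> b \<in> carrier W \<Longrightarrow> Vector_Spaces.linear scl s (\<lambda>x. F x a b)"
  shows "Vector_Spaces.linear scl s (\<lambda>x. tlift V W t (F x))"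
proof -
  interpret U: vector_space s by fact
  note hom = assms(3)[THEN linear_imp_hom(1)] assms(3)[THEN linear_imp_hom(2)]
  have "tlift V W t (F (x + y)) = tlift V W t (F x) + tlift V W t (F y)" for x y
    unfolding tlift_add[symmetric] by (rule tlift_cong_mem[OF assms(1)]) (rule hom(1))
  moreover have "tlift V W t (F (scl c x)) = s c (tlift V W t (F x))" for c x
  proof -
    have "tlift V W t (F (scl c x)) = tlift V W t (\<lambda>a b. s c (F x a b))"
      by (rule tlift_cong_mem[OF assms(1)]) (rule hom(2))
    also have "\<dots> = s c (tlift V W t (F x))"
      by (rule tlift_hom[symmetric]) (simp_all add: U.scale_right_distrib)
    finally show ?thesis .
  qed
  ultimately show ?thesis
    by (simp add: linear_iff_hom[OF scl_vector_space assms(2)])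
qed

lemma tlift3_cong_mem:
  assumes "t \<in> carrier (D \<otimes> D \<otimes> D)"
    and "\<And>a b c. lin a \<Longrightarrow> lin b \<Longrightarrow> lin c \<Longrightarrow> F a b c = G a b c"
  shows "tlift3 D t F = tlift3 D t G"
  unfolding tlift3_def
  by (rule tlift_cong_mem[OF assms(1)], rule tlift_cong_mem) (simp_all add: assms(2))

lemma trilin_tlift3:
  assumes t: "t \<in> carrier (D \<otimes> D \<otimes> D)"
  shows "trilin (\<lambda>x y z. tlift3 D t (\<lambda>\<phi> \<psi> \<chi>. \<phi> x * \<psi> y * \<chi> z))"
  unfolding trilin_iff tlift3_def
  by (intro conjI allI; rule linear_tlift[OF t vector_space_field]; rule linear_tlift[OF _ vector_space_field])
    (auto intro!: lin_intros)

lemma form3_tensor_surj: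
  "t \<in> carrier (D \<otimes> D \<otimes> D) \<Longrightarrow> form3_tensor H (\<lambda>x y z. tlift3 D t (\<lambda>\<phi> \<psi> \<chi>. \<phi> x * \<psi> y * \<chi> z)) = t"
  by (rule tensor3_eqI) (simp_all add: form3_tensor trilin_tlift3)

interpretation T: hopf_points where scl = scl and Basis = Basis and \<Delta> = \<Delta> and \<epsilon> = \<epsilon> and S = S
  and scR = scale3 and R = "{F. trilin F}" and mul = mul3 and one = counit3
  by (rule hopf_points_trilin) (rule H_def)

text \<open>
  The coordinate points induce an injective algebra homomorphism \<open>E\<close> from the third tensor power of the
  dual to trilinear forms under convolution.  It sends the tensor of a form to that form, so inverting
  the reassociator means inverting its form.
\<close>

lemma reassoc_inv_dual:
  assumes \<omega>: "normalized_3_cocycle H \<omega>"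
  shows "reassoc_inv (K \<omega>) = form3_tensor H \<omega>"
proof -
  let ?\<eta> = "conv_inverse3 H \<omega>"
  let ?A = "tensor_alg D (tensor_alg D D)"
  define E where "E = T.tprod D (tensor_alg D D) pt1 (T.tprod D D pt2 pt3)"
  have A: "tensor_alg (K \<omega>) (tensor_alg D D) = ?A"
  proof -
    have "tens (K \<omega>) (tensor_alg D D) = tens D (tensor_alg D D)"
      "K \<omega> \<otimes> tensor_alg D D = D \<otimes> tensor_alg D D"
      by (rule tens_cong tensor_sp_cong; simp)+
    moreover have "tlift (K \<omega>) (tensor_alg D D) t F = tlift D (tensor_alg D D) t F"
      for t and F :: "_ \<Rightarrow> _ \<Rightarrow> ('h \<Rightarrow> 'k, ('h \<Rightarrow> 'k, 'h \<Rightarrow> 'k, 'k) tensor, 'k) tensor"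
      by (rule fun_cong[OF fun_cong[OF tlift_cong]]) simp_all
    ultimately show ?thesis unfolding tensor_alg_def[of "K \<omega>"] tensor_alg_def[of D "tensor_alg D D"] by simp
  qed
  have cA: "carrier ?A = carrier (D \<otimes> D \<otimes> D)"
    using tensor_sp_cong[of D D "tensor_alg D D" "D \<otimes> D"] by simp
  have hom: "T.alg_hom ?A E"
    unfolding E_def
    by (intro T.alg_hom_tprod alg_closed_tensor alg_closed_D T.pointD(1) point_pt1 point_pt2 point_pt3)
  note homD = T.alg_homD[OF hom]
  have closed: "alg_closed ?A" by (intro alg_closed_tensor alg_closed_D)
  have E: "E t = (\<lambda>x y z. tlift3 D t (\<lambda>\<phi> \<psi> \<chi>. \<phi> x * \<psi> y * \<chi> z))" if t: "t \<in> carrier ?A" for t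
  proof -
    let ?B = "\<lambda>x y z. tlift3 D t (\<lambda>\<phi> \<psi> \<chi>. \<phi> x * \<psi> y * \<chi> z)"
    have "E = T.tprod D (D \<otimes> D) pt1 (T.tprod D D pt2 pt3)"
      unfolding E_def T.tprod_def[of D "tensor_alg D D"] T.tprod_def[of D "D \<otimes> D"]
      by (intro ext fun_cong[OF fun_cong[OF tlift_cong]]) simp_all
    then have "E t = T.tprod D (D \<otimes> D) pt1 (T.tprod D D pt2 pt3) (form3_tensor H ?B)"
      using t by (simp add: form3_tensor_surj cA del: tensor_alg_simps)
    also have "\<dots> = ?B"
      using t by (simp add: T.tprod_form3 trilin_tlift3 point_pt1 point_pt2 point_pt3 tri_generic cA del: tensor_alg_simps)
    finally show ?thesis .
  qed
  have inj: "t = u" if "t \<in> carrier ?A" "u \<in> carrier ?A" "E t = E u" for t u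
  proof (rule tensor3_eqI)
    show "t \<in> carrier (D \<otimes> D \<otimes> D)" "u \<in> carrier (D \<otimes> D \<otimes> D)" using that(1,2) unfolding cA .
    show "tlift3 D t (\<lambda>\<phi> \<psi> \<chi>. \<phi> x * \<psi> y * \<chi> z) = tlift3 D u (\<lambda>\<phi> \<psi> \<chi>. \<phi> x * \<psi> y * \<chi> z)" for x y z
      using fun_cong[OF fun_cong[OF fun_cong[OF that(3)]], of x y z] by (simp only: E[OF that(1)] E[OF that(2)])
  qed
  have tri: "trilin \<omega>" "trilin ?\<eta>"
    using \<omega> is_conv_inverse3[OF \<omega>] by (simp_all add: normalized_3_cocycle_def is_conv_inverse3_def)
  have m: "mul3 ?\<eta> \<omega> = counit3" "mul3 \<omega> ?\<eta> = counit3"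
    using is_conv_inverse3[OF \<omega>] tri
    by (simp_all add: is_conv_inverse3_def mul3_trilin fun_eq_iff counit3_def)
  have cf: "form3_tensor H B \<in> carrier ?A" if "trilin B" for B
    unfolding cA by (rule form3_tensor_carrier[OF that])
  have Ef: "E (form3_tensor H B) = B" if "trilin B" for B
    by (intro ext) (simp only: E[OF cf[OF that]] tlift_form3_tensor[OF that])
  have one: "\<one>\<^bsub>?A\<^esub> \<in> carrier ?A"
    using closed by (simp only: alg_closed_def)
  have mult: "t \<cdot>\<^bsub>?A\<^esub> u \<in> carrier ?A" if "t \<in> carrier ?A" "u \<in> carrier ?A" for t u
    using closed that unfolding alg_closed_def by blast
  have eq1: "t \<cdot>\<^bsub>?A\<^esub> u = \<one>\<^bsub>?A\<^esub> \<longleftrightarrow> mul3 (E t) (E u) = counit3" if "t \<in> carrier ?A" "u \<in> carrier ?A" for t u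
  proof
    assume "t \<cdot>\<^bsub>?A\<^esub> u = \<one>\<^bsub>?A\<^esub>"
    then have "E (t \<cdot>\<^bsub>?A\<^esub> u) = E \<one>\<^bsub>?A\<^esub>" by (rule arg_cong)
    then show "mul3 (E t) (E u) = counit3" by (simp only: homD(4)[OF that] homD(5))
  next
    assume "mul3 (E t) (E u) = counit3"
    then show "t \<cdot>\<^bsub>?A\<^esub> u = \<one>\<^bsub>?A\<^esub>"
      by (intro inj[OF mult[OF that] one]) (simp only: homD(4)[OF that] homD(5))
  qed
  show ?thesis
    unfolding reassoc_inv_def alg_inverse_def tensor_alg_K A K_simps
  proof (rule the_equality)
    show "form3_tensor H \<omega> \<in> carrier ?A \<and> form3_tensor H ?\<eta> \<cdot>\<^bsub>?A\<^esub> form3_tensor H \<omega> = \<one>\<^bsub>?A\<^esub> \<and>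
        form3_tensor H \<omega> \<cdot>\<^bsub>?A\<^esub> form3_tensor H ?\<eta> = \<one>\<^bsub>?A\<^esub>"
      using tri m by (simp only: cf eq1 Ef simp_thms)
  next
    fix u
    assume u: "u \<in> carrier ?A \<and> form3_tensor H ?\<eta> \<cdot>\<^bsub>?A\<^esub> u = \<one>\<^bsub>?A\<^esub> \<and> u \<cdot>\<^bsub>?A\<^esub> form3_tensor H ?\<eta> = \<one>\<^bsub>?A\<^esub>"
    then have uc: "u \<in> carrier ?A" by blast
    have eq: "mul3 ?\<eta> (E u) = counit3"
      using conjunct1[OF conjunct2[OF u], unfolded eq1[OF cf[OF tri(2)] uc] Ef[OF tri(2)]] .
    have "E u = \<omega>"
      by (rule T.inverse_unique[OF homD(1)[OF uc] _ eq m(1)]) (simp add: tri(1))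
    then show "u = form3_tensor H \<omega>"
      by (intro inj[OF uc cf[OF tri(1)]]) (simp only: Ef[OF tri(1)])
  qed
qed

text \<open>
  The inverse of the inverse of a group element is the element itself; at the generic point this says
  that the antipode is an involution.
\<close>

lemma antipode_antipode: "S (S x) = x"
proof -
  have "lin \<phi> \<Longrightarrow> \<phi> (S (S x)) = \<phi> x" for \<phi>
  proof -
    assume \<phi>: "lin \<phi>"
    then have *: "lin (\<lambda>x. \<phi> (S x))" "lin (\<lambda>x. \<phi> (S (S x)))"
      by (intro lin_app[OF \<phi>] linH_S linH_id)+
    have "T.pinv (T.pinv pt1) \<phi> = pt1 \<phi>" by (simp only: T.pinv_pinv[OF point_pt1])
    then have "pt1 (\<lambda>x. \<phi> (S (S x))) = pt1 \<phi>"
      using \<phi> * by (simp add: T.pinv_def)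
    then have "pt1 (\<lambda>x. \<phi> (S (S x))) x 1 1 = pt1 \<phi> x 1 1" by simp
    then show "\<phi> (S (S x)) = \<phi> x"
      using *(2) \<phi> by (simp add: pt1_def counit_one)
  qed
  then have "coord b (S (S x)) = coord b x" for b by (simp add: lin_coord)
  then show ?thesis using coord_sum[of "S (S x)"] coord_sum[of x] by simp
qed

lemma antipode_inv_K:
  assumes "lin \<phi>"
  shows "antipode_inv (K \<omega>) \<phi> = (\<lambda>h. \<phi> (S h))"
proof -
  have "lin (\<lambda>h. \<phi> (S h))" by (intro lin_app[OF assms] linH_S linH_id)
  moreover have "inj_on (\<lambda>\<phi> h. \<phi> (S h)) {\<phi>. lin \<phi>}"
    by (rule inj_on_inverseI[where g = "\<lambda>\<phi> h. \<phi> (S h)"]) (simp add: antipode_antipode)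
  ultimately show ?thesis
    unfolding antipode_inv_def K_simps
    by (intro inv_into_f_eq) (simp_all add: antipode_antipode)
qed

end

section \<open>The Drinfeld twist and the element Omega on points\<close>

lemma span_closed_add: "span_closed U \<Longrightarrow> x \<in> carrier U \<Longrightarrow> y \<in> carrier U \<Longrightarrow> x + y \<in> carrier U"
  and span_closed_zero: "span_closed U \<Longrightarrow> 0 \<in> carrier U"
  by (simp_all add: span_closed_def)

context fd_cocommutative_hopf_algebra
begin

lemma tlift3_closed:
  assumes "span_closed U" "t \<in> carrier (D \<otimes> D \<otimes> D)"
    and "\<And>a b c. lin a \<Longrightarrow> lin b \<Longrightarrow> lin c \<Longrightarrow> F a b c \<in> carrier U"
  shows "tlift3 D t F \<in> carrier U"
  unfolding tlift3_def
  by (rule tlift_closed[OF assms(2)], rule tlift_closed)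
    (simp_all add: assms span_closed_add span_closed_zero)

lemma lin_map_tlift3:
  assumes "lin_map U Z L" "span_closed U" "t \<in> carrier (D \<otimes> D \<otimes> D)"
    and "\<And>a b c. lin a \<Longrightarrow> lin b \<Longrightarrow> lin c \<Longrightarrow> F a b c \<in> carrier U"
  shows "L (tlift3 D t F) = tlift3 D t (\<lambda>a b c. L (F a b c))"
proof -
  note z = span_closed_zero[OF assms(2)] and a = span_closed_add[OF assms(2)]
  have "L (tlift3 D t F) = tlift D (D \<otimes> D) t (\<lambda>a u. L (tlift D D u (F a)))"
    unfolding tlift3_def
    by (rule lin_map_tlift[OF assms(1) z a assms(3)], assumption+, rule tlift_closed) (simp_all add: assms(4) z a)
  also have "\<dots> = tlift3 D t (\<lambda>a b c. L (F a b c))"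
    unfolding tlift3_def
    by (rule tlift_cong_mem[OF assms(3)], rule lin_map_tlift[OF assms(1) z a]) (simp_all add: assms(4))
  finally show ?thesis .
qed

lemma dcomult_carrier: "lin \<phi> \<Longrightarrow> dcomult \<phi> \<in> carrier (D \<otimes> D)"
  unfolding dcomult_def by (rule form2_tensor_carrier) (rule lin_app, assumption, intro linH_mult_left linH_mult_right linH_id)+

lemma dcomult_cong:
  assumes "lin \<phi>" "\<And>a b. lin a \<Longrightarrow> lin b \<Longrightarrow> F a b = G a b"
  shows "tlift D D (dcomult \<phi>) F = tlift D D (dcomult \<phi>) G"
  by (rule tlift_cong_mem[OF dcomult_carrier[OF assms(1)]]) (simp_all add: assms(2))

lemma dcomult_closed:
  assumes "span_closed U" "lin \<phi>" "\<And>a b. lin a \<Longrightarrow> lin b \<Longrightarrow> F a b \<in> carrier U"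
  shows "tlift D D (dcomult \<phi>) F \<in> carrier U"
  by (rule tlift_closed[OF dcomult_carrier[OF assms(2)]])
    (simp_all add: assms span_closed_add span_closed_zero)

lemma lin_map_dcomult:
  assumes "lin_map U Z L" "span_closed U" "lin \<phi>" "\<And>a b. lin a \<Longrightarrow> lin b \<Longrightarrow> F a b \<in> carrier U"
  shows "L (tlift D D (dcomult \<phi>) F) = tlift D D (dcomult \<phi>) (\<lambda>a b. L (F a b))"
  by (rule lin_map_tlift[OF assms(1) span_closed_zero[OF assms(2)] span_closed_add[OF assms(2)]
        dcomult_carrier[OF assms(3)]]) (simp_all add: assms(4))

lemma lin_antipode: "lin \<phi> \<Longrightarrow> lin (\<lambda>x. \<phi> (S x))"
  by (rule lin_app[OF _ linH_S[OF linH_id]])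

lemma lin_beta: "trilin \<omega> \<Longrightarrow> lin (beta_form H \<omega>)"
  unfolding beta_form_def cop3_def H_simps
  by (intro lin_intros; (erule trilin_app)?; intro lin_intros)

lemmas span_closed_DD = span_closed_tensor[OF span_closed_D, of D]

end

context hopf_points
begin

lemma tprod_comult:
  assumes "lin \<phi>" "point f" "point g"
  shows "tprod D D f g (dcomult \<phi>) = (f \<star> g) \<phi>"
  using assms
  unfolding dcomult_def
  by (subst tprod_form2) (simp_all add: lin_app[OF assms(1)] linH_mult_left linH_mult_right linH_id pmul_eq)

end

context cocycle_points
begin

abbreviation \<Phi> where "\<Phi> \<equiv> form3_tensor H \<eta>"
abbreviation \<Psi> where "\<Psi> \<equiv> form3_tensor H \<omega>"

lemma eta_eq: "conv_inverse3 H \<omega> = \<eta>"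
  by (rule conv_inverse3_unique[OF is_conv_inverse3[OF cocycle] inverse trilin_omega])

lemma reassoc_inv_K: "reassoc_inv (K \<omega>) = \<Psi>"
  by (simp add: reassoc_inv_dual cocycle)

lemmas K_unfold = tlift3_K K_tlift_simps reassoc_inv_K cop2_K K_simps K_tensor_simps tensor_alg_K eta_eq

lemmas Phi_carrier = form3_tensor_carrier[OF trilin_eta]
lemmas Psi_carrier = form3_tensor_carrier[OF trilin_omega]

lemma mul_tlift3_right: "z \<bullet> tlift3 D t F = tlift3 D t (\<lambda>a b c. z \<bullet> F a b c)"
  and mul_tlift3_left: "tlift3 D t F \<bullet> z = tlift3 D t (\<lambda>a b c. F a b c \<bullet> z)"
  by (simp_all add: tlift3_def mul_tlift_left mul_tlift_right)

lemma form3_on_points: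
  assumes "trilin B" "point f" "point g" "point h"
  shows "tlift3 D (form3_tensor H B) (\<lambda>a b c. f a \<bullet> (g b \<bullet> h c)) = tri B f g h"
  by (simp add: tprod_form3[OF assms, symmetric] tprod_def tlift3_def mul_tlift_right)

lemma dcomult_on_points:
  "lin \<phi> \<Longrightarrow> point f \<Longrightarrow> point g \<Longrightarrow> tlift D D (dcomult \<phi>) (\<lambda>a b. f a \<bullet> g b) = (f \<star> g) \<phi>"
  by (simp add: tprod_comult[symmetric] tprod_def)

lemma point_antipode: "lin \<phi> \<Longrightarrow> f (\<lambda>x. \<phi> (S x)) = pinv f \<phi>"
  by (simp add: pinv_def)

lemma tprod_DD_lin_map: "point f \<Longrightarrow> point g \<Longrightarrow> lin_map (D \<otimes> D) Rv (tprod D D f g)"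
  by (intro tprod_lin_map lin_map_point span_closed_D)

lemma tprod_DD_tens: "point f \<Longrightarrow> point g \<Longrightarrow> lin \<phi> \<Longrightarrow> lin \<psi> \<Longrightarrow> tprod D D f g (tens D D \<phi> \<psi>) = f \<phi> \<bullet> g \<psi>"
  by (simp add: tprod_tens lin_map_point)

lemmas lin_K = lin_conv lin_antipode lin_counit lin_beta[OF trilin_omega]

lemma tens_DD: "lin \<phi> \<Longrightarrow> lin \<psi> \<Longrightarrow> tens D D \<phi> \<psi> \<in> carrier (D \<otimes> D)"
  by (simp add: tens_carrier)

lemma gamma_carrier: "gamma_elt (K \<omega>) \<in> carrier (D \<otimes> D)"
  unfolding gamma_elt_def K_unfold
  by (intro tlift3_closed[OF span_closed_DD] dcomult_closed[OF span_closed_DD] Phi_carrier Psi_carrier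
      tens_DD lin_K; assumption)

text \<open>
  A point is multiplicative on the dual and turns the comultiplication of the dual into the product of
  points; so each of the two reassociators in \<open>\<gamma>\<close> contributes one value.
\<close>

lemma gamma_on_points:
  assumes f: "point f" and g: "point g"
  shows "tprod D D f g (gamma_elt (K \<omega>)) = gamma_pt f g"
proof -
  let ?f = "pinv f" and ?g = "pinv g"
  note L = tprod_DD_lin_map[OF f g]
  note pts = f g point_pinv
  have "tprod D D f g (gamma_elt (K \<omega>)) = tlift3 D \<Phi> (\<lambda>X1 X2 X3. tlift3 D \<Psi> (\<lambda>x1 x2 x3. tlift D D (dcomult x1) (\<lambda>x11 x12.
      tprod D D f g (tens D D (conv H (conv H (conv H (\<lambda>h. conv H X2 x12 (S h)) \<epsilon>) X3) x2)
        (conv H (conv H (\<lambda>h. conv H X1 x11 (S h)) \<epsilon>) x3)))))"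
    unfolding gamma_elt_def K_unfold
    apply (subst lin_map_tlift3[OF L span_closed_DD Phi_carrier])
     apply (intro tlift3_closed[OF span_closed_DD] dcomult_closed[OF span_closed_DD] Psi_carrier tens_DD lin_K; assumption)
    apply (rule tlift3_cong_mem[OF Phi_carrier])
    apply (subst lin_map_tlift3[OF L span_closed_DD Psi_carrier])
     apply (intro dcomult_closed[OF span_closed_DD] tens_DD lin_K; assumption)
    apply (rule tlift3_cong_mem[OF Psi_carrier])
    apply (rule lin_map_dcomult[OF L span_closed_DD])
     apply assumption
    apply (intro tens_DD lin_K; assumption)
    done
  also have "\<dots> = tlift3 D \<Phi> (\<lambda>X1 X2 X3. tlift3 D \<Psi> (\<lambda>x1 x2 x3. tlift D D (dcomult x1) (\<lambda>x11 x12.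
      (?g X1 \<bullet> (?f X2 \<bullet> f X3)) \<bullet> ((?g x11 \<bullet> ?f x12) \<bullet> (f x2 \<bullet> g x3)))))"
    apply (rule tlift3_cong_mem[OF Phi_carrier], rule tlift3_cong_mem[OF Psi_carrier], rule dcomult_cong, assumption)
    apply (simp add: tprod_DD_tens f g lin_K pointD(3,4)[OF f] pointD(3,4)[OF g] point_antipode
        pointD(3)[OF point_pinv[OF f]] pointD(3)[OF point_pinv[OF g]] mul_one pointD(5) R_mul)
    apply (simp only: mul_ac)
    apply (simp add: one_mul R_mul pointD(5) f g point_pinv)
    done
  also have "\<dots> = tlift3 D \<Phi> (\<lambda>X1 X2 X3. ?g X1 \<bullet> (?f X2 \<bullet> f X3)) \<bullet> tlift3 D \<Psi> (\<lambda>x1 x2 x3.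
      tlift D D (dcomult x1) (\<lambda>x11 x12. ?g x11 \<bullet> ?f x12) \<bullet> (f x2 \<bullet> g x3))"
    by (simp only: mul_tlift3_left) (simp only: mul_tlift3_right mul_tlift_left mul_tlift_right)
  also have "tlift3 D \<Psi> (\<lambda>x1 x2 x3. tlift D D (dcomult x1) (\<lambda>x11 x12. ?g x11 \<bullet> ?f x12) \<bullet> (f x2 \<bullet> g x3))
    = tlift3 D \<Psi> (\<lambda>x1 x2 x3. (?g \<star> ?f) x1 \<bullet> (f x2 \<bullet> g x3))"
    by (rule tlift3_cong_mem[OF Psi_carrier]) (simp add: dcomult_on_points pts)
  finally show ?thesis
    by (simp add: form3_on_points trilin_eta trilin_omega pts point_pmul gamma_pt_def)
qed

lemma beta_on_points:
  assumes u: "point u"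
  shows "u (beta_form H \<omega>) = om u (pinv u) u"
proof -
  note li = linR_intros trilin_app[OF trilin_omega]
  have "u (beta_form H \<omega>) = ev u (\<lambda>h. cop3 H h (\<lambda>a b c. scR (\<omega> a (S b) c) one))"
    by (simp add: ev_point_one[OF u lin_beta[OF trilin_omega], symmetric] beta_form_def cop3_def scR_cop2)
  also have "\<dots> = ev u (\<lambda>a. ev u (\<lambda>b. ev u (\<lambda>c. scR (\<omega> a (S b) c) one)))"
    by (rule ev_cop3[OF pointD(1)[OF u]]) (intro li)+
  also have "\<dots> = om u (pinv u) u"
    unfolding tri_def by (intro ev_cong ev_pinv[OF _ u] li)
  finally show ?thesis .
qed

abbreviation mulDD (infixl "\<odot>" 70) where "s \<odot> t \<equiv> s \<cdot>\<^bsub>tensor_alg D D\<^esub> t"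

lemma mulDD_carrier: "s \<in> carrier (D \<otimes> D) \<Longrightarrow> t \<in> carrier (D \<otimes> D) \<Longrightarrow> s \<odot> t \<in> carrier (D \<otimes> D)"
  using alg_closed_tensor[OF alg_closed_D alg_closed_D] by (simp add: alg_closed_def)

lemma twist_factors_carrier:
  assumes "lin x1" "lin x2" "lin x3"
  shows "tlift D D (dcomult x1) (\<lambda>x11 x12. tens D D (\<lambda>h. x12 (S h)) (\<lambda>h. x11 (S h))) \<in> carrier (D \<otimes> D)"
    and "dcomult (conv H (conv H x2 (beta_form H \<omega>)) (\<lambda>h. x3 (S h))) \<in> carrier (D \<otimes> D)"
  using assms by (auto intro!: dcomult_closed[OF span_closed_DD] tens_DD lin_K dcomult_carrier)

lemma twist_carrier: "drinfeld_twist (K \<omega>) \<in> carrier (D \<otimes> D)"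
  unfolding drinfeld_twist_def K_unfold
  by (intro tlift3_closed[OF span_closed_DD] Psi_carrier mulDD_carrier gamma_carrier twist_factors_carrier)

text \<open>
  The factors of the twist other than \<open>\<gamma>\<close> cancel because \<open>\<omega>(u\<^sup>-\<^sup>1,u,u\<^sup>-\<^sup>1)\<close> is inverse to \<open>\<beta>(u) = \<omega>(u,u\<^sup>-\<^sup>1,u)\<close>.
\<close>

lemma twist_on_points:
  assumes f: "point f" and g: "point g"
  shows "tprod D D f g (drinfeld_twist (K \<omega>)) = gamma_pt f g"
proof -
  define u where "u = f \<star> g"
  have u: "point u" "point (pinv u)" and iu: "pinv u = pinv g \<star> pinv f"
    by (simp_all add: u_def f g point_simps)
  note L = tprod_DD_lin_map[OF f g]
  have hom: "alg_hom (tensor_alg D D) (tprod D D f g)"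
    by (intro alg_hom_tprod pointD(1) f g alg_closed_D)
  have "tprod D D f g (drinfeld_twist (K \<omega>)) = tlift3 D \<Psi> (\<lambda>x1 x2 x3. tprod D D f g (
      tlift D D (dcomult x1) (\<lambda>x11 x12. tens D D (\<lambda>h. x12 (S h)) (\<lambda>h. x11 (S h))) \<odot> gamma_elt (K \<omega>)
        \<odot> dcomult (conv H (conv H x2 (beta_form H \<omega>)) (\<lambda>h. x3 (S h)))))"
    unfolding drinfeld_twist_def K_unfold
    by (rule lin_map_tlift3[OF L span_closed_DD Psi_carrier])
      (intro mulDD_carrier gamma_carrier twist_factors_carrier)
  also have "\<dots> = tlift3 D \<Psi> (\<lambda>x1 x2 x3. (gamma_pt f g \<bullet> u (beta_form H \<omega>)) \<bullet> (pinv u x1 \<bullet> (u x2 \<bullet> pinv u x3)))"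
  proof (rule tlift3_cong_mem[OF Psi_carrier])
    fix x1 x2 x3 :: "'h \<Rightarrow> 'k" assume x: "lin x1" "lin x2" "lin x3"
    let ?A = "tlift D D (dcomult x1) (\<lambda>x11 x12. tens D D (\<lambda>h. x12 (S h)) (\<lambda>h. x11 (S h)))"
    let ?B = "dcomult (conv H (conv H x2 (beta_form H \<omega>)) (\<lambda>h. x3 (S h)))"
    have "tprod D D f g ?A = tlift D D (dcomult x1) (\<lambda>x11 x12. tprod D D f g (tens D D (\<lambda>h. x12 (S h)) (\<lambda>h. x11 (S h))))"
      by (rule lin_map_dcomult[OF L span_closed_DD x(1)]) (intro tens_DD lin_K)
    also have "\<dots> = tlift D D (dcomult x1) (\<lambda>x11 x12. pinv g x11 \<bullet> pinv f x12)"
      by (rule dcomult_cong[OF x(1)]) (simp add: tprod_DD_tens f g lin_K point_antipode mul_commute)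
    also have "\<dots> = pinv u x1" by (simp add: dcomult_on_points x f g point_pinv iu)
    finally have A: "tprod D D f g ?A = pinv u x1" .
    have B: "tprod D D f g ?B = u x2 \<bullet> u (beta_form H \<omega>) \<bullet> pinv u x3"
      by (simp add: tprod_comult f g lin_K x u_def[symmetric] pointD(3)[OF u(1)] point_antipode)
    have "tprod D D f g (?A \<odot> gamma_elt (K \<omega>) \<odot> ?B) = pinv u x1 \<bullet> gamma_pt f g \<bullet> (u x2 \<bullet> u (beta_form H \<omega>) \<bullet> pinv u x3)"
      using alg_homD(4)[OF hom] twist_factors_carrier[OF x]
      by (simp add: mulDD_carrier gamma_carrier A B gamma_on_points f g)
    then show "tprod D D f g (?A \<odot> gamma_elt (K \<omega>) \<odot> ?B)
      = (gamma_pt f g \<bullet> u (beta_form H \<omega>)) \<bullet> (pinv u x1 \<bullet> (u x2 \<bullet> pinv u x3))"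
      by (simp add: mul_ac)
  qed
  also have "\<dots> = gamma_pt f g \<bullet> (om (pinv u) u (pinv u) \<bullet> om u (pinv u) u)"
    by (simp only: mul_tlift3_right[symmetric] form3_on_points[OF trilin_omega] u beta_on_points)
      (simp only: mul_ac)
  also have "\<dots> = gamma_pt f g"
    by (simp add: om_antipode u mul_one gamma_pt_def tri_closed R_mul f g point_simps)
  finally show ?thesis .
qed

abbreviation C5 where "C5 \<equiv> D \<otimes> D \<otimes> D \<otimes> D \<otimes> D"

text \<open>
  Five points applied to the factors of a fivefold tensor.
\<close>

definition ev5 where
  "ev5 g1 g2 g3 g4 g5 = tprod D (D \<otimes> D \<otimes> D \<otimes> D) g1 (tprod D (D \<otimes> D \<otimes> D) g2
     (tprod D (D \<otimes> D) g3 (tprod D D g4 g5)))"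

lemma span_closed_C5: "span_closed C5"
  by (intro span_closed_tensor span_closed_D)

lemma tens5_carrier:
  "lin a \<Longrightarrow> lin b \<Longrightarrow> lin c \<Longrightarrow> lin d \<Longrightarrow> lin e \<Longrightarrow> tens5 D a b c d e \<in> carrier C5"
  unfolding tens5_def tens3_def by (intro tens_carrier) simp_all

lemma ev5_lin_map:
  assumes "point g1" "point g2" "point g3" "point g4" "point g5"
  shows "lin_map C5 Rv (ev5 g1 g2 g3 g4 g5)"
  unfolding ev5_def by (intro tprod_lin_map lin_map_point span_closed_D assms)

lemma ev5_tens5:
  assumes g: "point g1" "point g2" "point g3" "point g4" "point g5"
    and l: "lin a" "lin b" "lin c" "lin d" "lin e"
  shows "ev5 g1 g2 g3 g4 g5 (tens5 D a b c d e) = g1 a \<bullet> (g2 b \<bullet> (g3 c \<bullet> (g4 d \<bullet> g5 e)))"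
proof -
  show ?thesis
    unfolding ev5_def tens5_def tens3_def
    by (simp add: tprod_tens tens_carrier lin_map_point tprod_lin_map span_closed_D g l)
qed

text \<open>The summands of \<open>\<Omega>\<close>, using that the antipode of the dual is its own inverse.\<close>

definition Omega_summand where
  "Omega_summand X2 X3 x1 x3 y1 y2 y3 f1 f2 X1_11 X1_12 X1_2 x2_1 x2_2 =
    tens5 D (conv H (conv H X1_11 y1) x1) (conv H (conv H X1_12 y2) x2_1) (conv H (conv H X1_2 y3) x2_2)
      (\<lambda>h. conv H (conv H f1 X2) x3 (S h)) (\<lambda>h. conv H f2 X3 (S h))"

abbreviation twist where "twist \<equiv> drinfeld_twist (K \<omega>)"

lemma Omega_elt_eq:
  "Omega_elt (K \<omega>) = tlift3 D \<Phi> (\<lambda>X1 X2 X3. tlift3 D \<Psi> (\<lambda>x1 x2 x3. tlift3 D \<Psi> (\<lambda>y1 y2 y3.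
     tlift D D twist (\<lambda>f1 f2. tlift D D (dcomult X1) (\<lambda>X1_1 X1_2. tlift D D (dcomult X1_1) (\<lambda>X1_11 X1_12.
       tlift D D (dcomult x2) (\<lambda>x2_1 x2_2.
         Omega_summand X2 X3 x1 x3 y1 y2 y3 f1 f2 X1_11 X1_12 X1_2 x2_1 x2_2)))))))"
  unfolding Omega_elt_def tens5_K K_unfold
  by (intro tlift3_cong_mem[OF Phi_carrier] tlift3_cong_mem[OF Psi_carrier] tlift_cong_mem[OF twist_carrier]
      dcomult_cong)
    (simp_all add: Omega_summand_def antipode_inv_K lin_K)

lemma Omega_summand_carrier:
  "\<lbrakk>lin X2; lin X3; lin x1; lin x3; lin y1; lin y2; lin y3; lin f1; lin f2; lin X1_11; lin X1_12; lin X1_2; lin x2_1; lin x2_2\<rbrakk>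
    \<Longrightarrow> Omega_summand X2 X3 x1 x3 y1 y2 y3 f1 f2 X1_11 X1_12 X1_2 x2_1 x2_2 \<in> carrier C5"
  unfolding Omega_summand_def by (intro tens5_carrier lin_K)

lemma twist_closed:
  "(\<And>a b. lin a \<Longrightarrow> lin b \<Longrightarrow> G a b \<in> carrier C5) \<Longrightarrow> tlift D D twist G \<in> carrier C5"
  by (rule tlift_closed[OF twist_carrier]) (simp_all add: span_closed_zero span_closed_add span_closed_C5)

lemmas Omega_closed = tlift3_closed[OF span_closed_C5 Phi_carrier] tlift3_closed[OF span_closed_C5 Psi_carrier]
  twist_closed dcomult_closed[OF span_closed_C5] Omega_summand_carrier

lemma Omega_carrier: "Omega_elt (K \<omega>) \<in> carrier C5"
  unfolding Omega_elt_eq by (intro Omega_closed)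

lemma lin_map_twist:
  assumes "lin_map C5 Rv L" "\<And>a b. lin a \<Longrightarrow> lin b \<Longrightarrow> G a b \<in> carrier C5"
  shows "L (tlift D D twist G) = tlift D D twist (\<lambda>a b. L (G a b))"
  by (rule lin_map_tlift[OF assms(1) tensor_zero_carrier tensor_add_carrier twist_carrier]) (simp_all add: assms(2))

text \<open>
  Each of the three reassociators and the twist in \<open>\<Omega>\<close> contributes one factor; the comultiplied legs
  evaluate to products of points, and the legs under the antipode to inverse points.
\<close>

lemma Omega_on_points:
  assumes g: "point g1" "point g2" "point g3" "point g4" "point g5"
  shows "ev5 g1 g2 g3 g4 g5 (Omega_elt (K \<omega>)) = Omega_pt g1 g2 g3 g4 g5"
proof -
  let ?L = "ev5 g1 g2 g3 g4 g5"
  note L = ev5_lin_map[OF g]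
  note ig = g[THEN point_pinv]
  note push = lin_map_tlift3[OF L span_closed_C5 Phi_carrier] lin_map_tlift3[OF L span_closed_C5 Psi_carrier]
    lin_map_twist[OF L] lin_map_dcomult[OF L span_closed_C5]
  have e1: "tlift3 D \<Phi> (\<lambda>X1 X2 X3. tlift D D (dcomult X1) (\<lambda>X1_1 X1_2.
        tlift D D (dcomult X1_1) (\<lambda>X1_11 X1_12. g1 X1_11 \<bullet> g2 X1_12) \<bullet> g3 X1_2) \<bullet> (pinv g4 X2 \<bullet> pinv g5 X3))
    = tlift3 D \<Phi> (\<lambda>X1 X2 X3. (g1 \<star> g2 \<star> g3) X1 \<bullet> (pinv g4 X2 \<bullet> pinv g5 X3))"
  proof (rule tlift3_cong_mem[OF Phi_carrier])
    fix X1 X2 X3 :: "'h \<Rightarrow> 'k" assume X1: "lin X1"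
    have "tlift D D (dcomult X1) (\<lambda>X1_1 X1_2. tlift D D (dcomult X1_1) (\<lambda>X1_11 X1_12. g1 X1_11 \<bullet> g2 X1_12) \<bullet> g3 X1_2)
      = tlift D D (dcomult X1) (\<lambda>X1_1 X1_2. (g1 \<star> g2) X1_1 \<bullet> g3 X1_2)"
      by (rule dcomult_cong[OF X1]) (simp add: dcomult_on_points g)
    also have "\<dots> = (g1 \<star> g2 \<star> g3) X1" by (simp add: dcomult_on_points X1 g point_pmul)
    finally show "tlift D D (dcomult X1) (\<lambda>X1_1 X1_2. tlift D D (dcomult X1_1) (\<lambda>X1_11 X1_12. g1 X1_11 \<bullet> g2 X1_12) \<bullet> g3 X1_2)
        \<bullet> (pinv g4 X2 \<bullet> pinv g5 X3) = (g1 \<star> g2 \<star> g3) X1 \<bullet> (pinv g4 X2 \<bullet> pinv g5 X3)" by simp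
  qed
  have e2: "tlift3 D \<Psi> (\<lambda>x1 x2 x3. g1 x1 \<bullet> (tlift D D (dcomult x2) (\<lambda>x2_1 x2_2. g2 x2_1 \<bullet> g3 x2_2) \<bullet> pinv g4 x3))
    = tlift3 D \<Psi> (\<lambda>x1 x2 x3. g1 x1 \<bullet> ((g2 \<star> g3) x2 \<bullet> pinv g4 x3))"
    by (rule tlift3_cong_mem[OF Psi_carrier]) (simp add: dcomult_on_points g)
  have e3: "tlift D D twist (\<lambda>f1 f2. pinv g4 f1 \<bullet> pinv g5 f2) = gamma_pt (pinv g4) (pinv g5)"
    using twist_on_points[OF ig(4,5)] by (simp add: tprod_def)
  have "?L (Omega_elt (K \<omega>)) = tlift3 D \<Phi> (\<lambda>X1 X2 X3. tlift3 D \<Psi> (\<lambda>x1 x2 x3. tlift3 D \<Psi> (\<lambda>y1 y2 y3.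
     tlift D D twist (\<lambda>f1 f2. tlift D D (dcomult X1) (\<lambda>X1_1 X1_2. tlift D D (dcomult X1_1) (\<lambda>X1_11 X1_12.
       tlift D D (dcomult x2) (\<lambda>x2_1 x2_2.
         ?L (Omega_summand X2 X3 x1 x3 y1 y2 y3 f1 f2 X1_11 X1_12 X1_2 x2_1 x2_2))))))))"
    unfolding Omega_elt_eq
    \<comment> \<open>The evaluation is linear and is moved inside the seven nested sums, one at a time.\<close>
    apply (subst push(1), (intro Omega_closed; assumption), rule tlift3_cong_mem[OF Phi_carrier])
    apply (subst push(2), (intro Omega_closed; assumption), rule tlift3_cong_mem[OF Psi_carrier])
    apply (subst push(2), (intro Omega_closed; assumption), rule tlift3_cong_mem[OF Psi_carrier])
    apply (subst push(3), (intro Omega_closed; assumption), rule tlift_cong_mem[OF twist_carrier])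
    apply (subst push(4), assumption, (intro Omega_closed; simp; fail), rule dcomult_cong, assumption)
    apply (subst push(4), assumption, (intro Omega_closed; simp; fail), rule dcomult_cong, assumption)
    apply (rule push(4), assumption, (intro Omega_closed; simp; fail))
    done
  \<comment> \<open>Each leg is a product in the dual; its factors are regrouped by the tensor they come from.\<close>
  also have "\<dots> = tlift3 D \<Phi> (\<lambda>X1 X2 X3. tlift3 D \<Psi> (\<lambda>x1 x2 x3. tlift3 D \<Psi> (\<lambda>y1 y2 y3.
     tlift D D twist (\<lambda>f1 f2. tlift D D (dcomult X1) (\<lambda>X1_1 X1_2. tlift D D (dcomult X1_1) (\<lambda>X1_11 X1_12.
       tlift D D (dcomult x2) (\<lambda>x2_1 x2_2.
         (((g1 X1_11 \<bullet> g2 X1_12) \<bullet> g3 X1_2) \<bullet> (pinv g4 X2 \<bullet> pinv g5 X3))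
         \<bullet> ((g1 x1 \<bullet> ((g2 x2_1 \<bullet> g3 x2_2) \<bullet> pinv g4 x3))
         \<bullet> ((g1 y1 \<bullet> (g2 y2 \<bullet> g3 y3)) \<bullet> (pinv g4 f1 \<bullet> pinv g5 f2))))))))))"
    by (intro tlift3_cong_mem[OF Phi_carrier] tlift3_cong_mem[OF Psi_carrier] tlift_cong_mem[OF twist_carrier]
        dcomult_cong)
      (simp_all add: Omega_summand_def ev5_tens5 g lin_K point_antipode g[THEN pointD(3)] ig[THEN pointD(3)] mul_ac)
  also have "\<dots> = tlift3 D \<Phi> (\<lambda>X1 X2 X3. tlift D D (dcomult X1) (\<lambda>X1_1 X1_2.
        tlift D D (dcomult X1_1) (\<lambda>X1_11 X1_12. g1 X1_11 \<bullet> g2 X1_12) \<bullet> g3 X1_2) \<bullet> (pinv g4 X2 \<bullet> pinv g5 X3))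
     \<bullet> (tlift3 D \<Psi> (\<lambda>x1 x2 x3. g1 x1 \<bullet> (tlift D D (dcomult x2) (\<lambda>x2_1 x2_2. g2 x2_1 \<bullet> g3 x2_2) \<bullet> pinv g4 x3))
     \<bullet> (tlift3 D \<Psi> (\<lambda>y1 y2 y3. g1 y1 \<bullet> (g2 y2 \<bullet> g3 y3)) \<bullet> tlift D D twist (\<lambda>f1 f2. pinv g4 f1 \<bullet> pinv g5 f2)))"
    by (simp only: mul_tlift3_left[symmetric] mul_tlift3_right[symmetric] mul_tlift_left[symmetric] mul_tlift_right[symmetric])
  finally have "?L (Omega_elt (K \<omega>)) = et (g1 \<star> g2 \<star> g3) (pinv g4) (pinv g5)
      \<bullet> (om g1 (g2 \<star> g3) (pinv g4) \<bullet> (om g1 g2 g3 \<bullet> gamma_pt (pinv g4) (pinv g5)))"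
    by (simp only: e1 e2 e3 form3_on_points trilin_eta trilin_omega g ig point_pmul)
  then show ?thesis by (simp add: Omega_pt_def mul_ac)
qed

end

section \<open>The maps and products in Sweedler form\<close>

context fd_cocommutative_hopf_algebra
begin

lemma tlift_cop2: "tlift V W t (\<lambda>a b. cop2 H h (\<lambda>x y. G a b x y)) = cop2 H h (\<lambda>x y. tlift V W t (\<lambda>a b. G a b x y))"
  unfolding cop2_def by (rule tlift_swap)

lemma tlift3_cop2: "tlift3 D t (\<lambda>a b c. cop2 H h (\<lambda>x y. G a b c x y)) = cop2 H h (\<lambda>x y. tlift3 D t (\<lambda>a b c. G a b c x y))"
  unfolding tlift3_def tlift_cop2 ..

lemma tlift3_mult_right: "tlift3 D t F * (c::'k) = tlift3 D t (\<lambda>x y z. F x y z * c)"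
  by (simp add: tlift3_def tlift_mult_right)

lemma cop2_apply: "cop2 H h F x = cop2 H h (\<lambda>a b. F a b x)"
  unfolding cop2_def by (rule tlift_fun_apply)

lemma cop2_closed:
  "(\<And>a b. F a b \<in> carrier (V \<otimes> W)) \<Longrightarrow> cop2 H h F \<in> carrier (V \<otimes> W)"
  unfolding cop2_def H_simps
  by (rule tlift_closed[OF comult_carrier]) (simp_all add: tensor_zero_carrier tensor_add_carrier)

lemma cop345_closed:
  shows "(\<And>a b c. F3 a b c \<in> carrier (V \<otimes> W)) \<Longrightarrow> cop3 H h F3 \<in> carrier (V \<otimes> W)"
    and "(\<And>a b c d. F4 a b c d \<in> carrier (V \<otimes> W)) \<Longrightarrow> cop4 H h F4 \<in> carrier (V \<otimes> W)"
    and "(\<And>a b c d e. F5 a b c d e \<in> carrier (V \<otimes> W)) \<Longrightarrow> cop5 H h F5 \<in> carrier (V \<otimes> W)"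
  unfolding cop3_def cop4_def cop5_def by (intro cop2_closed; assumption)+

lemma tlift_closed_tensor:
  "t \<in> carrier (V \<otimes> W) \<Longrightarrow> (\<And>a b. a \<in> carrier V \<Longrightarrow> b \<in> carrier W \<Longrightarrow> F a b \<in> carrier (V' \<otimes> W')) \<Longrightarrow>
    tlift V W t F \<in> carrier (V' \<otimes> W')"
  by (rule tlift_closed) (simp_all add: tensor_zero_carrier tensor_add_carrier)

lemma bilin_DH: "lin \<chi> \<Longrightarrow> bilin_map D H base_field (\<lambda>\<phi> h. \<phi> a * \<chi> h)"
  and bilin_HD: "lin \<chi> \<Longrightarrow> bilin_map H D base_field (\<lambda>h \<phi>. \<chi> h * \<phi> a)"
  by (simp_all add: bilin_map_def lin_map_def lin_iff algebra_simps)

text \<open>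
  The coefficients of a tensor are its values on products of an evaluation and a linear form.  This is
  the test by which all identities between elements of the two algebras are proved.
\<close>

lemma DH_eqI:
  assumes "t \<in> carrier (D \<otimes> H)" "u \<in> carrier (D \<otimes> H)"
    and "\<And>a \<chi>. lin \<chi> \<Longrightarrow> t (\<lambda>\<phi> h. \<phi> a * \<chi> h) = u (\<lambda>\<phi> h. \<phi> a * \<chi> h)"
  shows "t = u"
  by (rule dual_basis_tensor_eqI[OF dual_basis_D dual_basis_H assms(1,2)])
    (simp add: tlift_eq_apply[OF assms(1) bilin_DH] tlift_eq_apply[OF assms(2) bilin_DH] lin_coord assms(3))

lemma HD_eqI:
  assumes "t \<in> carrier (H \<otimes> D)" "u \<in> carrier (H \<otimes> D)"
    and "\<And>a \<chi>. lin \<chi> \<Longrightarrow> t (\<lambda>h \<phi>. \<chi> h * \<phi> a) = u (\<lambda>h \<phi>. \<chi> h * \<phi> a)"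
  shows "t = u"
  by (rule dual_basis_tensor_eqI[OF dual_basis_H dual_basis_D assms(1,2)])
    (simp add: tlift_eq_apply[OF assms(1) bilin_HD] tlift_eq_apply[OF assms(2) bilin_HD] lin_coord assms(3))

lemma tlift_dcomult:
  assumes "lin \<phi>"
  shows "tlift D D (dcomult \<phi>) (\<lambda>a b. a x * b y) = \<phi> (x * y)"
  unfolding dcomult_def
  by (rule tlift_form2_tensor) (rule lin_app[OF assms], intro linH_mult_left linH_mult_right linH_id)+

lemma tlift_dcomult3:
  assumes "lin \<phi>"
  shows "tlift D D (dcomult \<phi>) (\<lambda>a u. a x * tlift D D (dcomult u) (\<lambda>b c. b y * c z)) = \<phi> (x * (y * z))"
    and "tlift D D (dcomult \<phi>) (\<lambda>u c. tlift D D (dcomult u) (\<lambda>a b. a x * b y) * c z) = \<phi> (x * y * z)"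
proof -
  have "tlift D D (dcomult \<phi>) (\<lambda>a u. a x * tlift D D (dcomult u) (\<lambda>b c. b y * c z))
    = tlift D D (dcomult \<phi>) (\<lambda>a u. a x * u (y * z))"
    by (rule dcomult_cong[OF assms]) (simp add: tlift_dcomult)
  then show "tlift D D (dcomult \<phi>) (\<lambda>a u. a x * tlift D D (dcomult u) (\<lambda>b c. b y * c z)) = \<phi> (x * (y * z))"
    by (simp add: tlift_dcomult assms)
  have "tlift D D (dcomult \<phi>) (\<lambda>u c. tlift D D (dcomult u) (\<lambda>a b. a x * b y) * c z)
    = tlift D D (dcomult \<phi>) (\<lambda>u c. u (x * y) * c z)"
    by (rule dcomult_cong[OF assms]) (simp add: tlift_dcomult)
  then show "tlift D D (dcomult \<phi>) (\<lambda>u c. tlift D D (dcomult u) (\<lambda>a b. a x * b y) * c z) = \<phi> (x * y * z)"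
    by (simp add: tlift_dcomult assms)
qed

lemma cop2_dual_hopf [simp]: "cop2 (dual_hopf H) \<phi> F = tlift D D (dcomult \<phi>) F"
proof -
  have "tlift (dual_hopf H) (dual_hopf H) t F = tlift D D t F" for t
    by (rule fun_cong[OF fun_cong[OF tlift_cong]]) (simp_all add: dual_hopf_def)
  then show ?thesis by (simp add: cop2_def dual_hopf_def dcomult_def)
qed

lemma antipode_dual_hopf [simp]: "antipode (dual_hopf H) = (\<lambda>\<phi> h. \<phi> (S h))"
  by (simp add: dual_hopf_def)

lemma lin_ract_lact:
  assumes \<chi>: "lin \<chi>" and \<psi>: "lin \<psi>"
  shows "\<chi> (ract H (lact H \<phi> h) \<psi>) = cop2 H h (\<lambda>u v. cop2 H u (\<lambda>p q. \<phi> v * \<psi> p * \<chi> q))"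
proof -
  have "linH (\<lambda>x. scl c x)" for c by (simp add: linH_iff scale_right_distrib mult.commute)
  have l: "lin (\<lambda>u. cop2 H u (\<lambda>p q. \<psi> p * \<chi> q))" by (intro lin_intros \<chi> \<psi>)
  have "\<chi> (ract H (lact H \<phi> h) \<psi>) = cop2 H (lact H \<phi> h) (\<lambda>p q. \<psi> p * \<chi> q)"
    by (simp add: ract_def linear_cop2_value[OF \<chi>] linear_imp_hom(2)[OF \<chi>])
  also have "\<dots> = cop2 H h (\<lambda>u v. \<phi> v * cop2 H u (\<lambda>p q. \<psi> p * \<chi> q))"
    by (simp add: lact_def linear_cop2_value[OF l] linear_imp_hom(2)[OF l])
  finally show ?thesis by (simp add: cop2_mult_left mult.assoc)
qed

end

context cocycle_points
begin

text \<open>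
  The first tensor factor of \<open>w(h \<bowtie> \<phi>)\<close>.  At points, with \<open>h\<close> in place of all \<open>h\<^sub>i\<close>, it is
  \<open>a \<mapsto> \<eta>(a,h,h\<^sup>-\<^sup>1) \<phi>(h\<^sup>-\<^sup>1ah)\<close>.
\<close>

definition w_form :: "'h \<Rightarrow> 'h \<Rightarrow> 'h \<Rightarrow> 'h \<Rightarrow> ('h \<Rightarrow> 'k) \<Rightarrow> 'h \<Rightarrow> 'k" where
  "w_form h1 h2 h3 h4 \<phi> a = cop2 H a (\<lambda>a1 a2. \<eta> a1 h1 (S h2) * \<phi> (S h4 * a2 * h3))"

lemma lin_w_form: "lin \<phi> \<Longrightarrow> lin (w_form h1 h2 h3 h4 \<phi>)"
  unfolding w_form_def
  by (intro lin_intros; (rule trilin_app[OF trilin_eta] | erule lin_app); intro lin_intros)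

lemma w_map_eq:
  assumes t: "t \<in> carrier (H \<otimes> D)"
  shows "w_map H \<omega> t = tlift H D t (\<lambda>h \<phi>. cop5 H h (\<lambda>h1 h2 h3 h4 h5. tens D H (w_form h1 h2 h3 h4 \<phi>) h5))"
  unfolding w_map_def eta_eq D_simps H_simps
proof (rule tlift_cong_mem[OF t])
  fix h \<phi> assume "\<phi> \<in> carrier D"
  then have \<phi>: "lin \<phi>" by simp
  let ?\<xi> = "\<lambda>h3 h4. ract_dual H (lact_dual H h3 \<phi>) (S h4)"
  have \<xi>: "?\<xi> h3 h4 = (\<lambda>a. \<phi> (S h4 * a * h3))" "lin (?\<xi> h3 h4)" for h3 h4
    using \<phi> by (auto simp: ract_dual_def lact_dual_def intro!: lin_app[OF \<phi>] lin_intros)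
  have wp: "tlift3 D \<Phi> (\<lambda>\<omega>1 \<omega>2 \<omega>3. (\<lambda>h. (\<omega>2 h1 * \<omega>3 (S h2)) * conv H \<omega>1 (?\<xi> h3 h4) h)) = w_form h1 h2 h3 h4 \<phi>" for h1 h2 h3 h4
  proof (rule ext)
    fix a
    have "tlift3 D \<Phi> (\<lambda>\<omega>1 \<omega>2 \<omega>3. (\<lambda>h. (\<omega>2 h1 * \<omega>3 (S h2)) * conv H \<omega>1 (?\<xi> h3 h4) h)) a
      = cop2 H a (\<lambda>a1 a2. tlift3 D \<Phi> (\<lambda>\<omega>1 \<omega>2 \<omega>3. (\<omega>1 a1 * \<omega>2 h1 * \<omega>3 (S h2)) * ?\<xi> h3 h4 a2))"
      by (simp add: tlift3_def tlift_fun_apply conv_def cop2_mult_left tlift_cop2 ac_simps)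
    then show "tlift3 D \<Phi> (\<lambda>\<omega>1 \<omega>2 \<omega>3. (\<lambda>h. (\<omega>2 h1 * \<omega>3 (S h2)) * conv H \<omega>1 (?\<xi> h3 h4) h)) a = w_form h1 h2 h3 h4 \<phi> a"
      by (simp add: tlift3_mult_right[symmetric] tlift_form3_tensor[OF trilin_eta] w_form_def \<xi>)
  qed
  have L: "lin_map D (D \<otimes> H) (\<lambda>\<psi>. tens D H \<psi> h5)" for h5
    using tens_bilinear[of D H] by (simp add: bilin_map_def)
  show "tlift3 D \<Phi> (\<lambda>\<omega>1 \<omega>2 \<omega>3. cop5 H h (\<lambda>h1 h2 h3 h4 h5. tens D H
      (\<lambda>h. (\<omega>2 h1 * \<omega>3 (S h2)) * conv H \<omega>1 (?\<xi> h3 h4) h) h5))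
    = cop5 H h (\<lambda>h1 h2 h3 h4 h5. tens D H (w_form h1 h2 h3 h4 \<phi>) h5)"
    unfolding cop5_def cop4_def cop3_def tlift3_cop2
    by (intro cop2_cong, subst lin_map_tlift3[OF L span_closed_D Phi_carrier, symmetric])
      (simp_all add: wp lin_mult_right lin_conv \<xi>(2))
qed

lemma w_map_carrier: "t \<in> carrier (H \<otimes> D) \<Longrightarrow> w_map H \<omega> t \<in> carrier (D \<otimes> H)"
  by (simp add: w_map_eq) (intro tlift_closed_tensor cop345_closed tens_carrier; simp add: lin_w_form)

text \<open>
  The element \<open>p\<close> as a bilinear form.
\<close>

definition p_form :: "'h \<Rightarrow> 'h \<Rightarrow> 'k" where
  "p_form x y = tlift D D (p_elt H \<omega>) (\<lambda>p1 p2. p1 x * p2 y)"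

text \<open>
  The second tensor factor of \<open>W(\<phi> # h)\<close>, where the action on \<open>h\<^sub>3\<close> splits it into \<open>p\<close>, \<open>q\<close>, \<open>v\<close> and
  leaves \<open>q\<close> as the first factor.  At points it is \<open>a \<mapsto> p(ha,h\<^sup>-\<^sup>1) \<phi>(hah\<^sup>-\<^sup>1)\<close>.
\<close>

definition W_form :: "'h \<Rightarrow> 'h \<Rightarrow> 'h \<Rightarrow> 'h \<Rightarrow> ('h \<Rightarrow> 'k) \<Rightarrow> 'h \<Rightarrow> 'k" where
  "W_form h1 h2 p v \<phi> a = cop2 H a (\<lambda>a1 a2. p_form (h1 * a1) (S h2) * \<phi> (v * a2 * S p))"

lemma p_elt_carrier: "p_elt H \<omega> \<in> carrier (D \<otimes> D)"
  unfolding p_elt_def D_simps antipode_dual_hopf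
  by (rule tlift3_closed[OF span_closed_DD Psi_carrier]) (intro tens_DD lin_K)

lemma lin_p_form: "lin (\<lambda>x. p_form x y)" "lin (\<lambda>y. p_form x y)"
  unfolding p_form_def
  by (rule linear_tlift[OF p_elt_carrier vector_space_field]; auto intro!: lin_intros)+

lemma lin_W_form: "lin \<phi> \<Longrightarrow> lin (W_form h1 h2 p v \<phi>)"
  unfolding W_form_def
  by (intro lin_intros; (rule lin_app[OF lin_p_form(1)] | erule lin_app); intro lin_intros)

lemma tlift_p_elt:
  "tlift D D (p_elt H \<omega>) (\<lambda>p1 p2. tlift D D (dcomult p1) (\<lambda>p11 p12. p11 x * p12 y) * p2 z) = p_form (x * y) z"
  unfolding p_form_def
  by (rule tlift_cong_mem[OF p_elt_carrier]) (simp add: tlift_dcomult)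

text \<open>
  Both sides are compared through their coefficients: the comultiplications of \<open>\<phi>\<close> and \<open>p\<^sup>1\<close> merge into
  products of arguments, and the actions on \<open>h\<^sub>3\<close> become further Sweedler sums.
\<close>

lemma W_map_eq:
  assumes t: "t \<in> carrier (D \<otimes> H)"
  shows "W_map H \<omega> t = tlift D H t (\<lambda>\<phi> h. cop3 H h (\<lambda>h1 h2 h3. cop2 H h3 (\<lambda>u v. cop2 H u (\<lambda>p q.
    tens H D q (W_form h1 h2 p v \<phi>)))))"
  unfolding W_map_def
proof (rule tlift_cong_mem[OF t])
  fix \<phi> h assume "\<phi> \<in> carrier D"
  then have \<phi>: "lin \<phi>" by simp
  let ?t = "\<lambda>p1 p2 p11 p12 \<phi>1 \<phi>2 \<phi>3. cop3 H h (\<lambda>h1 h2 h3. tens H D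
     (scl (p11 h1 * p2 (S h2)) (ract H (lact H \<phi>1 h3) (\<lambda>h. \<phi>3 (S h)))) (conv H p12 \<phi>2))"
  let ?l = "tlift D D (p_elt H \<omega>) (\<lambda>p1 p2. tlift D D (dcomult p1) (\<lambda>p11 p12. tlift D D (dcomult \<phi>) (\<lambda>\<phi>1 u.
      tlift D D (dcomult u) (\<lambda>\<phi>2 \<phi>3. ?t p1 p2 p11 p12 \<phi>1 \<phi>2 \<phi>3))))"
  let ?r = "cop3 H h (\<lambda>h1 h2 h3. cop2 H h3 (\<lambda>u v. cop2 H u (\<lambda>p q. tens H D q (W_form h1 h2 p v \<phi>))))"
  have "?l = ?r"
  proof (rule HD_eqI)
    show "?l \<in> carrier (H \<otimes> D)"
      by (intro tlift_closed_tensor p_elt_carrier dcomult_carrier cop345_closed tens_carrier)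
        (simp_all add: \<phi> lin_conv)
    show "?r \<in> carrier (H \<otimes> D)"
      by (intro cop345_closed cop2_closed tens_carrier) (simp_all add: lin_W_form \<phi>)
    fix a \<chi> assume \<chi>: "lin \<chi>"
    \<comment> \<open>The legs of \<open>p\<^sup>1\<close> and of \<open>\<phi>\<close> are evaluated at separate arguments and recombine.\<close>
    have inner: "tlift D D (p_elt H \<omega>) (\<lambda>p1 p2. tlift D D (dcomult p1) (\<lambda>p11 p12. tlift D D (dcomult \<phi>) (\<lambda>\<phi>1 u.
        tlift D D (dcomult u) (\<lambda>\<phi>2 \<phi>3. p11 h1 * p2 (S h2) * (\<phi>1 v * \<phi>3 (S p) * \<chi> q) * (p12 a1 * \<phi>2 a2)))))
      = p_form (h1 * a1) (S h2) * \<phi> (v * a2 * S p) * \<chi> q" for h1 h2 v p q a1 a2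
    proof -
      have "p11 h1 * p2 (S h2) * (\<phi>1 v * \<phi>3 (S p) * \<chi> q) * (p12 a1 * \<phi>2 a2)
        = ((p11 h1 * p12 a1) * p2 (S h2)) * ((\<phi>1 v * (\<phi>2 a2 * \<phi>3 (S p))) * \<chi> q)" for p11 p2 \<phi>1 \<phi>3 p12 \<phi>2 :: "'h \<Rightarrow> 'k"
        by (simp only: ac_simps)
      then show ?thesis
        by (simp only: tlift_mult_left[symmetric] tlift_mult_right[symmetric] tlift_dcomult3(1)[OF \<phi>] tlift_p_elt)
          (simp only: mult.assoc)
    qed
    have outer: "\<chi> (scl c (ract H (lact H \<phi>1 h3) (\<lambda>h. \<phi>3 (S h)))) * x
      = cop2 H h3 (\<lambda>u v. cop2 H u (\<lambda>p q. c * (\<phi>1 v * \<phi>3 (S p) * \<chi> q) * x))" if "lin \<phi>3" for c x \<phi>1 \<phi>3 h3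
      by (simp add: linear_imp_hom(2)[OF \<chi>] lin_ract_lact[OF \<chi> lin_antipode[OF that]] cop2_mult_left cop2_mult_right)
    have "?l (\<lambda>h \<phi>. \<chi> h * \<phi> a) = tlift D D (p_elt H \<omega>) (\<lambda>p1 p2. tlift D D (dcomult p1) (\<lambda>p11 p12. tlift D D (dcomult \<phi>) (\<lambda>\<phi>1 u.
      tlift D D (dcomult u) (\<lambda>\<phi>2 \<phi>3. cop3 H h (\<lambda>h1 h2 h3. \<chi>
     (scl (p11 h1 * p2 (S h2)) (ract H (lact H \<phi>1 h3) (\<lambda>h. \<phi>3 (S h)))) * (conv H p12 \<phi>2) a)))))"
      by (simp only: tlift_fun_apply cop3_def cop2_apply tens_eq_apply[OF bilin_HD[OF \<chi>]])
    also have "\<dots> = tlift D D (p_elt H \<omega>) (\<lambda>p1 p2. tlift D D (dcomult p1) (\<lambda>p11 p12. tlift D D (dcomult \<phi>) (\<lambda>\<phi>1 u.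
      tlift D D (dcomult u) (\<lambda>\<phi>2 \<phi>3. cop3 H h (\<lambda>h1 h2 h3. cop2 H h3 (\<lambda>u v. cop2 H u (\<lambda>p q. cop2 H a (\<lambda>a1 a2.
        p11 h1 * p2 (S h2) * (\<phi>1 v * \<phi>3 (S p) * \<chi> q) * (p12 a1 * \<phi>2 a2)))))))))"
      by (rule tlift_cong_mem[OF p_elt_carrier], rule dcomult_cong, simp, rule dcomult_cong[OF \<phi>], rule dcomult_cong, simp)
        (simp only: outer, simp only: conv_def cop2_mult_left)
    also have "\<dots> = cop3 H h (\<lambda>h1 h2 h3. cop2 H h3 (\<lambda>u v. cop2 H u (\<lambda>p q. cop2 H a (\<lambda>a1 a2.
        p_form (h1 * a1) (S h2) * \<phi> (v * a2 * S p) * \<chi> q))))"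
      by (simp only: cop3_def tlift_cop2 inner)
    also have "\<dots> = ?r (\<lambda>h \<phi>. \<chi> h * \<phi> a)"
      by (simp only: cop3_def cop2_apply tens_eq_apply[OF bilin_HD[OF \<chi>]] W_form_def cop2_mult_left)
        (simp only: mult.commute)
    finally show "?l (\<lambda>h \<phi>. \<chi> h * \<phi> a) = ?r (\<lambda>h \<phi>. \<chi> h * \<phi> a)" .
  qed
  then show "tlift D D (p_elt H \<omega>) (\<lambda>p1 p2. cop2 (dual_hopf H) p1 (\<lambda>p1_1 p1_2. cop3 (dual_hopf H) \<phi> (\<lambda>\<phi>1 \<phi>2 \<phi>3.
       cop3 H h (\<lambda>h1 h2 h3. tens H D (scale H (p1_1 h1 * p2 (antipode H h2))
             (ract H (lact H \<phi>1 h3) (antipode (dual_hopf H) \<phi>3))) (p1_2 \<cdot>\<^bsub>D\<^esub> \<phi>2))))) = ?r"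
    by (simp add: cop3_def[of "dual_hopf H"])
qed

lemma W_map_carrier: "t \<in> carrier (D \<otimes> H) \<Longrightarrow> W_map H \<omega> t \<in> carrier (H \<otimes> D)"
  by (simp add: W_map_eq) (intro tlift_closed_tensor cop345_closed cop2_closed tens_carrier; simp add: lin_W_form)

end

context fd_cocommutative_hopf_algebra
begin

lemma tlift5_cong_mem:
  assumes "t \<in> carrier (D \<otimes> D \<otimes> D \<otimes> D \<otimes> D)"
    and "\<And>a b c d e. lin a \<Longrightarrow> lin b \<Longrightarrow> lin c \<Longrightarrow> lin d \<Longrightarrow> lin e \<Longrightarrow> F a b c d e = G a b c d e"
  shows "tlift5 D t F = tlift5 D t G"
  unfolding tlift5_def
  by (rule tlift_cong_mem[OF assms(1)], rule tlift_cong_mem, assumption, rule tlift3_cong_mem, assumption)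
    (simp_all add: assms(2))

lemma tlift5_closed_tensor:
  assumes "t \<in> carrier (D \<otimes> D \<otimes> D \<otimes> D \<otimes> D)"
    and "\<And>a b c d e. lin a \<Longrightarrow> lin b \<Longrightarrow> lin c \<Longrightarrow> lin d \<Longrightarrow> lin e \<Longrightarrow> F a b c d e \<in> carrier (V \<otimes> W)"
  shows "tlift5 D t F \<in> carrier (V \<otimes> W)"
  unfolding tlift5_def tlift3_def
  by (rule tlift_closed_tensor[OF assms(1)], rule tlift_closed_tensor, assumption,
      rule tlift_closed_tensor, assumption, rule tlift_closed_tensor, assumption) (simp add: assms(2))

lemma tlift5_cop2:
  "tlift5 D t (\<lambda>a b c d e. cop2 H h (\<lambda>x y. G a b c d e x y)) = cop2 H h (\<lambda>x y. tlift5 D t (\<lambda>a b c d e. G a b c d e x y))"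
  unfolding tlift5_def tlift3_cop2 tlift_cop2 ..

lemma tlift5_apply: "tlift5 D t F x = tlift5 D t (\<lambda>a b c d e. F a b c d e x)"
  unfolding tlift5_def tlift3_def tlift_fun_apply ..

lemma tlift5_mult_right: "tlift5 D t F * (k::'k) = tlift5 D t (\<lambda>a b c d e. F a b c d e * k)"
  unfolding tlift5_def by (simp only: tlift_mult_right tlift3_mult_right)

lemma linear_tlift5:
  assumes "t \<in> carrier (D \<otimes> D \<otimes> D \<otimes> D \<otimes> D)"
    and "\<And>a b c d e. lin a \<Longrightarrow> lin b \<Longrightarrow> lin c \<Longrightarrow> lin d \<Longrightarrow> lin e \<Longrightarrow> lin (\<lambda>x. F x a b c d e)"
  shows "lin (\<lambda>x. tlift5 D t (F x))"
  unfolding tlift5_def tlift3_def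
  by (rule linear_tlift[OF assms(1) vector_space_field], rule linear_tlift[OF _ vector_space_field], assumption,
      rule linear_tlift[OF _ vector_space_field], assumption, rule linear_tlift[OF _ vector_space_field], assumption)
    (simp add: assms(2))

lemma tens_H_K [simp]: "tens H (K \<omega>) = tens H D" "H \<otimes> K \<omega> = H \<otimes> D"
  by (rule tens_cong tensor_sp_cong; simp)+

lemma lin_cop2_app:
  assumes "\<And>a. lin (M a)" "\<And>b. lin (\<lambda>a. M a b)" "linH f"
  shows "lin (\<lambda>x. cop2 H (f x) M)"
  by (rule lin_app[OF lin_cop2[OF assms(1,2)] assms(3)])

end

context cocycle_points
begin

text \<open>
  The element \<open>\<Omega>\<close> as a multilinear form.
\<close>

definition Omega_form :: "'h \<Rightarrow> 'h \<Rightarrow> 'h \<Rightarrow> 'h \<Rightarrow> 'h \<Rightarrow> 'k" where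
  "Omega_form x1 x2 x3 x4 x5 = tlift5 D (Omega_elt (K \<omega>)) (\<lambda>a b c d e. a x1 * (b x2 * (c x3 * (d x4 * e x5))))"

lemma lin_Omega_form:
  "lin (\<lambda>x. Omega_form x x2 x3 x4 x5)" "lin (\<lambda>x. Omega_form x1 x x3 x4 x5)" "lin (\<lambda>x. Omega_form x1 x2 x x4 x5)"
  "lin (\<lambda>x. Omega_form x1 x2 x3 x x5)" "lin (\<lambda>x. Omega_form x1 x2 x3 x4 x)"
  unfolding Omega_form_def by (rule linear_tlift5[OF Omega_carrier]; intro lin_mult_left lin_mult_right; assumption)+

lemmas lin_Omega_form_app = lin_Omega_form[THEN lin_app]

text \<open>
  The second tensor factor of \<open>(h \<bowtie> \<phi>)(h' \<bowtie> \<phi>')\<close>, where the actions on \<open>h\<close> and \<open>h'\<close> split off \<open>p\<close>, \<open>v\<close> and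
  \<open>p'\<close>, \<open>v'\<close>.  At points it is \<open>c \<mapsto> \<Omega>(h,h',c,h',h) \<phi>(h'ch'\<^sup>-\<^sup>1) \<phi>'(c)\<close>.
\<close>

definition diag_form :: "'h \<Rightarrow> 'h \<Rightarrow> 'h \<Rightarrow> 'h \<Rightarrow> ('h \<Rightarrow> 'k) \<Rightarrow> ('h \<Rightarrow> 'k) \<Rightarrow> 'h \<Rightarrow> 'k" where
  "diag_form p v p' v' \<phi> \<phi>' a = cop2 H v' (\<lambda>v1 v2. cop2 H p' (\<lambda>p1 p2. cop2 H a (\<lambda>w a3. cop2 H w (\<lambda>a1 a2.
     Omega_form v v1 a1 p2 p * \<phi> (v2 * a2 * S p1) * \<phi>' a3))))"

lemma lin_diag_form: "lin \<phi> \<Longrightarrow> lin \<phi>' \<Longrightarrow> lin (diag_form p v p' v' \<phi> \<phi>')"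
proof -
  assume "lin \<phi>" "lin \<phi>'"
  note li = lin_intros lin_Omega_form_app lin_app[OF \<open>lin \<phi>\<close>] lin_app[OF \<open>lin \<phi>'\<close>]
  show ?thesis unfolding diag_form_def by (intro li)
qed

text \<open>
  As for \<open>W\<close>, the coefficients are compared.  The convolutions produced by \<open>\<Omega>\<^sup>2 b\<^sub>(\<^sub>1\<^sub>,\<^sub>1\<^sub>)\<close>,
  \<open>\<Omega>\<^sup>3 b\<^sub>(\<^sub>1\<^sub>,\<^sub>2\<^sub>) b'\<close> and \<open>S\<^sup>-\<^sup>1(b\<^sub>2) \<Omega>\<^sup>4\<close> unfold into Sweedler sums, after which the legs of \<open>\<Omega>\<close> recombine to
  its form and the legs of \<open>b\<close> to \<open>\<phi>\<close>.
\<close>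

lemma diag_mult_eq:
  assumes t: "t \<in> carrier (H \<otimes> D)" and t': "t' \<in> carrier (H \<otimes> D)"
  shows "t \<cdot>\<^bsub>diag_crossed_product_dual H \<omega>\<^esub> t' = tlift H D t (\<lambda>h \<phi>. tlift H D t' (\<lambda>h' \<phi>'.
    cop2 H h (\<lambda>u v. cop2 H u (\<lambda>p q. cop2 H h' (\<lambda>u' v'. cop2 H u' (\<lambda>p' q'.
      tens H D (q * q') (diag_form p v p' v' \<phi> \<phi>')))))))"
  unfolding diag_crossed_product_dual_def diag_crossed_product_def alg.simps K_tlift_simps tlift5_K tens_H_K H_simps K_simps cop2_K
proof (rule tlift_cong_mem[OF t], rule tlift_cong_mem[OF t'])
  fix h \<phi> h' \<phi>' assume "\<phi> \<in> carrier D" "\<phi>' \<in> carrier D"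
  then have \<phi>: "lin \<phi>" and \<phi>': "lin \<phi>'" by simp_all
  let ?\<Omega> = "Omega_elt (K \<omega>)"
  let ?u = "\<lambda>\<Omega>1 \<Omega>2 \<Omega>4 \<Omega>5 b11 b2. ract H (lact H \<Omega>1 h) \<Omega>5 * ract H (lact H (conv H \<Omega>2 b11) h')
        (conv H (antipode_inv (K \<omega>) b2) \<Omega>4)"
  let ?l = "tlift5 D ?\<Omega> (\<lambda>\<Omega>1 \<Omega>2 \<Omega>3 \<Omega>4 \<Omega>5. tlift D D (dcomult \<phi>) (\<lambda>b1 b2. tlift D D (dcomult b1) (\<lambda>b11 b12.
      tens H D (?u \<Omega>1 \<Omega>2 \<Omega>4 \<Omega>5 b11 b2) (conv H (conv H \<Omega>3 b12) \<phi>'))))"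
  let ?r = "cop2 H h (\<lambda>u v. cop2 H u (\<lambda>p q. cop2 H h' (\<lambda>u' v'. cop2 H u' (\<lambda>p' q'.
      tens H D (q * q') (diag_form p v p' v' \<phi> \<phi>')))))"
  show "?l = ?r"
  proof (rule HD_eqI)
    show "?l \<in> carrier (H \<otimes> D)"
      by (intro tlift5_closed_tensor Omega_carrier tlift_closed_tensor dcomult_carrier tens_carrier)
        (simp_all add: \<phi> \<phi>' lin_conv)
    show "?r \<in> carrier (H \<otimes> D)"
      by (intro cop2_closed tens_carrier) (simp_all add: lin_diag_form \<phi> \<phi>')
    fix a \<chi> assume \<chi>: "lin \<chi>"
    have chi: "\<chi> (ract H (lact H \<Omega>1 h) \<Omega>5 * ract H (lact H \<psi>1 h') \<psi>2) * x
      = cop2 H h (\<lambda>u v. cop2 H u (\<lambda>p q. cop2 H h' (\<lambda>u' v'. cop2 H u' (\<lambda>p' q'.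
          \<Omega>1 v * \<Omega>5 p * (\<psi>1 v' * \<psi>2 p' * \<chi> (q * q')) * x))))"
      if "lin \<Omega>5" "lin \<psi>2" for \<Omega>1 \<Omega>5 \<psi>1 \<psi>2 x
    proof -
      have l: "lin (\<lambda>y. \<chi> (y * r))" "lin (\<lambda>y. \<chi> (r * y))" for r
        by (intro lin_app[OF \<chi>] lin_intros)+
      show ?thesis
        by (simp only: lin_ract_lact[OF l(1) that(1)])
          (simp only: lin_ract_lact[OF l(2) that(2)] cop2_mult_left cop2_mult_right)
    qed
    have expand: "\<chi> (?u \<Omega>1 \<Omega>2 \<Omega>4 \<Omega>5 b11 b2) * conv H (conv H \<Omega>3 b12) \<phi>' a
      = cop2 H h (\<lambda>u v. cop2 H u (\<lambda>p q. cop2 H h' (\<lambda>u' v'. cop2 H u' (\<lambda>p' q'.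
          cop2 H v' (\<lambda>v1 v2. cop2 H p' (\<lambda>p1 p2. cop2 H a (\<lambda>w a3. cop2 H w (\<lambda>a1 a2.
            (\<Omega>1 v * (\<Omega>2 v1 * (\<Omega>3 a1 * (\<Omega>4 p2 * \<Omega>5 p)))) * ((b11 v2 * b12 a2) * b2 (S p1) * (\<phi>' a3 * \<chi> (q * q')))))))))))"
      if "lin \<Omega>4" "lin \<Omega>5" "lin b2" for \<Omega>1 \<Omega>2 \<Omega>3 \<Omega>4 \<Omega>5 b11 b12 b2
    proof -
      have c: "conv H (\<lambda>h. b2 (S h)) \<Omega>4 p' = cop2 H p' (\<lambda>p1 p2. b2 (S p1) * \<Omega>4 p2)" for p'
        by (simp add: conv_def)
      have "\<Omega>1 v * \<Omega>5 p * (conv H \<Omega>2 b11 v' * conv H (\<lambda>h. b2 (S h)) \<Omega>4 p' * \<chi> (q * q')) * conv H (conv H \<Omega>3 b12) \<phi>' a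
        = conv H \<Omega>2 b11 v' * (conv H (\<lambda>h. b2 (S h)) \<Omega>4 p' * (conv H (conv H \<Omega>3 b12) \<phi>' a * (\<Omega>1 v * \<Omega>5 p * \<chi> (q * q'))))"
        for v p v' p' q q' by (simp only: ac_simps)
      also have "\<dots> v p v' p' q q' = cop2 H v' (\<lambda>v1 v2. cop2 H p' (\<lambda>p1 p2. cop2 H a (\<lambda>w a3. cop2 H w (\<lambda>a1 a2.
            (\<Omega>1 v * (\<Omega>2 v1 * (\<Omega>3 a1 * (\<Omega>4 p2 * \<Omega>5 p)))) * ((b11 v2 * b12 a2) * b2 (S p1) * (\<phi>' a3 * \<chi> (q * q')))))))"
        for v p v' p' q q'
        unfolding c unfolding conv_def
        by (simp only: cop2_mult_right) (simp only: cop2_mult_left ac_simps)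
      finally show ?thesis
        by (simp only: antipode_inv_K[OF that(3)] chi[OF that(2) lin_conv[OF lin_antipode[OF that(3)] that(1)]])
    qed
    have K: "tlift5 D ?\<Omega> (\<lambda>\<Omega>1 \<Omega>2 \<Omega>3 \<Omega>4 \<Omega>5. tlift D D (dcomult \<phi>) (\<lambda>b1 b2. tlift D D (dcomult b1) (\<lambda>b11 b12.
        (\<Omega>1 v * (\<Omega>2 v1 * (\<Omega>3 a1 * (\<Omega>4 p2 * \<Omega>5 p)))) * ((b11 v2 * b12 a2) * b2 (S p1) * c))))
      = Omega_form v v1 a1 p2 p * (\<phi> (v2 * a2 * S p1) * c)" for v v1 a1 p2 p v2 a2 p1 c
      by (simp only: tlift_mult_left[symmetric] tlift_mult_right[symmetric] tlift_dcomult3(2)[OF \<phi>]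
          tlift5_mult_right[symmetric] Omega_form_def)
    have "?l (\<lambda>h \<phi>. \<chi> h * \<phi> a) = tlift5 D ?\<Omega> (\<lambda>\<Omega>1 \<Omega>2 \<Omega>3 \<Omega>4 \<Omega>5. tlift D D (dcomult \<phi>) (\<lambda>b1 b2. tlift D D (dcomult b1) (\<lambda>b11 b12.
      \<chi> (?u \<Omega>1 \<Omega>2 \<Omega>4 \<Omega>5 b11 b2) * conv H (conv H \<Omega>3 b12) \<phi>' a)))"
      by (simp only: tlift_fun_apply tlift5_apply tens_eq_apply[OF bilin_HD[OF \<chi>]])
    also have "\<dots> = tlift5 D ?\<Omega> (\<lambda>\<Omega>1 \<Omega>2 \<Omega>3 \<Omega>4 \<Omega>5. tlift D D (dcomult \<phi>) (\<lambda>b1 b2. tlift D D (dcomult b1) (\<lambda>b11 b12.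
       cop2 H h (\<lambda>u v. cop2 H u (\<lambda>p q. cop2 H h' (\<lambda>u' v'. cop2 H u' (\<lambda>p' q'.
          cop2 H v' (\<lambda>v1 v2. cop2 H p' (\<lambda>p1 p2. cop2 H a (\<lambda>w a3. cop2 H w (\<lambda>a1 a2.
            (\<Omega>1 v * (\<Omega>2 v1 * (\<Omega>3 a1 * (\<Omega>4 p2 * \<Omega>5 p)))) * ((b11 v2 * b12 a2) * b2 (S p1) * (\<phi>' a3 * \<chi> (q * q'))))))))))))))"
      by (rule tlift5_cong_mem[OF Omega_carrier], rule dcomult_cong[OF \<phi>], rule dcomult_cong, assumption)
        (simp only: expand)
    also have "\<dots> = cop2 H h (\<lambda>u v. cop2 H u (\<lambda>p q. cop2 H h' (\<lambda>u' v'. cop2 H u' (\<lambda>p' q'.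
          cop2 H v' (\<lambda>v1 v2. cop2 H p' (\<lambda>p1 p2. cop2 H a (\<lambda>w a3. cop2 H w (\<lambda>a1 a2.
            Omega_form v v1 a1 p2 p * (\<phi> (v2 * a2 * S p1) * (\<phi>' a3 * \<chi> (q * q')))))))))))"
      by (simp only: tlift_cop2 tlift5_cop2 K)
    also have "\<dots> = ?r (\<lambda>h \<phi>. \<chi> h * \<phi> a)"
      by (simp only: cop2_apply tens_eq_apply[OF bilin_HD[OF \<chi>]] diag_form_def cop2_mult_left)
        (simp only: ac_simps)
    finally show "?l (\<lambda>h \<phi>. \<chi> h * \<phi> a) = ?r (\<lambda>h \<phi>. \<chi> h * \<phi> a)" .
  qed
qed

text \<open>
  The conjugations in \<open>\<theta>\<close> are Sweedler sums, which multilinearity moves outside \<open>\<omega>\<close> and \<open>\<eta>\<close>.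
\<close>

lemma theta_eq:
  "theta H \<omega> g x y = cop3 H g (\<lambda>g1 g2 g3. cop5 H x (\<lambda>x1 x2 x3 x4 x5. cop4 H y (\<lambda>y1 y2 y3 y4.
     \<omega> g1 x1 y1 * cop2 H (x3 * y3) (\<lambda>p q. \<omega> x2 y2 (S p * g2 * q)) * cop2 H x5 (\<lambda>p q. \<eta> x4 (S p * g3 * q) y4))))"
proof -
  have "\<omega> a b (cop2 H z G) = cop2 H z (\<lambda>p q. \<omega> a b (G p q))" for a b z G
    using trilin_omega by (intro linear_cop2_value) (simp add: trilin_iff)
  moreover have "\<eta> a (cop2 H z G) b = cop2 H z (\<lambda>p q. \<eta> a (G p q) b)" for a b z G
    using trilin_eta by (intro linear_cop2_value[where \<phi> = "\<lambda>z. \<eta> a z b"]) (simp add: trilin_iff)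
  ultimately show ?thesis
    by (simp only: theta_def adj_def eta_eq H_simps)
qed

lemma lin_sigma: "lin (sigma H \<omega> x y)"
  unfolding sigma_def theta_eq cop3_def cop4_def cop5_def
  by (intro lin_intros lin_cop2_app trilin_app[OF trilin_omega] trilin_app[OF trilin_eta])

lemma hopf_mult_eq:
  "t \<cdot>\<^bsub>hopf_crossed_product H \<omega>\<^esub> t' = tlift D H t (\<lambda>\<psi> u. tlift D H t' (\<lambda>\<psi>' u'.
    cop4 H u (\<lambda>u1 u2 u3 u4. cop2 H u' (\<lambda>u1' u2'.
      tens D H (conv H (conv H \<psi> (\<lambda>a. \<psi>' (S u2 * a * u1))) (sigma H \<omega> u3 u1')) (u4 * u2')))))"
  by (simp add: hopf_crossed_product_def ract_dual_def lact_dual_def)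

end

section \<open>The maps and products on points\<close>

context hopf_points
begin

text \<open>
  For the splitting of a group element by its two actions; the copy \<open>q\<close> that survives as a tensor
  factor is placed innermost.
\<close>

lemma ev_cop3_left:
  assumes g: "point g"
    and M: "\<And>b c. linR (\<lambda>a. M a b c)" "\<And>a c. linR (\<lambda>b. M a b c)" "\<And>a b. linR (\<lambda>c. M a b c)"
  shows "ev g (\<lambda>h. cop2 H h (\<lambda>u v. cop2 H u (\<lambda>p q. M p q v))) = ev g (\<lambda>p. ev g (\<lambda>v. ev g (\<lambda>q. M p q v)))" (is "?lhs = _")
proof -
  note li = linear_cop2[where s = scR] linear_cop2_inner[where s = scR] M linR_ev
  have "?lhs = ev g (\<lambda>u. cop2 H u (\<lambda>p q. ev g (\<lambda>v. M p q v)))"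
    by (simp only: ev_cop2_inner[symmetric]) (rule ev_cop2_point[OF g]; intro li)
  also have "\<dots> = ev g (\<lambda>p. ev g (\<lambda>q. ev g (\<lambda>v. M p q v)))"
    by (rule ev_cop2_point[OF g]) (intro li)+
  also have "\<dots> = ev g (\<lambda>p. ev g (\<lambda>v. ev g (\<lambda>q. M p q v)))"
    by (rule ev_cong, rule ev_swap)
  finally show ?thesis .
qed

lemma ev_swap2: "ev f (\<lambda>x. ev g (\<lambda>y. ev h (\<lambda>z. M x y z))) = ev g (\<lambda>y. ev h (\<lambda>z. ev f (\<lambda>x. M x y z)))"
  by (rule trans[OF ev_swap], rule ev_cong, rule ev_swap)

lemma ev_swap4:
  "ev f (\<lambda>x. ev a (\<lambda>y1. ev b (\<lambda>y2. ev c (\<lambda>y3. ev d (\<lambda>y4. M x y1 y2 y3 y4)))))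
    = ev a (\<lambda>y1. ev b (\<lambda>y2. ev c (\<lambda>y3. ev d (\<lambda>y4. ev f (\<lambda>x. M x y1 y2 y3 y4)))))"
  by (rule trans[OF ev_swap2], rule ev_cong, rule ev_cong, rule ev_swap2)

lemma ev_word3:
  assumes "point f" "point g" "point h" and M: "linR M"
  shows "ev f (\<lambda>x. ev g (\<lambda>y. ev h (\<lambda>z. M (x * y * z)))) = ev (f \<star> g \<star> h) M"
proof -
  have "ev (f \<star> g \<star> h) M = ev (f \<star> g) (\<lambda>x. ev h (\<lambda>z. M (x * z)))"
    by (rule ev_pmul[OF M, symmetric])
  also have "\<dots> = ev f (\<lambda>x. ev g (\<lambda>y. ev h (\<lambda>z. M (x * y * z))))"
    by (rule ev_pmul[symmetric]) (intro linR_ev linR_app[OF M] linR_intros)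
  finally show ?thesis by simp
qed

text \<open>
  Conjugation by a point.
\<close>

lemma ev_conj_left:
  assumes f: "point f" and g: "point g" and M: "linR M"
  shows "ev f (\<lambda>p. ev f (\<lambda>q. ev g (\<lambda>a. M (S p * a * q)))) = ev (pinv f \<star> g \<star> f) M" (is "?lhs = _")
proof -
  have "?lhs = ev (pinv f) (\<lambda>p. ev f (\<lambda>q. ev g (\<lambda>a. M (p * a * q))))"
    by (rule ev_pinv[OF _ f]) (intro linR_ev linR_app[OF M] linR_intros)
  also have "\<dots> = ev (pinv f) (\<lambda>p. ev g (\<lambda>a. ev f (\<lambda>q. M (p * a * q))))"
    by (rule ev_cong, rule ev_swap)
  also have "\<dots> = ev (pinv f \<star> g \<star> f) M"
    by (intro ev_word3 point_pinv f g M)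
  finally show ?thesis .
qed

lemma ev_conj_right:
  assumes f: "point f" and g: "point g" and M: "linR M"
  shows "ev f (\<lambda>p. ev f (\<lambda>v. ev g (\<lambda>a. M (v * a * S p)))) = ev (f \<star> g \<star> pinv f) M" (is "?lhs = _")
proof -
  have "?lhs = ev (pinv f) (\<lambda>p. ev f (\<lambda>v. ev g (\<lambda>a. M (v * a * p))))"
    by (rule ev_pinv[OF _ f]) (intro linR_ev linR_app[OF M] linR_intros)
  also have "\<dots> = ev f (\<lambda>v. ev g (\<lambda>a. ev (pinv f) (\<lambda>p. M (v * a * p))))"
    by (rule ev_swap2)
  also have "\<dots> = ev (f \<star> g \<star> pinv f) M"
    by (intro ev_word3 point_pinv f g M)
  finally show ?thesis .
qed

end

context cocycle_points
begin

lemma lin_w_form_args: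
  assumes "lin \<phi>" "linH f"
  shows "lin (\<lambda>x. w_form (f x) h2 h3 h4 \<phi> a)" "lin (\<lambda>x. w_form h1 (f x) h3 h4 \<phi> a)"
    "lin (\<lambda>x. w_form h1 h2 (f x) h4 \<phi> a)" "lin (\<lambda>x. w_form h1 h2 h3 (f x) \<phi> a)" "lin (\<lambda>x. w_form h1 h2 h3 h4 \<phi> (f x))"
  unfolding w_form_def
  by (intro lin_intros lin_cop2_app trilin_app[OF trilin_eta] lin_app[OF assms(1)] assms(2))+

lemma w_form_on_points:
  assumes f: "point f" and g: "point g" and \<phi>: "lin \<phi>"
  shows "ev f (\<lambda>h1. ev f (\<lambda>h2. ev f (\<lambda>h3. ev f (\<lambda>h4. g (w_form h1 h2 h3 h4 \<phi>)))))
    = et g f (pinv f) \<bullet> (pinv f \<star> g \<star> f) \<phi>" (is "?lhs = _")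
proof -
  note li = linR_intros trilin_app[OF trilin_eta] lin_app[OF \<phi>]
  have "?lhs = ev f (\<lambda>h1. ev f (\<lambda>h2. ev g (\<lambda>a1. scR (\<eta> a1 h1 (S h2)) one)))
      \<bullet> ev f (\<lambda>h3. ev f (\<lambda>h4. ev g (\<lambda>a2. scR (\<phi> (S h4 * a2 * h3)) one)))"
    by (simp only: ev_point_one[OF g lin_w_form[OF \<phi>], symmetric] w_form_def, simp add: ev_expand f g li, simp only: ev_split)
  also have "ev f (\<lambda>h1. ev f (\<lambda>h2. ev g (\<lambda>a1. scR (\<eta> a1 h1 (S h2)) one))) = et g f (pinv f)" (is "?l1 = _")
  proof -
    have "?l1
      = ev f (\<lambda>h1. ev (pinv f) (\<lambda>h2. ev g (\<lambda>a1. scR (\<eta> a1 h1 h2) one)))"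
      by (rule ev_cong, rule ev_pinv[OF _ f]) (intro li)
    also have "\<dots> = ev g (\<lambda>a1. ev f (\<lambda>h1. ev (pinv f) (\<lambda>h2. scR (\<eta> a1 h1 h2) one)))"
      by (rule ev_swap2[symmetric])
    finally show ?thesis by (simp add: tri_def)
  qed
  also have "ev f (\<lambda>h3. ev f (\<lambda>h4. ev g (\<lambda>a2. scR (\<phi> (S h4 * a2 * h3)) one))) = (pinv f \<star> g \<star> f) \<phi>" (is "?l1 = _")
  proof -
    have "?l1
      = ev f (\<lambda>h4. ev f (\<lambda>h3. ev g (\<lambda>a2. scR (\<phi> (S h4 * a2 * h3)) one)))"
      by (rule ev_swap)
    also have "\<dots> = ev (pinv f \<star> g \<star> f) (\<lambda>x. scR (\<phi> x) one)"
      by (rule ev_conj_left[OF f g]) (intro linR_scale \<phi>)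
    finally show ?thesis by (simp add: ev_point_one \<phi> f g point_simps)
  qed
  finally show ?thesis .
qed

text \<open>
  The coefficient of \<open>w(h \<bowtie> \<phi>)\<close> at \<open>a\<close> and \<open>\<chi>\<close>.
\<close>

definition w_pair :: "'h \<Rightarrow> ('h \<Rightarrow> 'k) \<Rightarrow> ('h \<Rightarrow> 'k) \<Rightarrow> 'h \<Rightarrow> 'k" where
  "w_pair h \<phi> \<chi> a = cop5 H h (\<lambda>h1 h2 h3 h4 h5. w_form h1 h2 h3 h4 \<phi> a * \<chi> h5)"

lemma w_pair_on_points:
  assumes f: "point f" and g: "point g" and \<phi>: "lin \<phi>" and \<chi>: "lin \<chi>"
  shows "ev f (\<lambda>h. ev g (\<lambda>a. scR (w_pair h \<phi> \<chi> a) one)) = et g f (pinv f) \<bullet> (pinv f \<star> g \<star> f) \<phi> \<bullet> f \<chi>" (is "?lhs = _")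
proof -
  note li = linR_intros lin_w_form_args[OF \<phi>] \<chi>
  have "?lhs = ev f (\<lambda>h1. ev f (\<lambda>h2. ev f (\<lambda>h3. ev f (\<lambda>h4. g (w_form h1 h2 h3 h4 \<phi>))))) \<bullet> f \<chi>"
    unfolding w_pair_def
    by (simp add: ev_expand f g li) (simp only: ev_split ev_point_one[OF g lin_w_form[OF \<phi>]] ev_point_one[OF f \<chi>])
  then show ?thesis by (simp only: w_form_on_points[OF f g \<phi>])
qed

text \<open>
  The value of \<open>p\<close> at points.
\<close>

definition p_pt where "p_pt f g = om f g (pinv g) \<bullet> om g (pinv g) g"

lemma p_form_on_points:
  assumes f: "point f" and g: "point g"
  shows "ev f (\<lambda>x. ev g (\<lambda>y. scR (p_form x y) one)) = p_pt f g" (is "?lhs = _")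
proof -
  have "?lhs = tlift D D (p_elt H \<omega>) (\<lambda>p1 p2. ev f (\<lambda>x. ev g (\<lambda>y. scR (p1 x * p2 y) one)))"
    by (simp only: p_form_def scR_tlift ev_tlift)
  also have "\<dots> = tprod D D f g (p_elt H \<omega>)"
    unfolding tprod_def
    by (rule tlift_cong_mem[OF p_elt_carrier]) (simp add: scR_mult_one ev_mul_left ev_mul_right ev_point_one f g)
  also have "\<dots> = tlift3 D \<Psi> (\<lambda>x1 x2 x3. f x1 \<bullet> (g x2 \<bullet> g (beta_form H \<omega>) \<bullet> pinv g x3))"
    unfolding p_elt_def D_simps antipode_dual_hopf
    by (subst lin_map_tlift3[OF tprod_DD_lin_map[OF f g] span_closed_DD Psi_carrier], intro tens_DD lin_K; (assumption)?)
      (rule tlift3_cong_mem[OF Psi_carrier], simp add: tprod_DD_tens f g lin_K pointD(3) point_antipode)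
  also have "\<dots> = tlift3 D \<Psi> (\<lambda>x1 x2 x3. g (beta_form H \<omega>) \<bullet> (f x1 \<bullet> (g x2 \<bullet> pinv g x3)))"
    by (simp only: mul_ac)
  also have "\<dots> = p_pt f g"
    by (simp only: mul_tlift3_right[symmetric] form3_on_points[OF trilin_omega] f g point_pinv beta_on_points p_pt_def)
      (rule mul_commute)
  finally show ?thesis .
qed

lemma lin_W_form_args:
  assumes "lin \<phi>" "linH f"
  shows "lin (\<lambda>x. W_form (f x) h2 p v \<phi> a)" "lin (\<lambda>x. W_form h1 (f x) p v \<phi> a)"
    "lin (\<lambda>x. W_form h1 h2 (f x) v \<phi> a)" "lin (\<lambda>x. W_form h1 h2 p (f x) \<phi> a)" "lin (\<lambda>x. W_form h1 h2 p v \<phi> (f x))"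
  unfolding W_form_def
  by (intro lin_intros lin_cop2_app lin_p_form[THEN lin_app] lin_app[OF assms(1)] assms(2))+

lemma W_form_on_points:
  assumes f: "point f" and g: "point g" and \<phi>: "lin \<phi>"
  shows "ev f (\<lambda>h1. ev f (\<lambda>h2. ev f (\<lambda>p. ev f (\<lambda>v. g (W_form h1 h2 p v \<phi>)))))
    = p_pt (f \<star> g) (pinv f) \<bullet> (f \<star> g \<star> pinv f) \<phi>" (is "?lhs = _")
proof -
  note li = linR_intros lin_p_form[THEN lin_app] lin_app[OF \<phi>]
  have "?lhs = ev f (\<lambda>h1. ev f (\<lambda>h2. ev g (\<lambda>a1. scR (p_form (h1 * a1) (S h2)) one)))
      \<bullet> ev f (\<lambda>p. ev f (\<lambda>v. ev g (\<lambda>a2. scR (\<phi> (v * a2 * S p)) one)))"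
    by (simp only: ev_point_one[OF g lin_W_form[OF \<phi>], symmetric] W_form_def, simp add: ev_expand f g li, simp only: ev_split)
  also have "ev f (\<lambda>h1. ev f (\<lambda>h2. ev g (\<lambda>a1. scR (p_form (h1 * a1) (S h2)) one))) = p_pt (f \<star> g) (pinv f)" (is "?l1 = _")
  proof -
    have "?l1
      = ev f (\<lambda>h1. ev (pinv f) (\<lambda>h2. ev g (\<lambda>a1. scR (p_form (h1 * a1) h2) one)))"
      by (rule ev_cong, rule ev_pinv[OF _ f]) (intro li)
    also have "\<dots> = ev f (\<lambda>h1. ev g (\<lambda>a1. ev (pinv f) (\<lambda>h2. scR (p_form (h1 * a1) h2) one)))"
      by (rule ev_cong, rule ev_swap)
    also have "\<dots> = ev (f \<star> g) (\<lambda>x. ev (pinv f) (\<lambda>h2. scR (p_form x h2) one))"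
      by (rule ev_pmul) (intro li lin_p_form)
    finally show ?thesis by (simp add: p_form_on_points f g point_simps)
  qed
  also have "ev f (\<lambda>p. ev f (\<lambda>v. ev g (\<lambda>a2. scR (\<phi> (v * a2 * S p)) one))) = (f \<star> g \<star> pinv f) \<phi>"
    by (subst ev_conj_right[OF f g, where M = "\<lambda>x. scR (\<phi> x) one"])
      (simp_all add: ev_point_one \<phi> f g point_simps linR_scale)
  finally show ?thesis .
qed

text \<open>
  The coefficient of \<open>W(\<phi> # h)\<close> at \<open>a\<close> and \<open>\<chi>\<close>.
\<close>

definition W_pair :: "('h \<Rightarrow> 'k) \<Rightarrow> 'h \<Rightarrow> ('h \<Rightarrow> 'k) \<Rightarrow> 'h \<Rightarrow> 'k" where
  "W_pair \<phi> h \<chi> a = cop3 H h (\<lambda>h1 h2 h3. cop2 H h3 (\<lambda>u v. cop2 H u (\<lambda>p q. W_form h1 h2 p v \<phi> a * \<chi> q)))"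

lemma W_pair_on_points:
  assumes f: "point f" and g: "point g" and \<phi>: "lin \<phi>" and \<chi>: "lin \<chi>"
  shows "ev f (\<lambda>h. ev g (\<lambda>a. scR (W_pair \<phi> h \<chi> a) one)) = p_pt (f \<star> g) (pinv f) \<bullet> (f \<star> g \<star> pinv f) \<phi> \<bullet> f \<chi>" (is "?lhs = _")
proof -
  note li = linR_intros lin_W_form_args[OF \<phi>] \<chi>
  have "?lhs = ev f (\<lambda>h1. ev f (\<lambda>h2. ev f (\<lambda>p. ev f (\<lambda>v. g (W_form h1 h2 p v \<phi>))))) \<bullet> f \<chi>"
    unfolding W_pair_def
    by (simp add: ev_expand f g li) (simp only: ev_split ev_point_one[OF g lin_W_form[OF \<phi>]] ev_point_one[OF f \<chi>])
  then show ?thesis by (simp only: W_form_on_points[OF f g \<phi>])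
qed

text \<open>
  The left-hand side is the coefficient of \<open>W(w(h \<bowtie> \<phi>))\<close>.  The conjugations undo each other and the
  scalars \<open>p(ha,h\<^sup>-\<^sup>1)\<close> and \<open>\<eta>(hah\<^sup>-\<^sup>1,h,h\<^sup>-\<^sup>1)\<close> are inverse by \<open>om_et_inverse_map\<close>.
\<close>

lemma W_pair_w_form_on_points:
  assumes f: "point f" and g: "point g" and \<phi>: "lin \<phi>" and \<chi>: "lin \<chi>"
  shows "ev f (\<lambda>h. ev g (\<lambda>a. scR (cop5 H h (\<lambda>h1 h2 h3 h4 h5. W_pair (w_form h1 h2 h3 h4 \<phi>) h5 \<chi> a)) one)) = f \<chi> \<bullet> g \<phi>" (is "?lhs = _")
proof -
  note li = linR_intros lin_w_form_args[OF \<phi>] lin_W_form_args \<chi> lin_p_form[THEN lin_app] lin_cop2_app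
  let ?C = "f \<star> g \<star> pinv f"
  have l: "lin (\<lambda>x. W_pair (w_form x h2 h3 h4 \<phi>) h5 \<chi> a)" "lin (\<lambda>x. W_pair (w_form h1 x h3 h4 \<phi>) h5 \<chi> a)"
    "lin (\<lambda>x. W_pair (w_form h1 h2 x h4 \<phi>) h5 \<chi> a)" "lin (\<lambda>x. W_pair (w_form h1 h2 h3 x \<phi>) h5 \<chi> a)"
    "lin (\<lambda>x. W_pair (w_form h1 h2 h3 h4 \<phi>) x \<chi> a)" for h1 h2 h3 h4 h5 a
    unfolding W_pair_def cop3_def W_form_def by (intro li)+
  have "?lhs
    = ev f (\<lambda>h1. ev f (\<lambda>h2. ev f (\<lambda>h3. ev f (\<lambda>h4. ev f (\<lambda>h5. ev g (\<lambda>a. scR (W_pair (w_form h1 h2 h3 h4 \<phi>) h5 \<chi> a) one))))))"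
    by (simp add: ev_expand f g linR_intros l)
  also have "\<dots> = p_pt (f \<star> g) (pinv f) \<bullet> ev f (\<lambda>h1. ev f (\<lambda>h2. ev f (\<lambda>h3. ev f (\<lambda>h4. ?C (w_form h1 h2 h3 h4 \<phi>))))) \<bullet> f \<chi>"
    by (simp only: W_pair_on_points[OF f g lin_w_form[OF \<phi>] \<chi>] ev_mul_left ev_mul_right)
  also have "\<dots> = (om (f \<star> g) (pinv f) f \<bullet> om (pinv f) f (pinv f) \<bullet> et (f \<star> g \<star> pinv f) f (pinv f)) \<bullet> (g \<phi> \<bullet> f \<chi>)"
    using f g by (simp add: w_form_on_points \<phi> p_pt_def point_simps mul_assoc)
  also have "\<dots> = f \<chi> \<bullet> g \<phi>"
    using f g by (simp only: om_et_inverse_map point_pmul) (simp add: one_mul R_mul pointD(5) mul_commute)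
  finally show ?thesis .
qed

lemma lin_w_pair:
  assumes "lin \<phi>" "lin \<chi>" "linH f"
  shows "lin (\<lambda>h. w_pair (f h) \<phi> \<chi> a)" "lin (\<lambda>a. w_pair h \<phi> \<chi> (f a))"
  unfolding w_pair_def cop5_def cop4_def cop3_def
  by (intro lin_intros lin_cop2_app lin_w_form_args assms)+

text \<open>
  The same for \<open>w(W(\<phi> # h))\<close>; the scalars are now \<open>\<eta>(a,h,h\<^sup>-\<^sup>1)\<close> and \<open>p(ah,h\<^sup>-\<^sup>1)\<close>.
\<close>

lemma w_pair_W_form_on_points:
  assumes f: "point f" and g: "point g" and \<phi>: "lin \<phi>" and \<chi>: "lin \<chi>"
  shows "ev f (\<lambda>h. ev g (\<lambda>a. scR (cop3 H h (\<lambda>h1 h2 h3. cop2 H h3 (\<lambda>u v. cop2 H u (\<lambda>p q.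
      w_pair q (W_form h1 h2 p v \<phi>) \<chi> a)))) one)) = f \<chi> \<bullet> g \<phi>" (is "?lhs = _")
proof -
  note li = linR_intros lin_w_form_args lin_W_form_args[OF \<phi>] \<chi> lin_cop2_app trilin_app[OF trilin_eta]
  let ?C = "pinv f \<star> g \<star> f"
  have l: "lin (\<lambda>x. w_pair q (W_form x h2 p v \<phi>) \<chi> a)" "lin (\<lambda>x. w_pair q (W_form h1 x p v \<phi>) \<chi> a)"
    "lin (\<lambda>x. w_pair q (W_form h1 h2 x v \<phi>) \<chi> a)" "lin (\<lambda>x. w_pair q (W_form h1 h2 p x \<phi>) \<chi> a)"
    "lin (\<lambda>x. w_pair x (W_form h1 h2 p v \<phi>) \<chi> a)" for h1 h2 p v q a
    unfolding w_pair_def cop5_def cop4_def cop3_def w_form_def by (intro li)+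
  have "?lhs
    = ev f (\<lambda>h1. ev f (\<lambda>h2. ev f (\<lambda>p. ev f (\<lambda>v. ev f (\<lambda>q. ev g (\<lambda>a. scR (w_pair q (W_form h1 h2 p v \<phi>) \<chi> a) one))))))"
    by (simp add: ev_expand f g linR_intros l, rule ev_cong, rule ev_cong, rule ev_cong, rule ev_swap)
  also have "\<dots> = et g f (pinv f) \<bullet> ev f (\<lambda>h1. ev f (\<lambda>h2. ev f (\<lambda>p. ev f (\<lambda>v. ?C (W_form h1 h2 p v \<phi>))))) \<bullet> f \<chi>"
    by (simp only: w_pair_on_points[OF f g lin_W_form[OF \<phi>] \<chi>] ev_mul_left ev_mul_right)
  also have "\<dots> = (om (g \<star> f) (pinv f) f \<bullet> om (pinv f) f (pinv f) \<bullet> et (g \<star> f \<star> pinv f) f (pinv f)) \<bullet> (g \<phi> \<bullet> f \<chi>)"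
    using f g by (simp add: W_form_on_points \<phi> p_pt_def point_simps) (simp only: mul_ac)
  also have "\<dots> = f \<chi> \<bullet> g \<phi>"
    using f g by (simp only: om_et_inverse_map point_pmul) (simp add: one_mul R_mul pointD(5) mul_commute)
  finally show ?thesis .
qed

lemma ev5_tlift5: "ev5 g1 g2 g3 g4 g5 t = tlift5 D t (\<lambda>a b c d e. g1 a \<bullet> (g2 b \<bullet> (g3 c \<bullet> (g4 d \<bullet> g5 e))))"
  unfolding ev5_def tprod_def tlift5_def tlift3_def mul_tlift_right ..

lemma Omega_form_on_points:
  assumes g: "point g1" "point g2" "point g3" "point g4" "point g5"
  shows "ev g5 (\<lambda>x5. ev g1 (\<lambda>x1. ev g4 (\<lambda>x4. ev g2 (\<lambda>x2. ev g3 (\<lambda>x3. scR (Omega_form x1 x2 x3 x4 x5) one)))))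
    = Omega_pt g1 g2 g3 g4 g5" (is "?lhs = _")
proof -
  let ?\<Omega> = "Omega_elt (K \<omega>)"
  have sc: "scR (tlift5 D t F) m = tlift5 D t (\<lambda>a b c d e. scR (F a b c d e) m)" for t F m
    by (simp only: tlift5_def tlift3_def scR_tlift)
  have tl: "ev g (\<lambda>x. tlift5 D t (\<lambda>a b c d e. M a b c d e x)) = tlift5 D t (\<lambda>a b c d e. ev g (M a b c d e))" for g t M
    by (simp only: tlift5_def tlift3_def ev_tlift)
  have "?lhs
    = tlift5 D ?\<Omega> (\<lambda>a b c d e. ev g5 (\<lambda>x5. ev g1 (\<lambda>x1. ev g4 (\<lambda>x4. ev g2 (\<lambda>x2. ev g3 (\<lambda>x3.
        scR (a x1 * (b x2 * (c x3 * (d x4 * e x5)))) one))))))"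
    by (simp only: Omega_form_def sc tl)
  also have "\<dots> = tlift5 D ?\<Omega> (\<lambda>a b c d e. g1 a \<bullet> (g2 b \<bullet> (g3 c \<bullet> (g4 d \<bullet> g5 e))))"
    by (rule tlift5_cong_mem[OF Omega_carrier])
      (simp only: scR_mult_one ev_mul_left ev_mul_right ev_point_one g mul_ac)
  finally show ?thesis by (simp only: ev5_tlift5[symmetric] Omega_on_points[OF g])
qed

lemma lin_diag_form_args:
  assumes "lin \<phi>" "lin \<phi>'" "linH f"
  shows "lin (\<lambda>x. diag_form (f x) v p' v' \<phi> \<phi>' a)" "lin (\<lambda>x. diag_form p (f x) p' v' \<phi> \<phi>' a)"
    "lin (\<lambda>x. diag_form p v (f x) v' \<phi> \<phi>' a)" "lin (\<lambda>x. diag_form p v p' (f x) \<phi> \<phi>' a)" "lin (\<lambda>x. diag_form p v p' v' \<phi> \<phi>' (f x))"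
  unfolding diag_form_def
  by (intro lin_intros lin_cop2_app lin_Omega_form_app lin_app[OF assms(1)] lin_app[OF assms(2)] assms(3))+

lemma diag_form_on_points:
  assumes f: "point f" and f': "point f'" and g: "point g" and \<phi>: "lin \<phi>" and \<phi>': "lin \<phi>'"
  shows "ev f (\<lambda>p. ev f (\<lambda>v. ev f' (\<lambda>p'. ev f' (\<lambda>v'. g (diag_form p v p' v' \<phi> \<phi>')))))
    = Omega_pt f f' g f' f \<bullet> (f' \<star> g \<star> pinv f') \<phi> \<bullet> g \<phi>'" (is "?lhs = _")
proof -
  note li = linR_intros lin_Omega_form_app lin_app[OF \<phi>] lin_app[OF \<phi>'] lin_cop2_app
  have "?lhs = ev f (\<lambda>p. ev f (\<lambda>v. ev f' (\<lambda>p2. ev f' (\<lambda>v1. ev g (\<lambda>a1. scR (Omega_form v v1 a1 p2 p) one)))))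
      \<bullet> ev f' (\<lambda>p1. ev f' (\<lambda>v2. ev g (\<lambda>a2. scR (\<phi> (v2 * a2 * S p1)) one))) \<bullet> ev g (\<lambda>a3. scR (\<phi>' a3) one)"
    by (simp only: ev_point_one[OF g lin_diag_form[OF \<phi> \<phi>'], symmetric] diag_form_def, simp add: ev_expand f f' g li,
        simp only: ev_split)
  also have "ev f' (\<lambda>p1. ev f' (\<lambda>v2. ev g (\<lambda>a2. scR (\<phi> (v2 * a2 * S p1)) one))) = (f' \<star> g \<star> pinv f') \<phi>"
    by (subst ev_conj_right[OF f' g, where M = "\<lambda>x. scR (\<phi> x) one"])
      (simp_all add: ev_point_one \<phi> f' g point_simps linR_scale)
  finally show ?thesis by (simp only: Omega_form_on_points f f' g ev_point_one[OF g \<phi>'])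
qed

text \<open>
  The coefficient of \<open>w((h \<bowtie> \<phi>)(h' \<bowtie> \<phi>'))\<close> at \<open>a\<close> and \<open>\<chi>\<close>.
\<close>

definition w_of_diag :: "'h \<Rightarrow> ('h \<Rightarrow> 'k) \<Rightarrow> 'h \<Rightarrow> ('h \<Rightarrow> 'k) \<Rightarrow> ('h \<Rightarrow> 'k) \<Rightarrow> 'h \<Rightarrow> 'k" where
  "w_of_diag h \<phi> h' \<phi>' \<chi> a = cop2 H h (\<lambda>u v. cop2 H u (\<lambda>p q. cop2 H h' (\<lambda>u' v'. cop2 H u' (\<lambda>p' q'.
     w_pair (q * q') (diag_form p v p' v' \<phi> \<phi>') \<chi> a))))"

lemma lin_w_pair_diag_form:
  assumes \<phi>: "lin \<phi>" and \<phi>': "lin \<phi>'" and \<chi>: "lin \<chi>" and F: "linH F"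
  shows "lin (\<lambda>x. w_pair q (diag_form (F x) v p' v' \<phi> \<phi>') \<chi> a)" "lin (\<lambda>x. w_pair q (diag_form p (F x) p' v' \<phi> \<phi>') \<chi> a)"
    "lin (\<lambda>x. w_pair q (diag_form p v (F x) v' \<phi> \<phi>') \<chi> a)" "lin (\<lambda>x. w_pair q (diag_form p v p' (F x) \<phi> \<phi>') \<chi> a)"
    "lin (\<lambda>x. w_pair (F x) (diag_form p v p' v' \<phi> \<phi>') \<chi> a)" "lin (\<lambda>x. w_pair q (diag_form p v p' v' \<phi> \<phi>') \<chi> (F x))"
proof -
  note li = lin_intros lin_diag_form_args[OF \<phi> \<phi>'] \<chi> F
  show "lin (\<lambda>x. w_pair q (diag_form (F x) v p' v' \<phi> \<phi>') \<chi> a)" "lin (\<lambda>x. w_pair q (diag_form p (F x) p' v' \<phi> \<phi>') \<chi> a)"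
    "lin (\<lambda>x. w_pair q (diag_form p v (F x) v' \<phi> \<phi>') \<chi> a)" "lin (\<lambda>x. w_pair q (diag_form p v p' (F x) \<phi> \<phi>') \<chi> a)"
    unfolding w_pair_def cop5_def cop4_def cop3_def w_form_def by (intro li)+
  show "lin (\<lambda>x. w_pair (F x) (diag_form p v p' v' \<phi> \<phi>') \<chi> a)" "lin (\<lambda>x. w_pair q (diag_form p v p' v' \<phi> \<phi>') \<chi> (F x))"
    by (intro lin_w_pair lin_diag_form \<phi> \<phi>' \<chi> F)+
qed

lemma trilin_w_of_diag: "lin \<phi> \<Longrightarrow> lin \<phi>' \<Longrightarrow> lin \<chi> \<Longrightarrow> trilin (\<lambda>h h' a. w_of_diag h \<phi> h' \<phi>' \<chi> a)"
  unfolding trilin_iff w_of_diag_def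
  by (intro conjI allI lin_intros lin_w_pair_diag_form; assumption)

lemma w_of_diag_on_points:
  assumes f: "point f" and f': "point f'" and g: "point g" and \<phi>: "lin \<phi>" and \<phi>': "lin \<phi>'" and \<chi>: "lin \<chi>"
  defines "U \<equiv> f \<star> f'" and "C \<equiv> pinv (f \<star> f') \<star> g \<star> (f \<star> f')"
  shows "tri (\<lambda>h h' a. w_of_diag h \<phi> h' \<phi>' \<chi> a) f f' g
    = et g U (pinv U) \<bullet> Omega_pt f f' C f' f \<bullet> (f' \<star> C \<star> pinv f') \<phi> \<bullet> C \<phi>' \<bullet> U \<chi>" (is "?lhs = _")
proof -
  note li = linR_intros lin_w_pair_diag_form[OF \<phi> \<phi>' \<chi>]
  have U: "point U" and C: "point C" by (simp_all add: U_def C_def f f' g point_simps)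
  let ?M = "\<lambda>p v q p' v' q' a. scR (w_pair (q * q') (diag_form p v p' v' \<phi> \<phi>') \<chi> a) one"
  have "?lhs
    = ev f (\<lambda>h. cop2 H h (\<lambda>u v. cop2 H u (\<lambda>p q. ev f' (\<lambda>h'. cop2 H h' (\<lambda>u' v'. cop2 H u' (\<lambda>p' q'.
        ev g (\<lambda>a. ?M p v q p' v' q' a)))))))"
    unfolding tri_def w_of_diag_def scR_cop2 ev_cop2_inner ..
  also have "\<dots> = ev f (\<lambda>p. ev f (\<lambda>v. ev f (\<lambda>q. ev f' (\<lambda>h'. cop2 H h' (\<lambda>u' v'. cop2 H u' (\<lambda>p' q'.
        ev g (\<lambda>a. ?M p v q p' v' q' a)))))))"
    by (rule ev_cop3_left[OF f]) (intro li)+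
  also have "\<dots> = ev f (\<lambda>p. ev f (\<lambda>v. ev f (\<lambda>q. ev f' (\<lambda>p'. ev f' (\<lambda>v'. ev f' (\<lambda>q'. ev g (\<lambda>a. ?M p v q p' v' q' a)))))))"
    by (rule ev_cong, rule ev_cong, rule ev_cong, rule ev_cop3_left[OF f']) (intro li)+
  also have "\<dots> = ev f (\<lambda>p. ev f (\<lambda>v. ev f' (\<lambda>p'. ev f' (\<lambda>v'. ev f (\<lambda>q. ev f' (\<lambda>q'. ev g (\<lambda>a. ?M p v q p' v' q' a)))))))"
    by (rule ev_cong, rule ev_cong, rule ev_swap2)
  also have "\<dots> = ev f (\<lambda>p. ev f (\<lambda>v. ev f' (\<lambda>p'. ev f' (\<lambda>v'. et g U (pinv U) \<bullet> C (diag_form p v p' v' \<phi> \<phi>') \<bullet> U \<chi>))))"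
  proof (rule ev_cong, rule ev_cong, rule ev_cong, rule ev_cong)
    fix p v p' v'
    have "ev f (\<lambda>q. ev f' (\<lambda>q'. ev g (\<lambda>a. ?M p v q p' v' q' a)))
      = ev U (\<lambda>q. ev g (\<lambda>a. scR (w_pair q (diag_form p v p' v' \<phi> \<phi>') \<chi> a) one))"
      unfolding U_def by (rule ev_pmul) (intro li)
    then show "ev f (\<lambda>q. ev f' (\<lambda>q'. ev g (\<lambda>a. ?M p v q p' v' q' a)))
      = et g U (pinv U) \<bullet> C (diag_form p v p' v' \<phi> \<phi>') \<bullet> U \<chi>"
      by (simp add: w_pair_on_points[OF U g lin_diag_form[OF \<phi> \<phi>'] \<chi>]) (simp add: C_def U_def)
  qed
  also have "\<dots> = et g U (pinv U) \<bullet> (Omega_pt f f' C f' f \<bullet> (f' \<star> C \<star> pinv f') \<phi> \<bullet> C \<phi>') \<bullet> U \<chi>"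
    by (simp only: ev_mul_left ev_mul_right diag_form_on_points[OF f f' C \<phi> \<phi>'])
  finally show ?thesis by (simp only: mul_assoc)
qed

lemma theta_on_points:
  assumes f: "point f" and f': "point f'" and g: "point g"
  shows "ev f (\<lambda>x. ev f' (\<lambda>y. ev g (\<lambda>a. scR (theta H \<omega> a x y) one))) = theta_pt g f f'" (is "?lhs = _")
proof -
  note li = linR_intros trilin_app[OF trilin_omega] trilin_app[OF trilin_eta] lin_cop2_app
  define U where "U = f \<star> f'"
  have U: "point U" by (simp add: U_def f f' point_simps)
  have "?lhs = ev f (\<lambda>x1. ev f' (\<lambda>y1. ev g (\<lambda>a1. scR (\<omega> a1 x1 y1) one)))
    \<bullet> ev f (\<lambda>x2. ev f (\<lambda>x3. ev f' (\<lambda>y2. ev f' (\<lambda>y3. ev g (\<lambda>a2. scR (cop2 H (x3 * y3) (\<lambda>p q. \<omega> x2 y2 (S p * a2 * q))) one)))))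
    \<bullet> ev f (\<lambda>x4. ev f (\<lambda>x5. ev f' (\<lambda>y4. ev g (\<lambda>a3. scR (cop2 H x5 (\<lambda>p q. \<eta> x4 (S p * a3 * q) y4)) one))))"
    unfolding theta_eq
    by (simp add: ev_expand f f' g li)
      (simp add: ev_split ev_expand f f' g li)
  also have "ev f (\<lambda>x1. ev f' (\<lambda>y1. ev g (\<lambda>a1. scR (\<omega> a1 x1 y1) one))) = om g f f'"
    unfolding tri_def by (rule ev_swap2[symmetric])
  also have "ev f (\<lambda>x2. ev f (\<lambda>x3. ev f' (\<lambda>y2. ev f' (\<lambda>y3. ev g (\<lambda>a2. scR (cop2 H (x3 * y3) (\<lambda>p q. \<omega> x2 y2 (S p * a2 * q))) one)))))
    = om f f' (pinv U \<star> g \<star> U)" (is "?l1 = _")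
  proof -
    have "?l1
      = ev f (\<lambda>x2. ev f' (\<lambda>y2. ev f (\<lambda>x3. ev f' (\<lambda>y3. ev g (\<lambda>a2. scR (cop2 H (x3 * y3) (\<lambda>p q. \<omega> x2 y2 (S p * a2 * q))) one)))))"
      by (rule ev_cong, rule ev_swap)
    also have "\<dots> = ev f (\<lambda>x2. ev f' (\<lambda>y2. ev U (\<lambda>z. ev g (\<lambda>a2. scR (cop2 H z (\<lambda>p q. \<omega> x2 y2 (S p * a2 * q))) one))))"
      unfolding U_def by (rule ev_cong, rule ev_cong, rule ev_pmul) (intro li)
    also have "\<dots> = ev f (\<lambda>x2. ev f' (\<lambda>y2. ev U (\<lambda>p. ev U (\<lambda>q. ev g (\<lambda>a2. scR (\<omega> x2 y2 (S p * a2 * q)) one)))))"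
      unfolding scR_cop2 ev_cop2_inner by (rule ev_cong, rule ev_cong, rule ev_cop2_point[OF U]) (intro li)+
    also have "\<dots> = om f f' (pinv U \<star> g \<star> U)"
      unfolding tri_def by (rule ev_cong, rule ev_cong, rule ev_conj_left[OF U g]) (intro li)
    finally show ?thesis .
  qed
  also have "ev f (\<lambda>x4. ev f (\<lambda>x5. ev f' (\<lambda>y4. ev g (\<lambda>a3. scR (cop2 H x5 (\<lambda>p q. \<eta> x4 (S p * a3 * q) y4)) one))))
    = et f (pinv f \<star> g \<star> f) f'" (is "?l1 = _")
  proof -
    have "?l1
      = ev f (\<lambda>x4. ev f (\<lambda>x5. ev g (\<lambda>a3. ev f' (\<lambda>y4. scR (cop2 H x5 (\<lambda>p q. \<eta> x4 (S p * a3 * q) y4)) one))))"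
      by (rule ev_cong, rule ev_cong, rule ev_swap)
    also have "\<dots> = ev f (\<lambda>x4. ev f (\<lambda>p. ev f (\<lambda>q. ev g (\<lambda>a3. ev f' (\<lambda>y4. scR (\<eta> x4 (S p * a3 * q) y4) one)))))"
      unfolding scR_cop2 ev_cop2_inner by (rule ev_cong, rule ev_cop2_point[OF f]) (intro li)+
    also have "\<dots> = et f (pinv f \<star> g \<star> f) f'"
      unfolding tri_def by (rule ev_cong, rule ev_conj_left[OF f g]) (intro li)
    finally show ?thesis .
  qed
  finally show ?thesis by (simp add: theta_pt_def U_def)
qed

text \<open>
  The coefficient of \<open>(\<psi> # u)(\<psi>' # u')\<close> at \<open>a\<close> and \<open>\<chi>\<close>.
\<close>

definition hopf_pair :: "('h \<Rightarrow> 'k) \<Rightarrow> 'h \<Rightarrow> ('h \<Rightarrow> 'k) \<Rightarrow> 'h \<Rightarrow> ('h \<Rightarrow> 'k) \<Rightarrow> 'h \<Rightarrow> 'k" where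
  "hopf_pair \<psi> u \<psi>' u' \<chi> a = cop4 H u (\<lambda>u1 u2 u3 u4. cop2 H u' (\<lambda>u1' u2'.
     conv H (conv H \<psi> (\<lambda>a. \<psi>' (S u2 * a * u1))) (sigma H \<omega> u3 u1') a * \<chi> (u4 * u2')))"

lemma lin_theta:
  assumes "linH F"
  shows "lin (\<lambda>x. theta H \<omega> (F x) y z)" "lin (\<lambda>x. theta H \<omega> y (F x) z)" "lin (\<lambda>x. theta H \<omega> y z (F x))"
  unfolding theta_eq cop3_def cop4_def cop5_def
  by (intro lin_intros lin_cop2_app trilin_app[OF trilin_omega] trilin_app[OF trilin_eta] assms)+

lemma hopf_pair_expand: "hopf_pair \<psi> u \<psi>' u' \<chi> a = cop4 H u (\<lambda>u1 u2 u3 u4. cop2 H u' (\<lambda>u1' u2'.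
     cop2 H a (\<lambda>w a3. cop2 H w (\<lambda>a1 a2. \<psi> a1 * \<psi>' (S u2 * a2 * u1) * theta H \<omega> a3 u3 u1' * \<chi> (u4 * u2')))))"
  unfolding hopf_pair_def conv_def sigma_def by (simp only: cop2_mult_right)

lemma hopf_pair_on_points:
  assumes f: "point f" and f': "point f'" and g: "point g" and \<psi>: "lin \<psi>" and \<psi>': "lin \<psi>'" and \<chi>: "lin \<chi>"
  shows "ev f (\<lambda>u. ev f' (\<lambda>u'. ev g (\<lambda>a. scR (hopf_pair \<psi> u \<psi>' u' \<chi> a) one)))
    = g \<psi> \<bullet> (pinv f \<star> g \<star> f) \<psi>' \<bullet> theta_pt g f f' \<bullet> (f \<star> f') \<chi>" (is "?lhs = _")
proof -
  note li = linR_intros lin_theta lin_app[OF \<psi>] lin_app[OF \<psi>'] lin_app[OF \<chi>] lin_cop2_app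
  have "?lhs = ev g (\<lambda>a1. scR (\<psi> a1) one) \<bullet> ev f (\<lambda>u1. ev f (\<lambda>u2. ev g (\<lambda>a2. scR (\<psi>' (S u2 * a2 * u1)) one)))
      \<bullet> ev f (\<lambda>u3. ev f' (\<lambda>u1'. ev g (\<lambda>a3. scR (theta H \<omega> a3 u3 u1') one))) \<bullet> ev f (\<lambda>u4. ev f' (\<lambda>u2'. scR (\<chi> (u4 * u2')) one))"
    unfolding hopf_pair_expand
    by (simp add: ev_expand f f' g li) (simp only: ev_split)
  also have "ev f (\<lambda>u1. ev f (\<lambda>u2. ev g (\<lambda>a2. scR (\<psi>' (S u2 * a2 * u1)) one))) = (pinv f \<star> g \<star> f) \<psi>'" (is "?l1 = _")
  proof -
    have "?l1
      = ev f (\<lambda>u2. ev f (\<lambda>u1. ev g (\<lambda>a2. scR (\<psi>' (S u2 * a2 * u1)) one)))"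
      by (rule ev_swap)
    also have "\<dots> = ev (pinv f \<star> g \<star> f) (\<lambda>x. scR (\<psi>' x) one)"
      by (rule ev_conj_left[OF f g]) (intro linR_scale \<psi>')
    finally show ?thesis by (simp add: ev_point_one \<psi>' f g point_simps)
  qed
  finally show ?thesis
    by (simp only: theta_on_points[OF f f' g] ev_point_one[OF g \<psi>] pmul_eq[OF f f' \<chi>])
qed

text \<open>
  The coefficient of \<open>w(h \<bowtie> \<phi>) w(h' \<bowtie> \<phi>')\<close> at \<open>a\<close> and \<open>\<chi>\<close>.
\<close>

definition hopf_of_w :: "'h \<Rightarrow> ('h \<Rightarrow> 'k) \<Rightarrow> 'h \<Rightarrow> ('h \<Rightarrow> 'k) \<Rightarrow> ('h \<Rightarrow> 'k) \<Rightarrow> 'h \<Rightarrow> 'k" where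
  "hopf_of_w h \<phi> h' \<phi>' \<chi> a = cop5 H h (\<lambda>h1 h2 h3 h4 h5. cop5 H h' (\<lambda>k1 k2 k3 k4 k5.
     hopf_pair (w_form h1 h2 h3 h4 \<phi>) h5 (w_form k1 k2 k3 k4 \<phi>') k5 \<chi> a))"

lemma lin_hopf_pair_w_form:
  assumes \<phi>: "lin \<phi>" and \<phi>': "lin \<phi>'" and \<chi>: "lin \<chi>" and F: "linH F"
  shows "lin (\<lambda>x. hopf_pair (w_form (F x) h2 h3 h4 \<phi>) u \<psi>' u' \<chi> a)" "lin (\<lambda>x. hopf_pair (w_form h1 (F x) h3 h4 \<phi>) u \<psi>' u' \<chi> a)"
    "lin (\<lambda>x. hopf_pair (w_form h1 h2 (F x) h4 \<phi>) u \<psi>' u' \<chi> a)" "lin (\<lambda>x. hopf_pair (w_form h1 h2 h3 (F x) \<phi>) u \<psi>' u' \<chi> a)"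
    "lin (\<lambda>x. hopf_pair \<psi> u (w_form (F x) h2 h3 h4 \<phi>') u' \<chi> a)" "lin (\<lambda>x. hopf_pair \<psi> u (w_form h1 (F x) h3 h4 \<phi>') u' \<chi> a)"
    "lin (\<lambda>x. hopf_pair \<psi> u (w_form h1 h2 (F x) h4 \<phi>') u' \<chi> a)" "lin (\<lambda>x. hopf_pair \<psi> u (w_form h1 h2 h3 (F x) \<phi>') u' \<chi> a)"
  unfolding hopf_pair_expand cop4_def cop3_def
  by (intro lin_intros lin_cop2_app lin_w_form_args \<phi> \<phi>' F)+

lemma lin_hopf_pair:
  assumes \<psi>: "lin \<psi>" and \<psi>': "lin \<psi>'" and \<chi>: "lin \<chi>" and F: "linH F"
  shows "lin (\<lambda>x. hopf_pair \<psi> (F x) \<psi>' u' \<chi> a)" "lin (\<lambda>x. hopf_pair \<psi> u \<psi>' (F x) \<chi> a)" "lin (\<lambda>x. hopf_pair \<psi> u \<psi>' u' \<chi> (F x))"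
  unfolding hopf_pair_expand cop4_def cop3_def
  by (intro lin_intros lin_cop2_app lin_theta lin_app[OF \<psi>] lin_app[OF \<psi>'] lin_app[OF \<chi>] F)+

lemma trilin_hopf_of_w: "lin \<phi> \<Longrightarrow> lin \<phi>' \<Longrightarrow> lin \<chi> \<Longrightarrow> trilin (\<lambda>h h' a. hopf_of_w h \<phi> h' \<phi>' \<chi> a)"
  unfolding trilin_iff hopf_of_w_def cop5_def cop4_def cop3_def
  by (intro conjI allI lin_intros lin_hopf_pair_w_form lin_hopf_pair lin_w_form; assumption)

lemma hopf_of_w_on_points:
  assumes f: "point f" and f': "point f'" and g: "point g" and \<phi>: "lin \<phi>" and \<phi>': "lin \<phi>'" and \<chi>: "lin \<chi>"
  defines "B \<equiv> pinv f \<star> g \<star> f"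
  shows "tri (\<lambda>h h' a. hopf_of_w h \<phi> h' \<phi>' \<chi> a) f f' g
    = et g f (pinv f) \<bullet> B \<phi> \<bullet> (et B f' (pinv f') \<bullet> (pinv f' \<star> B \<star> f') \<phi>') \<bullet> theta_pt g f f' \<bullet> (f \<star> f') \<chi>" (is "?lhs = _")
proof -
  have B: "point B" by (simp add: B_def f g point_simps)
  note wl = lin_w_form[OF \<phi>] lin_w_form[OF \<phi>']
  note li = linR_intros lin_hopf_pair_w_form[OF \<phi> \<phi>' \<chi>] lin_hopf_pair[OF wl(1) wl(2) \<chi>]
  let ?w = "\<lambda>h1 h2 h3 h4. w_form h1 h2 h3 h4 \<phi>" and ?w' = "\<lambda>k1 k2 k3 k4. w_form k1 k2 k3 k4 \<phi>'"
  let ?M = "\<lambda>h1 h2 h3 h4 h5 k1 k2 k3 k4 k5 a. scR (hopf_pair (?w h1 h2 h3 h4) h5 (?w' k1 k2 k3 k4) k5 \<chi> a) one"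
  have "?lhs = ev f (\<lambda>h1. ev f (\<lambda>h2. ev f (\<lambda>h3. ev f (\<lambda>h4. ev f (\<lambda>h5.
      ev f' (\<lambda>k1. ev f' (\<lambda>k2. ev f' (\<lambda>k3. ev f' (\<lambda>k4. ev f' (\<lambda>k5. ev g (?M h1 h2 h3 h4 h5 k1 k2 k3 k4 k5)))))))))))"
    unfolding tri_def hopf_of_w_def by (simp add: ev_expand f f' g li)
  also have "\<dots> = ev f (\<lambda>h1. ev f (\<lambda>h2. ev f (\<lambda>h3. ev f (\<lambda>h4. 
      ev f' (\<lambda>k1. ev f' (\<lambda>k2. ev f' (\<lambda>k3. ev f' (\<lambda>k4. ev f (\<lambda>h5. ev f' (\<lambda>k5. ev g (?M h1 h2 h3 h4 h5 k1 k2 k3 k4 k5)))))))))))"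
    by (rule ev_cong, rule ev_cong, rule ev_cong, rule ev_cong, rule ev_swap4)
  also have "\<dots> = ev f (\<lambda>h1. ev f (\<lambda>h2. ev f (\<lambda>h3. ev f (\<lambda>h4. g (?w h1 h2 h3 h4)))))
      \<bullet> ev f' (\<lambda>k1. ev f' (\<lambda>k2. ev f' (\<lambda>k3. ev f' (\<lambda>k4. B (?w' k1 k2 k3 k4))))) \<bullet> theta_pt g f f' \<bullet> (f \<star> f') \<chi>"
    by (simp only: hopf_pair_on_points[OF f f' g wl(1) wl(2) \<chi>] B_def[symmetric] ev_mul_left ev_mul_right)
  finally show ?thesis
    by (simp only: w_form_on_points[OF f g \<phi>] w_form_on_points[OF f' B \<phi>'] B_def[symmetric])
qed

text \<open>
  On both sides \<open>\<phi>\<close> is evaluated at \<open>f\<^sup>-\<^sup>1gf\<close>, \<open>\<phi>'\<close> at \<open>(ff')\<^sup>-\<^sup>1g(ff')\<close> and \<open>\<chi>\<close> at \<open>ff'\<close>; the remaining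
  scalars agree by \<open>multiplicative_pt\<close>.
\<close>

lemma w_of_diag_eq_hopf_of_w_on_points:
  assumes f: "point f" and f': "point f'" and g: "point g" and \<phi>: "lin \<phi>" and \<phi>': "lin \<phi>'" and \<chi>: "lin \<chi>"
  shows "tri (\<lambda>h h' a. w_of_diag h \<phi> h' \<phi>' \<chi> a) f f' g = tri (\<lambda>h h' a. hopf_of_w h \<phi> h' \<phi>' \<chi> a) f f' g" (is "?lhs = _")
proof -
  define B where "B = pinv f \<star> g \<star> f"
  define C where "C = pinv (f \<star> f') \<star> g \<star> (f \<star> f')"
  have 1: "f' \<star> C \<star> pinv f' = B" and 2: "pinv f' \<star> B \<star> f' = C"
    by (simp_all add: B_def C_def f f' g point_simps)
  have "?lhs
    = (et g (f \<star> f') (pinv (f \<star> f')) \<bullet> Omega_pt f f' C f' f) \<bullet> (B \<phi> \<bullet> C \<phi>' \<bullet> (f \<star> f') \<chi>)"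
    using w_of_diag_on_points[OF f f' g \<phi> \<phi>' \<chi>] unfolding C_def[symmetric] 1 by (simp only: mul_assoc)
  also have "\<dots> = (et g f (pinv f) \<bullet> et B f' (pinv f') \<bullet> theta_pt g f f') \<bullet> (B \<phi> \<bullet> C \<phi>' \<bullet> (f \<star> f') \<chi>)"
    using multiplicative_pt[OF g f f'] unfolding C_def[symmetric] B_def[symmetric] by simp
  also have "\<dots> = tri (\<lambda>h h' a. hopf_of_w h \<phi> h' \<phi>' \<chi> a) f f' g"
    using hopf_of_w_on_points[OF f f' g \<phi> \<phi>' \<chi>] unfolding B_def[symmetric] 2 by (simp only: mul_ac)
  finally show ?thesis .
qed

end

section \<open>The isomorphism\<close>

context fd_cocommutative_hopf_algebra
begin

text \<open>
  Linear forms on the dual, needed to see that the coefficients are bilinear.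
\<close>

abbreviation dlin :: "(('h \<Rightarrow> 'k) \<Rightarrow> 'k) \<Rightarrow> bool" where "dlin \<equiv> lin_map D base_field"

lemma dlin_eval: "dlin (\<lambda>\<phi>. \<phi> x)"
  and dlin_mult_left: "dlin L \<Longrightarrow> dlin (\<lambda>\<phi>. L \<phi> * c)"
  and dlin_mult_right: "dlin L \<Longrightarrow> dlin (\<lambda>\<phi>. c * L \<phi>)"
  by (auto simp: lin_map_def algebra_simps)

lemma dlin_tlift:
  assumes "\<And>a b. dlin (L a b)"
  shows "dlin (\<lambda>\<phi>. tlift V W t (\<lambda>a b. L a b \<phi>))"
  unfolding lin_map_def
proof (intro conjI ballI allI)
  fix \<phi> \<psi> c assume l: "\<phi> \<in> carrier D" "\<psi> \<in> carrier D"
  have "L a b (\<phi> + \<psi>) = L a b \<phi> + L a b \<psi>" for a b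
    using assms[of a b] l unfolding lin_map_def by blast
  then show "tlift V W t (\<lambda>a b. L a b (\<phi> + \<psi>)) = tlift V W t (\<lambda>a b. L a b \<phi>) + tlift V W t (\<lambda>a b. L a b \<psi>)"
    by (simp only: tlift_add)
next
  fix \<phi> c assume l: "\<phi> \<in> carrier D"
  have "L a b (scale D c \<phi>) = c * L a b \<phi>" for a b
    using assms[of a b] l unfolding lin_map_def base_field_simps by blast
  then show "tlift V W t (\<lambda>a b. L a b (scale D c \<phi>)) = scale base_field c (tlift V W t (\<lambda>a b. L a b \<phi>))"
    by (simp only: tlift_mult_left base_field_simps)
qed simp

lemma dlin_cop2: "(\<And>a b. dlin (L a b)) \<Longrightarrow> dlin (\<lambda>\<phi>. cop2 H h (\<lambda>a b. L a b \<phi>))"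
  unfolding cop2_def by (rule dlin_tlift)

lemmas dlin_intros = dlin_eval dlin_mult_left dlin_mult_right dlin_cop2

lemma bilin_HD_I: "(\<And>\<phi>. lin \<phi> \<Longrightarrow> lin (\<lambda>h. B h \<phi>)) \<Longrightarrow> (\<And>h. dlin (B h)) \<Longrightarrow> bilin_map H D base_field B"
  and bilin_DH_I: "(\<And>\<phi>. lin \<phi> \<Longrightarrow> lin (B' \<phi>)) \<Longrightarrow> (\<And>h. dlin (\<lambda>\<phi>. B' \<phi> h)) \<Longrightarrow> bilin_map D H base_field B'"
  by (auto simp: bilin_map_def lin_map_def[of H] lin_iff)

lemma cop5_tlift: "cop5 H h (\<lambda>x1 x2 x3 x4 x5. tlift V W t (\<lambda>a b. G a b x1 x2 x3 x4 x5))
    = tlift V W t (\<lambda>a b. cop5 H h (\<lambda>x1 x2 x3 x4 x5. G a b x1 x2 x3 x4 x5))"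
  unfolding cop5_def cop4_def cop3_def tlift_cop2 ..

end

context cocycle_points
begin

lemma w_map_apply:
  assumes "t \<in> carrier (H \<otimes> D)" "bilin_map D H base_field B"
  shows "w_map H \<omega> t B = tlift H D t (\<lambda>h \<phi>. cop5 H h (\<lambda>h1 h2 h3 h4 h5. B (w_form h1 h2 h3 h4 \<phi>) h5))"
  by (simp only: w_map_eq[OF assms(1)] tlift_fun_apply cop5_def cop4_def cop3_def cop2_apply tens_eq_apply[OF assms(2)])

lemma W_map_apply:
  assumes "t \<in> carrier (D \<otimes> H)" "bilin_map H D base_field B"
  shows "W_map H \<omega> t B = tlift D H t (\<lambda>\<phi> h. cop3 H h (\<lambda>h1 h2 h3. cop2 H h3 (\<lambda>u v. cop2 H u (\<lambda>p q. B q (W_form h1 h2 p v \<phi>)))))"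
  by (simp only: W_map_eq[OF assms(1)] tlift_fun_apply cop3_def cop2_apply tens_eq_apply[OF assms(2)])

lemma bilin_w_pair: "lin \<chi> \<Longrightarrow> bilin_map H D base_field (\<lambda>h \<phi>. w_pair h \<phi> \<chi> a)"
  by (rule bilin_HD_I, rule lin_w_pair(1)) (simp_all add: linH_id, unfold w_pair_def cop5_def cop4_def cop3_def w_form_def, intro dlin_intros)

lemma bilin_W_pair:
  assumes "lin \<chi>"
  shows "bilin_map D H base_field (\<lambda>\<phi> h. W_pair \<phi> h \<chi> a)"
proof (rule bilin_DH_I)
  show "lin (\<lambda>h. W_pair \<phi> h \<chi> a)" if "lin \<phi>" for \<phi>
    unfolding W_pair_def cop3_def by (intro lin_intros lin_W_form_args that assms)
  show "dlin (\<lambda>\<phi>. W_pair \<phi> h \<chi> a)" for h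
    unfolding W_pair_def cop3_def W_form_def by (intro dlin_intros)
qed

lemma w_map_pair:
  assumes "t \<in> carrier (H \<otimes> D)" "lin \<chi>"
  shows "w_map H \<omega> t (\<lambda>\<phi> h. \<phi> a * \<chi> h) = t (\<lambda>h \<phi>. w_pair h \<phi> \<chi> a)"
  by (simp only: w_map_apply[OF assms(1) bilin_DH[OF assms(2)]] w_pair_def[symmetric] tlift_eq_apply[OF assms(1) bilin_w_pair[OF assms(2)]])

lemma W_map_pair:
  assumes "t \<in> carrier (D \<otimes> H)" "lin \<chi>"
  shows "W_map H \<omega> t (\<lambda>h \<phi>. \<chi> h * \<phi> a) = t (\<lambda>\<phi> h. W_pair \<phi> h \<chi> a)" (is "?lhs = _")
proof -
  have "?lhs = tlift D H t (\<lambda>\<phi> h. W_pair \<phi> h \<chi> a)"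
    by (subst W_map_apply[OF assms(1) bilin_HD[OF assms(2)]]) (simp only: W_pair_def mult.commute)
  then show ?thesis by (simp only: tlift_eq_apply[OF assms(1) bilin_W_pair[OF assms(2)]])
qed

lemma bilin_hopf_pair:
  assumes "lin \<psi>" "lin \<chi>"
  shows "bilin_map D H base_field (\<lambda>\<psi>' u'. hopf_pair \<psi> u \<psi>' u' \<chi> a)"
proof (rule bilin_DH_I)
  show "lin (\<lambda>u'. hopf_pair \<psi> u \<psi>' u' \<chi> a)" if "lin \<psi>'" for \<psi>'
    by (rule lin_hopf_pair(2)[OF assms(1) that assms(2) linH_id])
  show "dlin (\<lambda>\<psi>'. hopf_pair \<psi> u \<psi>' u' \<chi> a)" for u'
    unfolding hopf_pair_expand cop4_def cop3_def by (intro dlin_intros)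
qed

lemma diag_mult_pair:
  assumes t: "t \<in> carrier (H \<otimes> D)" and t': "t' \<in> carrier (H \<otimes> D)" and \<chi>: "lin \<chi>"
  shows "w_map H \<omega> (t \<cdot>\<^bsub>diag_crossed_product_dual H \<omega>\<^esub> t') (\<lambda>\<phi> h. \<phi> a * \<chi> h)
    = tlift H D t (\<lambda>h \<phi>. tlift H D t' (\<lambda>h' \<phi>'. w_of_diag h \<phi> h' \<phi>' \<chi> a))"
    and "t \<cdot>\<^bsub>diag_crossed_product_dual H \<omega>\<^esub> t' \<in> carrier (H \<otimes> D)"
proof -
  show c: "t \<cdot>\<^bsub>diag_crossed_product_dual H \<omega>\<^esub> t' \<in> carrier (H \<otimes> D)"
    unfolding diag_mult_eq[OF t t']
    by (intro tlift_closed_tensor[OF t] tlift_closed_tensor[OF t'] cop2_closed tens_carrier) (simp_all add: lin_diag_form)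
  show "w_map H \<omega> (t \<cdot>\<^bsub>diag_crossed_product_dual H \<omega>\<^esub> t') (\<lambda>\<phi> h. \<phi> a * \<chi> h)
    = tlift H D t (\<lambda>h \<phi>. tlift H D t' (\<lambda>h' \<phi>'. w_of_diag h \<phi> h' \<phi>' \<chi> a))"
    unfolding w_map_pair[OF c \<chi>]
    by (simp only: diag_mult_eq[OF t t'] tlift_fun_apply cop2_apply tens_eq_apply[OF bilin_w_pair[OF \<chi>]] w_of_diag_def)
qed

lemma hopf_mult_pair:
  assumes t: "t \<in> carrier (H \<otimes> D)" and t': "t' \<in> carrier (H \<otimes> D)" and \<chi>: "lin \<chi>"
  shows "(w_map H \<omega> t \<cdot>\<^bsub>hopf_crossed_product H \<omega>\<^esub> w_map H \<omega> t') (\<lambda>\<phi> h. \<phi> a * \<chi> h)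
    = tlift H D t (\<lambda>h \<phi>. tlift H D t' (\<lambda>h' \<phi>'. hopf_of_w h \<phi> h' \<phi>' \<chi> a))"
    and "w_map H \<omega> t \<cdot>\<^bsub>hopf_crossed_product H \<omega>\<^esub> w_map H \<omega> t' \<in> carrier (D \<otimes> H)"
proof -
  note wt = w_map_carrier[OF t] and wt' = w_map_carrier[OF t']
  have l: "lin (conv H (conv H \<psi> (\<lambda>a. \<psi>' (x * a * y))) (sigma H \<omega> u v))" if "lin \<psi>" "lin \<psi>'" for \<psi> \<psi>' x y u v
  proof -
    have "lin (\<lambda>a. \<psi>' (x * a * y))"
      by (rule lin_app[OF that(2)]) (intro linH_mult_left linH_mult_right linH_id)
    then show ?thesis by (intro lin_conv that(1) lin_sigma)
  qed
  show "w_map H \<omega> t \<cdot>\<^bsub>hopf_crossed_product H \<omega>\<^esub> w_map H \<omega> t' \<in> carrier (D \<otimes> H)"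
    unfolding hopf_mult_eq
    by (intro tlift_closed_tensor[OF wt] tlift_closed_tensor[OF wt'] cop345_closed cop2_closed tens_carrier)
      (simp_all add: l)
  define G where "G \<psi> u = tlift H D t' (\<lambda>h' \<phi>'. cop5 H h' (\<lambda>k1 k2 k3 k4 k5. hopf_pair \<psi> u (w_form k1 k2 k3 k4 \<phi>') k5 \<chi> a))" for \<psi> u
  have inner: "tlift D H (w_map H \<omega> t') (\<lambda>\<psi>' u'. hopf_pair \<psi> u \<psi>' u' \<chi> a) = G \<psi> u" if "lin \<psi>" for \<psi> u
    by (simp only: tlift_eq_apply[OF wt' bilin_hopf_pair[OF that \<chi>]] w_map_apply[OF t' bilin_hopf_pair[OF that \<chi>]] G_def)
  have G: "bilin_map D H base_field G"
  proof (rule bilin_DH_I)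
    show "lin (G \<psi>)" if "lin \<psi>" for \<psi>
      unfolding G_def cop5_def cop4_def cop3_def
      by (rule linear_tlift[OF t' vector_space_field]) (intro lin_intros lin_hopf_pair that lin_w_form \<chi>; simp)
    show "dlin (\<lambda>\<psi>. G \<psi> u)" for u
      unfolding G_def cop5_def hopf_pair_expand cop4_def cop3_def by (intro dlin_tlift dlin_intros)
  qed
  have "(w_map H \<omega> t \<cdot>\<^bsub>hopf_crossed_product H \<omega>\<^esub> w_map H \<omega> t') (\<lambda>\<phi> h. \<phi> a * \<chi> h)
    = tlift D H (w_map H \<omega> t) (\<lambda>\<psi> u. tlift D H (w_map H \<omega> t') (\<lambda>\<psi>' u'. hopf_pair \<psi> u \<psi>' u' \<chi> a))"
    by (simp only: hopf_mult_eq tlift_fun_apply cop4_def cop3_def cop2_apply tens_eq_apply[OF bilin_DH[OF \<chi>]] hopf_pair_def)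
  also have "\<dots> = tlift D H (w_map H \<omega> t) G"
    by (rule tlift_cong_mem[OF wt]) (simp add: inner)
  also have "\<dots> = tlift H D t (\<lambda>h \<phi>. cop5 H h (\<lambda>h1 h2 h3 h4 h5. G (w_form h1 h2 h3 h4 \<phi>) h5))"
    by (simp only: tlift_eq_apply[OF wt G] w_map_apply[OF t G])
  also have "\<dots> = tlift H D t (\<lambda>h \<phi>. tlift H D t' (\<lambda>h' \<phi>'. hopf_of_w h \<phi> h' \<phi>' \<chi> a))"
    by (simp only: G_def cop5_tlift hopf_of_w_def)
  finally show "(w_map H \<omega> t \<cdot>\<^bsub>hopf_crossed_product H \<omega>\<^esub> w_map H \<omega> t') (\<lambda>\<phi> h. \<phi> a * \<chi> h)
    = tlift H D t (\<lambda>h \<phi>. tlift H D t' (\<lambda>h' \<phi>'. hopf_of_w h \<phi> h' \<phi>' \<chi> a))" .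
qed

text \<open>
  At the unit of the group \<open>w\<close> is trivial because \<open>\<eta>(a,1,1) = 1\<close>.
\<close>

lemma w_pair_unit_on_points:
  assumes g: "point g" and \<chi>: "lin \<chi>"
  shows "ev g (\<lambda>a. scR (w_pair 1 \<epsilon> \<chi> a) one) = scR (\<chi> 1) one" (is "?lhs = _")
proof -
  have "?lhs = ev pone (\<lambda>h. ev g (\<lambda>a. scR (w_pair h \<epsilon> \<chi> a) one))"
    by (rule ev_pone[symmetric]) (intro linR_intros lin_w_pair lin_counit \<chi> ev_closed g R_scale_one)+
  also have "\<dots> = et g pone pone \<bullet> g \<epsilon> \<bullet> pone \<chi>"
    using w_pair_on_points[OF point_pone g lin_counit \<chi>] g by (simp add: point_simps)
  also have "et g pone pone = one"
    using om_et[of g pone pone] g by (simp add: om_pone point_pone one_mul tri_closed)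
  finally show ?thesis by (simp add: pone_def \<chi> pointD(4)[OF g] one_mul R_one R_scale_one)
qed

end

context fd_cocommutative_hopf_algebra
begin

text \<open>
  The two composites and the two products are compared by coefficients.  These are forms in \<open>h\<close> and \<open>a\<close>
  or in \<open>h\<close>, \<open>h'\<close> and \<open>a\<close>, hence determined by their values at the generic points.
\<close>

lemma w_map_iso:
  assumes \<omega>: "normalized_3_cocycle H \<omega>"
  shows "algebra_iso (diag_crossed_product_dual H \<omega>) (hopf_crossed_product H \<omega>) (w_map H \<omega>)
    \<and> (\<forall>t \<in> carrier (diag_crossed_product_dual H \<omega>). W_map H \<omega> (w_map H \<omega> t) = t)
    \<and> (\<forall>u \<in> carrier (hopf_crossed_product H \<omega>).
         W_map H \<omega> u \<in> carrier (diag_crossed_product_dual H \<omega>) \<and> w_map H \<omega> (W_map H \<omega> u) = u)"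
proof -
  interpret T: cocycle_points where scl = scl and Basis = Basis and \<Delta> = \<Delta> and \<epsilon> = \<epsilon> and S = S
    and scR = scale3 and R = "{F. trilin F}" and mul = mul3 and one = counit3
    and \<omega> = \<omega> and \<eta> = "conv_inverse3 H \<omega>"
    by (intro cocycle_points.intro cocycle_points_axioms.intro hopf_points_trilin H_def)
      (use \<omega> is_conv_inverse3[OF \<omega>] in \<open>simp_all add: H_def\<close>)
  note pts = point_pt1 point_pt2 point_pt3
  let ?A = "diag_crossed_product_dual H \<omega>" and ?B = "hopf_crossed_product H \<omega>"
  let ?w = "w_map H \<omega>" and ?W = "W_map H \<omega>"
  have A [simp]: "carrier ?A = carrier (H \<otimes> D)" "scale ?A = (\<lambda>c t B. c * t B)" "unit ?A = tens H D 1 \<epsilon>"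
    by (simp_all add: diag_crossed_product_dual_def diag_crossed_product_def) (simp add: tensor_sp_def)
  have B [simp]: "carrier ?B = carrier (D \<otimes> H)" "scale ?B = (\<lambda>c t B. c * t B)" "unit ?B = tens D H \<epsilon> 1"
    by (simp_all add: hopf_crossed_product_def) (simp add: tensor_sp_def)
  \<comment> \<open>A bilinear form is made trilinear by a counit in the middle argument.\<close>
  have two: "F = G"
    if "T.ev pt1 (\<lambda>h. T.ev pt3 (\<lambda>a. scale3 (F h a) counit3)) = T.ev pt1 (\<lambda>h. T.ev pt3 (\<lambda>a. scale3 (G h a) counit3))"
      and "\<And>a. lin (\<lambda>h. F h a)" "\<And>h. lin (F h)" "\<And>a. lin (\<lambda>h. G h a)" "\<And>h. lin (G h)" for F G
  proof -
    have e: "T.tri (\<lambda>h y a. F h a * \<epsilon> y) pt1 pt2 pt3 = mul3 (T.ev pt1 (\<lambda>h. T.ev pt3 (\<lambda>a. scale3 (F h a) counit3))) (pt2 \<epsilon>)" for F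
      by (simp only: T.tri_def T.scR_mult_one T.ev_mul_left T.ev_mul_right T.ev_point_one[OF point_pt2 lin_counit])
    have tr: "trilin (\<lambda>h y a. F h a * \<epsilon> y)" if "\<And>a. lin (\<lambda>h. F h a)" "\<And>h. lin (F h)" for F
      unfolding trilin_iff by (intro conjI allI lin_intros that lin_counit)
    have "(\<lambda>h y a. F h a * \<epsilon> y) = (\<lambda>h y a. G h a * \<epsilon> y)"
      using tri_generic[OF tr[OF that(2,3)]] tri_generic[OF tr[OF that(4,5)]] that(1) by (simp only: e)
    then have "F h a * \<epsilon> 1 = G h a * \<epsilon> 1" for h a by (simp only: fun_eq_iff)
    then show "F = G" by (simp add: fun_eq_iff counit_one)
  qed
  have Ww: "?W (?w t) = t" if t: "t \<in> carrier (H \<otimes> D)" for t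
  proof (rule HD_eqI)
    show "?W (?w t) \<in> carrier (H \<otimes> D)" "t \<in> carrier (H \<otimes> D)"
      by (intro T.W_map_carrier T.w_map_carrier t)+
    fix a \<chi> assume \<chi>: "lin \<chi>"
    have eq: "(\<lambda>h a. cop5 H h (\<lambda>h1 h2 h3 h4 h5. T.W_pair (T.w_form h1 h2 h3 h4 \<phi>) h5 \<chi> a)) = (\<lambda>h a. \<chi> h * \<phi> a)" if \<phi>: "lin \<phi>" for \<phi>
    proof (rule two)
      note li = lin_intros lin_cop2_app T.lin_w_form_args[OF \<phi>] \<chi> \<phi> T.lin_p_form[THEN lin_app]
      show "lin (\<lambda>h. cop5 H h (\<lambda>h1 h2 h3 h4 h5. T.W_pair (T.w_form h1 h2 h3 h4 \<phi>) h5 \<chi> a))"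
        "lin (\<lambda>a. cop5 H h (\<lambda>h1 h2 h3 h4 h5. T.W_pair (T.w_form h1 h2 h3 h4 \<phi>) h5 \<chi> a))"
        "lin (\<lambda>h. \<chi> h * \<phi> a)" "lin (\<lambda>a. \<chi> h * \<phi> a)" for h a
        unfolding T.W_pair_def cop5_def cop4_def cop3_def T.W_form_def by (intro li)+
      show "T.ev pt1 (\<lambda>h. T.ev pt3 (\<lambda>a. scale3 (cop5 H h (\<lambda>h1 h2 h3 h4 h5. T.W_pair (T.w_form h1 h2 h3 h4 \<phi>) h5 \<chi> a)) counit3))
        = T.ev pt1 (\<lambda>h. T.ev pt3 (\<lambda>a. scale3 (\<chi> h * \<phi> a) counit3))"
        by (simp only: T.W_pair_w_form_on_points[OF point_pt1 point_pt3 \<phi> \<chi>] T.scR_mult_one T.ev_mul_left T.ev_mul_right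
            T.ev_point_one pts \<phi> \<chi>)
    qed
    have "?W (?w t) (\<lambda>h \<phi>. \<chi> h * \<phi> a)
      = tlift H D t (\<lambda>h \<phi>. cop5 H h (\<lambda>h1 h2 h3 h4 h5. T.W_pair (T.w_form h1 h2 h3 h4 \<phi>) h5 \<chi> a))"
      by (simp only: T.W_map_pair[OF T.w_map_carrier[OF t] \<chi>] T.w_map_apply[OF t T.bilin_W_pair[OF \<chi>]])
    also have "\<dots> = tlift H D t (\<lambda>h \<phi>. \<chi> h * \<phi> a)"
      by (rule tlift_cong_mem[OF t]) (use fun_cong[OF fun_cong[OF eq]] in simp)
    finally show "?W (?w t) (\<lambda>h \<phi>. \<chi> h * \<phi> a) = t (\<lambda>h \<phi>. \<chi> h * \<phi> a)"
      by (simp only: tlift_eq_apply[OF t bilin_HD[OF \<chi>]])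
  qed
  have wW: "?w (?W u) = u" if u: "u \<in> carrier (D \<otimes> H)" for u
  proof (rule DH_eqI)
    show "?w (?W u) \<in> carrier (D \<otimes> H)" "u \<in> carrier (D \<otimes> H)"
      by (intro T.W_map_carrier T.w_map_carrier u)+
    fix a \<chi> assume \<chi>: "lin \<chi>"
    have eq: "(\<lambda>h a. cop3 H h (\<lambda>h1 h2 h3. cop2 H h3 (\<lambda>u v. cop2 H u (\<lambda>p q. T.w_pair q (T.W_form h1 h2 p v \<phi>) \<chi> a))))
      = (\<lambda>h a. \<chi> h * \<phi> a)" if \<phi>: "lin \<phi>" for \<phi>
    proof (rule two)
      note li = lin_intros lin_cop2_app T.lin_W_form_args[OF \<phi>] \<chi> \<phi> trilin_app[OF T.trilin_eta]
      show "lin (\<lambda>h. cop3 H h (\<lambda>h1 h2 h3. cop2 H h3 (\<lambda>u v. cop2 H u (\<lambda>p q. T.w_pair q (T.W_form h1 h2 p v \<phi>) \<chi> a))))"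
        "lin (\<lambda>a. cop3 H h (\<lambda>h1 h2 h3. cop2 H h3 (\<lambda>u v. cop2 H u (\<lambda>p q. T.w_pair q (T.W_form h1 h2 p v \<phi>) \<chi> a))))"
        "lin (\<lambda>h. \<chi> h * \<phi> a)" "lin (\<lambda>a. \<chi> h * \<phi> a)" for h a
        unfolding T.w_pair_def cop5_def cop4_def cop3_def T.w_form_def by (intro li)+
      show "T.ev pt1 (\<lambda>h. T.ev pt3 (\<lambda>a. scale3 (cop3 H h (\<lambda>h1 h2 h3. cop2 H h3 (\<lambda>u v. cop2 H u (\<lambda>p q.
          T.w_pair q (T.W_form h1 h2 p v \<phi>) \<chi> a)))) counit3))
        = T.ev pt1 (\<lambda>h. T.ev pt3 (\<lambda>a. scale3 (\<chi> h * \<phi> a) counit3))"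
        by (simp only: T.w_pair_W_form_on_points[OF point_pt1 point_pt3 \<phi> \<chi>] T.scR_mult_one T.ev_mul_left T.ev_mul_right
            T.ev_point_one pts \<phi> \<chi>)
    qed
    have "?w (?W u) (\<lambda>\<phi> h. \<phi> a * \<chi> h) = tlift D H u (\<lambda>\<phi> h. cop3 H h (\<lambda>h1 h2 h3. cop2 H h3 (\<lambda>u v. cop2 H u (\<lambda>p q.
        T.w_pair q (T.W_form h1 h2 p v \<phi>) \<chi> a))))"
      by (simp only: T.w_map_pair[OF T.W_map_carrier[OF u] \<chi>] T.W_map_apply[OF u T.bilin_w_pair[OF \<chi>]])
    also have "\<dots> = tlift D H u (\<lambda>\<phi> h. \<phi> a * \<chi> h)"
      by (rule tlift_cong_mem[OF u]) (use fun_cong[OF fun_cong[OF eq]] in \<open>simp add: mult.commute\<close>)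
    finally show "?w (?W u) (\<lambda>\<phi> h. \<phi> a * \<chi> h) = u (\<lambda>\<phi> h. \<phi> a * \<chi> h)"
      by (simp only: tlift_eq_apply[OF u bilin_DH[OF \<chi>]])
  qed
  have lin: "lin_map ?A ?B ?w"
    unfolding lin_map_def A B
  proof (intro conjI ballI allI)
    fix t u c assume t: "t \<in> carrier (H \<otimes> D)" and u: "u \<in> carrier (H \<otimes> D)"
    show "?w t \<in> carrier (D \<otimes> H)" by (rule T.w_map_carrier[OF t])
    note tu = tensor_add_carrier[OF t u]
    show "?w (t + u) = ?w t + ?w u"
      by (rule DH_eqI)
        (simp_all add: T.w_map_carrier tu t u tensor_add_carrier[OF T.w_map_carrier[OF t] T.w_map_carrier[OF u]] T.w_map_pair)
  next
    fix t c assume t: "t \<in> carrier (H \<otimes> D)"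
    have ct: "(\<lambda>B. c * t B) \<in> carrier (H \<otimes> D)"
      using tensor_scale_carrier[OF t span_closed_H, of c] by (simp add: tensor_sp_def)
    have cw: "(\<lambda>B. c * ?w t B) \<in> carrier (D \<otimes> H)"
      using tensor_scale_carrier[OF T.w_map_carrier[OF t] span_closed_D, of c] by (simp add: tensor_sp_def)
    show "?w (\<lambda>B. c * t B) = (\<lambda>B. c * ?w t B)"
      by (rule DH_eqI[OF T.w_map_carrier[OF ct] cw]) (simp add: T.w_map_pair ct t)
  qed
  have bij: "bij_betw ?w (carrier ?A) (carrier ?B)"
    by (rule bij_betw_byWitness[where f' = ?W]) (auto simp: Ww wW T.w_map_carrier T.W_map_carrier)
  have mult: "?w (t \<cdot>\<^bsub>?A\<^esub> t') = ?w t \<cdot>\<^bsub>?B\<^esub> ?w t'" if t: "t \<in> carrier (H \<otimes> D)" and t': "t' \<in> carrier (H \<otimes> D)" for t t'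
  proof (rule DH_eqI)
    show "?w (t \<cdot>\<^bsub>?A\<^esub> t') \<in> carrier (D \<otimes> H)"
      by (rule T.w_map_carrier[OF T.diag_mult_pair(2)[OF t t' lin_counit]])
    show "?w t \<cdot>\<^bsub>?B\<^esub> ?w t' \<in> carrier (D \<otimes> H)"
      by (rule T.hopf_mult_pair(2)[OF t t' lin_counit])
    fix a \<chi> assume \<chi>: "lin \<chi>"
    have eq: "T.w_of_diag h \<phi> h' \<phi>' \<chi> a = T.hopf_of_w h \<phi> h' \<phi>' \<chi> a" if \<phi>: "lin \<phi>" and \<phi>': "lin \<phi>'" for h \<phi> h' \<phi>'
    proof -
      have "(\<lambda>h h' a. T.w_of_diag h \<phi> h' \<phi>' \<chi> a) = (\<lambda>h h' a. T.hopf_of_w h \<phi> h' \<phi>' \<chi> a)"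
        using T.w_of_diag_eq_hopf_of_w_on_points[OF pts \<phi> \<phi>' \<chi>]
        by (simp only: tri_generic[OF T.trilin_w_of_diag[OF \<phi> \<phi>' \<chi>]] tri_generic[OF T.trilin_hopf_of_w[OF \<phi> \<phi>' \<chi>]])
      then show ?thesis by (simp only: fun_eq_iff)
    qed
    show "?w (t \<cdot>\<^bsub>?A\<^esub> t') (\<lambda>\<phi> h. \<phi> a * \<chi> h) = (?w t \<cdot>\<^bsub>?B\<^esub> ?w t') (\<lambda>\<phi> h. \<phi> a * \<chi> h)"
      unfolding T.diag_mult_pair(1)[OF t t' \<chi>] T.hopf_mult_pair(1)[OF t t' \<chi>]
      by (rule tlift_cong_mem[OF t], rule tlift_cong_mem[OF t']) (simp add: eq)
  qed
  have unit: "?w (tens H D 1 \<epsilon>) = tens D H \<epsilon> 1"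
  proof (rule DH_eqI)
    have c: "tens H D 1 \<epsilon> \<in> carrier (H \<otimes> D)" by (rule tens_carrier) (simp_all add: lin_counit)
    show "?w (tens H D 1 \<epsilon>) \<in> carrier (D \<otimes> H)" by (rule T.w_map_carrier[OF c])
    show "tens D H \<epsilon> 1 \<in> carrier (D \<otimes> H)" by (rule tens_carrier) (simp_all add: lin_counit)
    fix a \<chi> assume \<chi>: "lin \<chi>"
    have l: "lin (T.w_pair 1 \<epsilon> \<chi>)" using T.lin_w_pair(2)[OF lin_counit \<chi> linH_id] .
    have "pt3 (T.w_pair 1 \<epsilon> \<chi>) = scale3 (\<chi> 1) counit3"
      using T.w_pair_unit_on_points[OF point_pt3 \<chi>] by (simp only: T.ev_point_one[OF point_pt3 l])
    then have "pt3 (T.w_pair 1 \<epsilon> \<chi>) 1 1 a = scale3 (\<chi> 1) counit3 1 1 a" by simp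
    then have "T.w_pair 1 \<epsilon> \<chi> a = \<epsilon> a * \<chi> 1"
      by (simp add: pt3_def l scale3_def counit3_def counit_one)
    then show "?w (tens H D 1 \<epsilon>) (\<lambda>\<phi> h. \<phi> a * \<chi> h) = tens D H \<epsilon> 1 (\<lambda>\<phi> h. \<phi> a * \<chi> h)"
      by (simp only: T.w_map_pair[OF c \<chi>] tens_eq_apply[OF T.bilin_w_pair[OF \<chi>]] tens_eq_apply[OF bilin_DH[OF \<chi>]])
  qed
  show ?thesis
    using lin bij mult unit Ww wW T.W_map_carrier by (simp add: algebra_iso_def)
qed

end

theorem theorem4p1:
  fixes scl :: "'k::field \<Rightarrow> 'h::ring_1 \<Rightarrow> 'h" and Basis :: "'h set"
    and \<Delta> :: "'h \<Rightarrow> ('h, 'h, 'k) tensor" and \<epsilon> :: "'h \<Rightarrow> 'k" and S :: "'h \<Rightarrow> 'h"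
    and \<omega> :: "'h \<Rightarrow> 'h \<Rightarrow> 'h \<Rightarrow> 'k" and H :: "('k, 'h) hopf"
  assumes "fd_cocommutative_hopf_algebra scl Basis \<Delta> \<epsilon> S"
    and "H = hopf_struct scl \<Delta> \<epsilon> S"
    and "normalized_3_cocycle H \<omega>"
  shows "algebra_iso (diag_crossed_product_dual H \<omega>) (hopf_crossed_product H \<omega>) (w_map H \<omega>)
    \<and> (\<forall>t \<in> carrier (diag_crossed_product_dual H \<omega>). W_map H \<omega> (w_map H \<omega> t) = t)
    \<and> (\<forall>u \<in> carrier (hopf_crossed_product H \<omega>).
         W_map H \<omega> u \<in> carrier (diag_crossed_product_dual H \<omega>) \<and> w_map H \<omega> (W_map H \<omega> u) = u)"
  using fd_cocommutative_hopf_algebra.w_map_iso[OF assms(1)] assms(2,3) by blast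

end
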